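(* Let $\vec G_1$ and $\vec G_2$ be the two linear orientations of the Coxeter diagram $s_0\overset{4}{-}s_1-\cdots-s_{n-1}$ of $B_n$ (all arrows pointing in the same direction along the path). Then the set of signed permutations avoiding the signed patterns $-2\,-1$, $2\,-1$, $-2\,3\,1$, $-1\,2\,-3$, $1\,2\,-3$ and $2\,3\,1$ is a sublattice of the weak order on $B_n$ isomorphic to one of $\mathcal C(\vec G_1),\mathcal C(\vec G_2)$, and the set of signed permutations avoiding $-2\,1$, $1\,-2$, $-2\,-1\,-3$, $-1\,3\,-2$, $3\,-1\,2$ and $3\,1\,2$ is a sublattice of the weak order on $B_n$ isomorphic to the other.
   Context: $B_n$: signed permutations $x$ of $\pm[n]$ with $x(-i)=-x(i)$, written in abbreviated notation $x_1,\dots,x_n$ ($x_i=x(i)$); generators $s_0=(-1\ 1)$, $s_i=(i\ i{+}1)(-i{-}1\ {-i})$. Weak order $v\le w$ iff $I(v)\subseteq I(w)$, $I(w)$ the reflections $t$ with $\ell(tw)<\ell(w)$. $\Theta(\vec G)$: smallest lattice congruence of the weak order with $t$ congruent to the element with word $tsts\cdots$ of $m(s,t)-1$ letters for each directed edge $s\to t$ ($m(s_0,s_1)=4$, otherwise $3$); $\mathcal C(\vec G)$ is the quotient lattice. Signed pattern avoidance: for a sequence $(a_1,\dots,a_p)$ of nonzero integers with distinct absolute values, $\mathrm{st}(a_1,\dots,a_p)$ is the signed permutation $y\in B_p$ with $y_i<0$ iff $a_i<0$ and $|y_i|<|y_j|$ iff $|a_i|<|a_j|$. A signed permutation $x$ contains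 the signed pattern $y$ if some subsequence of its abbreviated notation $x_1,\dots,x_n$ has standardization $y$; otherwise it avoids $y$. Patterns are written in abbreviated notation, e.g. $-2\,3\,1$ is the element of $B_3$ with $y_1=-2,y_2=3,y_3=1$. *)

theory Defs
  imports Main
begin

text \<open>A signed permutation of +-[n] is represented as a bijection x of the
integers with x(-i) = -x(i) which fixes every i with |i| > n (and hence 0).
Group multiplication is function composition.\<close>

definition signed_perm :: "nat \<Rightarrow> (int \<Rightarrow> int) \<Rightarrow> bool" where
  "signed_perm n x \<longleftrightarrow> bij x \<and> (\<forall>i. x (- i) = - x i) \<and> (\<forall>i. \<bar>i\<bar> > int n \<longrightarrow> x i = i)"

definition Bn :: "nat \<Rightarrow> (int \<Rightarrow> int) set" where
  "Bn n = {x. signed_perm n x}"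

definition gen :: "nat \<Rightarrow> int \<Rightarrow> int" where
  "gen i = (if i = 0 then (\<lambda>j. if j = 1 then -1 else if j = -1 then 1 else j)
            else (\<lambda>j. if j = int i then int i + 1 else if j = int i + 1 then int i
                      else if j = - int i then - int i - 1 else if j = - int i - 1 then - int i
                      else j))"

definition word_prod :: "nat list \<Rightarrow> int \<Rightarrow> int" where
  "word_prod ws = foldr (\<lambda>i f. gen i \<circ> f) ws id"

definition len :: "nat \<Rightarrow> (int \<Rightarrow> int) \<Rightarrow> nat" where
  "len n w = (LEAST k. \<exists>ws. length ws = k \<and> set ws \<subseteq> {..<n} \<and> word_prod ws = w)"

definition refls :: "nat \<Rightarrow> (int \<Rightarrow> int) set" where
  "refls n = {u \<circ> gen i \<circ> inv u | u i. u \<in> Bn n \<and> i < n}"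

definition invset :: "nat \<Rightarrow> (int \<Rightarrow> int) \<Rightarrow> (int \<Rightarrow> int) set" where
  "invset n w = {t \<in> refls n. len n (t \<circ> w) < len n w}"

definition weak_le :: "nat \<Rightarrow> (int \<Rightarrow> int) \<Rightarrow> (int \<Rightarrow> int) \<Rightarrow> bool" where
  "weak_le n v w \<longleftrightarrow> invset n v \<subseteq> invset n w"

definition weak_join :: "nat \<Rightarrow> (int \<Rightarrow> int) \<Rightarrow> (int \<Rightarrow> int) \<Rightarrow> (int \<Rightarrow> int)" where
  "weak_join n x y = (THE z. z \<in> Bn n \<and> weak_le n x z \<and> weak_le n y z \<and>
      (\<forall>u\<in>Bn n. weak_le n x u \<and> weak_le n y u \<longrightarrow> weak_le n z u))"

definition weak_meet :: "nat \<Rightarrow> (int \<Rightarrow> int) \<Rightarrow> (int \<Rightarrow> int) \<Rightarrow> (int \<Rightarrow> int)" where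
  "weak_meet n x y = (THE z. z \<in> Bn n \<and> weak_le n z x \<and> weak_le n z y \<and>
      (\<forall>u\<in>Bn n. weak_le n u x \<and> weak_le n u y \<longrightarrow> weak_le n u z))"

definition lattice_cong :: "nat \<Rightarrow> ((int \<Rightarrow> int) \<times> (int \<Rightarrow> int)) set \<Rightarrow> bool" where
  "lattice_cong n R \<longleftrightarrow> equiv (Bn n) R \<and>
     (\<forall>x\<in>Bn n. \<forall>y\<in>Bn n. \<forall>z\<in>Bn n. (x, y) \<in> R \<longrightarrow>
        (weak_join n x z, weak_join n y z) \<in> R \<and> (weak_meet n x z, weak_meet n y z) \<in> R)"

text \<open>Coxeter matrix entries for adjacent generators of B_n.\<close>
definition mcox :: "nat \<Rightarrow> nat \<Rightarrow> nat" where
  "mcox s t = (if {s, t} = {0, 1} then 4 else 3)"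

definition alt_word :: "nat \<Rightarrow> nat \<Rightarrow> nat \<Rightarrow> nat list" where
  "alt_word t s k = map (\<lambda>j. if even j then t else s) [0..<k]"

text \<open>Generating pairs of Theta(G): for each directed edge s -> t (pair (s,t)),
t is congruent to the element with word tsts... of m(s,t)-1 letters.\<close>
definition gen_pairs :: "(nat \<times> nat) set \<Rightarrow> ((int \<Rightarrow> int) \<times> (int \<Rightarrow> int)) set" where
  "gen_pairs E = {(gen t, word_prod (alt_word t s (mcox s t - 1))) | s t. (s, t) \<in> E}"

definition Theta :: "nat \<Rightarrow> (nat \<times> nat) set \<Rightarrow> ((int \<Rightarrow> int) \<times> (int \<Rightarrow> int)) set" where
  "Theta n E = \<Inter> {R. lattice_cong n R \<and> gen_pairs E \<subseteq> R}"

definition Cq :: "nat \<Rightarrow> (nat \<times> nat) set \<Rightarrow> (int \<Rightarrow> int) set set" where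
  "Cq n E = Bn n // Theta n E"

definition Cq_le :: "nat \<Rightarrow> (int \<Rightarrow> int) set \<Rightarrow> (int \<Rightarrow> int) set \<Rightarrow> bool" where
  "Cq_le n X Y \<longleftrightarrow> (\<exists>x\<in>X. \<exists>y\<in>Y. weak_le n x y)"

definition orient_up :: "nat \<Rightarrow> (nat \<times> nat) set" where
  "orient_up n = {(i, i + 1) | i. i + 1 < n}"

definition orient_down :: "nat \<Rightarrow> (nat \<times> nat) set" where
  "orient_down n = {(i + 1, i) | i. i + 1 < n}"

definition weak_sublattice :: "nat \<Rightarrow> (int \<Rightarrow> int) set \<Rightarrow> bool" where
  "weak_sublattice n S \<longleftrightarrow> S \<subseteq> Bn n \<and>
     (\<forall>x\<in>S. \<forall>y\<in>S. weak_join n x y \<in> S \<and> weak_meet n x y \<in> S)"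

definition iso_to_Cq :: "nat \<Rightarrow> (int \<Rightarrow> int) set \<Rightarrow> (nat \<times> nat) set \<Rightarrow> bool" where
  "iso_to_Cq n S E \<longleftrightarrow> (\<exists>f. bij_betw f S (Cq n E) \<and>
     (\<forall>x\<in>S. \<forall>y\<in>S. weak_le n x y \<longleftrightarrow> Cq_le n (f x) (f y)))"

definition abbr :: "nat \<Rightarrow> (int \<Rightarrow> int) \<Rightarrow> int list" where
  "abbr n x = map x [1..int n]"

definition st :: "int list \<Rightarrow> int list" where
  "st as = map (\<lambda>a. sgn a * int (card {b \<in> set as. \<bar>b\<bar> \<le> \<bar>a\<bar>})) as"

definition contains :: "nat \<Rightarrow> (int \<Rightarrow> int) \<Rightarrow> int list \<Rightarrow> bool" where
  "contains n x p \<longleftrightarrow> (\<exists>I. st (nths (abbr n x) I) = p)"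

definition avoiding :: "nat \<Rightarrow> int list list \<Rightarrow> (int \<Rightarrow> int) set" where
  "avoiding n ps = {x \<in> Bn n. \<forall>p\<in>set ps. \<not> contains n x p}"

end

theory Submission
  imports Defs
begin

text \<open>In full notation \<open>x(-n), \<dots>, x(-1), x(1), \<dots>, x(n)\<close>, avoiding the first six patterns means that no
  subsequence \<open>b c a\<close> with \<open>a < b < c\<close> and \<open>b > 0\<close> occurs; the other six exclude the same
  subsequences with \<open>b < 0\<close>. A Boolean \<open>\<delta>\<close> selects the sign of \<open>b\<close> and treats both cases at once. The
  condition is a closure property of the inversion set, stable under intersection and under transitive
  closure of unions, which gives the sublattice. The largest such subset of an inversion set is explicit,
  and two elements with the same largest subset have, by a duality under complementation, the same
  smallest containing set of the dual kind; hence having the same largest subset is a lattice congruence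
  that contains the generating pairs, and each of its classes contains exactly one of the permutations in
  question. Conversely, by induction on \<open>c - a\<close>, any lattice congruence containing the generating pairs
  contracts every descent \<open>c a\<close> with such a \<open>b\<close> to its left: whether a cover is contracted depends only on
  the exchanged values \<open>a, c\<close> and on which values between them lie to the left, so a further value can be
  moved next to the pair, where the hexagon (or, in the centre, octagon) reduces \<open>c - a\<close>.\<close>

section \<open>Inversions and the weak order\<close>

text \<open>The main obstacle is the mirror symmetry: a value moves together with its negative. A
  value \<open>e\<close> can be brought next to a descent \<open>c a\<close> only if it differs from
  \<open>- a\<close> and \<open>- c\<close>, and \<open>- e\<close> must not change sides either.
  Hence the induction bottoms out at four kinds of pairs \<open>(a, c)\<close>, up to negation:
  \<open>(i, i + 2)\<close> with \<open>i > 0\<close>, \<open>(- 1, 2)\<close>,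
  \<open>(- 2, 2)\<close> and \<open>(- 1, 3)\<close>. The first three occur inside the generating
  pairs; the last needs an argument of its own.

  Compatibility of the congruence with joins is deduced from compatibility with meets: complementing
  an inversion set reverses the order and exchanges the two values of \<delta>.

  Minimality follows by descending: an element that is not aligned has a congruent lower cover, so
  every class of a competing congruence reaches an aligned element. Intersected with the kernel of
  the projection, the competitor reaches the same aligned element from any two elements of one
  kernel class.\<close>

definition Om :: "nat \<Rightarrow> int set" where
  "Om n = {v. v \<noteq> 0 \<and> \<bar>v\<bar> \<le> int n}"

definition full :: "nat \<Rightarrow> (int \<times> int) set" where
  "full n = {(a, b). a \<in> Om n \<and> b \<in> Om n \<and> a < b}"

text \<open>Inversions are recorded as pairs of values, ranging over the full notation of \<open>x\<close>.\<close>
definition inversions :: "nat \<Rightarrow> (int \<Rightarrow> int) \<Rightarrow> (int \<times> int) set" where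
  "inversions n x = {(a, b) \<in> full n. inv x b < inv x a}"

text \<open>Multiplication by a generator changes an inversion set by exactly one such mirror pair.
  For \<open>a = - b\<close> the two entries coincide, which is the case of
  \<open>gen 0\<close>.\<close>

definition lab :: "int \<Rightarrow> int \<Rightarrow> (int \<times> int) set" where
  "lab a b = {(a, b), (- b, - a)}"

text \<open>The generator \<open>gen i\<close> exchanges the positions \<open>pre i\<close> and \<open>i + 1\<close>, which are
  neighbours in the full notation, where position \<open>0\<close> is skipped.\<close>
definition pre :: "nat \<Rightarrow> int" where
  "pre i = (if i = 0 then - 1 else int i)"

definition swap :: "int \<Rightarrow> int \<Rightarrow> int \<Rightarrow> int" where
  "swap u v = (\<lambda>j. if j = u then v else if j = v then u
                   else if j = - u then - v else if j = - v then - u else j)"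

lemma finite_Om [simp]: "finite (Om n)"
proof -
  have "Om n \<subseteq> {- int n..int n}" by (auto simp: Om_def)
  thus ?thesis using finite_subset by blast
qed

lemma uminus_Om [simp]: "- v \<in> Om n \<longleftrightarrow> v \<in> Om n"
  by (auto simp: Om_def)

lemma Om_nonzero: "v \<in> Om n \<Longrightarrow> v \<noteq> 0"
  by (auto simp: Om_def)

lemma finite_full [simp]: "finite (full n)"
  by (rule finite_subset[of _ "Om n \<times> Om n"]) (auto simp: full_def)

lemma inversions_full: "inversions n x \<subseteq> full n"
  by (auto simp: inversions_def)

lemma Bn_bij: "x \<in> Bn n \<Longrightarrow> bij x"
  and Bn_uminus: "x \<in> Bn n \<Longrightarrow> x (- i) = - x i"
  and Bn_outside: "x \<in> Bn n \<Longrightarrow> \<bar>i\<bar> > int n \<Longrightarrow> x i = i"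
  by (auto simp: Bn_def signed_perm_def)

lemma Bn_inv_apply [simp]: "x \<in> Bn n \<Longrightarrow> inv x (x i) = i"
  by (meson Bn_bij bij_is_inj inv_f_f)

lemma Bn_apply_inv [simp]: "x \<in> Bn n \<Longrightarrow> x (inv x i) = i"
  by (meson Bn_bij bij_is_surj surj_f_inv_f)

lemma Bn_inv: assumes "x \<in> Bn n" shows "inv x \<in> Bn n"
proof -
  have "bij (inv x)" by (simp add: Bn_bij[OF assms] bij_imp_bij_inv)
  moreover have "inv x (- i) = - inv x i" for i
    by (metis Bn_uminus Bn_apply_inv Bn_inv_apply assms)
  moreover have "inv x i = i" if "\<bar>i\<bar> > int n" for i
    by (metis Bn_outside Bn_inv_apply assms that)
  ultimately show ?thesis by (auto simp: Bn_def signed_perm_def)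
qed

lemma Bn_eq_iff: "x \<in> Bn n \<Longrightarrow> x i = x j \<longleftrightarrow> i = j"
  by (metis Bn_inv_apply)

lemma Bn_inv_eq_iff: "x \<in> Bn n \<Longrightarrow> inv x i = inv x j \<longleftrightarrow> i = j"
  by (metis Bn_apply_inv)

lemma Bn_inv_uminus: "x \<in> Bn n \<Longrightarrow> inv x (- i) = - inv x i"
  using Bn_inv Bn_uminus by blast

lemma Bn_zero: "x \<in> Bn n \<Longrightarrow> x 0 = 0"
  using Bn_uminus[of x n 0] by simp

lemma Bn_Om [simp]: assumes "x \<in> Bn n" shows "x i \<in> Om n \<longleftrightarrow> i \<in> Om n"
proof -
  have "x i \<in> Om n" if "x \<in> Bn n" "i \<in> Om n" for x i
  proof -
    have "x i \<noteq> 0" using that Bn_zero Bn_eq_iff Om_nonzero by metis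
    moreover have "\<not> \<bar>x i\<bar> > int n"
      using that Bn_outside[of x n "x i"] Bn_eq_iff[of x n "x i" i] by (auto simp: Om_def)
    ultimately show ?thesis by (auto simp: Om_def)
  qed
  from this[of x i] this[of "inv x" "x i"] show ?thesis using assms Bn_inv by auto
qed

lemma Bn_inv_Om [simp]: "x \<in> Bn n \<Longrightarrow> inv x i \<in> Om n \<longleftrightarrow> i \<in> Om n"
  by (simp add: Bn_inv)

lemma Bn_comp: "x \<in> Bn n \<Longrightarrow> y \<in> Bn n \<Longrightarrow> x \<circ> y \<in> Bn n"
  by (auto simp: Bn_def signed_perm_def bij_comp)

lemma inv_comp_Bn: "x \<in> Bn n \<Longrightarrow> y \<in> Bn n \<Longrightarrow> inv (x \<circ> y) = inv y \<circ> inv x"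
  by (simp add: Bn_bij o_inv_distrib)

lemma id_Bn: "id \<in> Bn n"
  by (auto simp: Bn_def signed_perm_def)

lemma gen_gen [simp]: "gen i (gen i v) = v"
  by (auto simp: gen_def)

lemma gen_comp_gen [simp]: "gen i \<circ> gen i = id"
  by (auto simp: fun_eq_iff)

lemma inv_gen [simp]: "inv (gen i) = gen i"
  by (rule inv_unique_comp) auto

lemma gen_Bn: assumes "i < n" shows "gen i \<in> Bn n"
proof -
  have "bij (gen i)" by (rule o_bij[of "gen i"]) auto
  thus ?thesis using assms by (auto simp: Bn_def signed_perm_def gen_def)
qed

lemma gen_eq_swap: "gen i = swap (pre i) (int i + 1)"
  by (auto simp: gen_def swap_def pre_def fun_eq_iff)

lemma Bn_inv_eq: "x \<in> Bn n \<Longrightarrow> inv x j = p \<longleftrightarrow> j = x p"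
  by auto

lemma swap_conj: "x \<in> Bn n \<Longrightarrow> x \<circ> swap p q \<circ> inv x = swap (x p) (x q)"
  by (rule ext) (simp add: swap_def Bn_inv_eq Bn_uminus)

lemma swap_uminus: "a \<noteq> 0 \<Longrightarrow> b \<noteq> 0 \<Longrightarrow> swap (- b) (- a) = swap a b"
  by (rule ext) (unfold swap_def, smt (verit))

lemma swap_lab: "a \<noteq> 0 \<Longrightarrow> b \<noteq> 0 \<Longrightarrow> (u, v) \<in> lab a b \<Longrightarrow> swap u v = swap a b"
  by (auto simp: lab_def swap_uminus)

lemma swap_commute: "swap u v = swap v u"
  by (rule ext) (unfold swap_def, smt (verit))

lemma swap_swap [simp]: "u \<noteq> 0 \<Longrightarrow> v \<noteq> 0 \<Longrightarrow> swap u v (swap u v j) = j"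
  unfolding swap_def by (smt (verit))

lemma pre_Om: "i < n \<Longrightarrow> pre i \<in> Om n"
  and Suc_Om: "i < n \<Longrightarrow> int i + 1 \<in> Om n"
  by (auto simp: pre_def Om_def)

text \<open>A generator reverses the order of two adjacent positions and of their mirror images
  only. With 0 removed, \<open>- 1\<close> and \<open>1\<close> count as adjacent, hence the
  restriction to nonzero positions.\<close>

lemma gen_less_iff:
  assumes "p \<noteq> 0" "q \<noteq> 0"
  shows "gen i q < gen i p \<longleftrightarrow>
    (if (q, p) \<in> lab (pre i) (int i + 1) then False
     else if (p, q) \<in> lab (pre i) (int i + 1) then True else q < p)"
proof (cases "i = 0")
  case True thus ?thesis using assms by (auto simp: gen_def lab_def pre_def)
next
  case False
  define k where "k = int i"
  have k: "k > 0" using False by (simp add: k_def)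
  have g: "(r = k \<and> gen i r = k + 1) \<or> (r = k + 1 \<and> gen i r = k) \<or> (r = - k \<and> gen i r = - k - 1) \<or>
    (r = - k - 1 \<and> gen i r = - k) \<or>
    (r \<noteq> k \<and> r \<noteq> k + 1 \<and> r \<noteq> - k \<and> r \<noteq> - k - 1 \<and> gen i r = r)" for r
    using False by (auto simp: gen_def k_def)
  have "(u, v) \<in> lab (pre i) (int i + 1) \<longleftrightarrow> u = k \<and> v = k + 1 \<or> u = - (k + 1) \<and> v = - k" for u v
    using False by (auto simp: lab_def pre_def k_def)
  thus ?thesis using g[of p] g[of q] k by (smt (z3))
qed

lemma lab_image: assumes "x \<in> Bn n"
  shows "(inv x u, inv x v) \<in> lab p q \<longleftrightarrow> (u, v) \<in> lab (x p) (x q)"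
  using assms by (simp add: lab_def Bn_inv_eq Bn_uminus)

lemma lab_swap_iff: "(u, v) \<in> lab a b \<Longrightarrow> u < v \<longleftrightarrow> a < b"
  by (auto simp: lab_def)

text \<open>The values \<open>a\<close> and \<open>b\<close> occupy neighbouring positions, so
  \<open>x \<circ> gen i\<close> orders all other pairs of values as \<open>x\<close> does, apart
  from the mirror image.\<close>

lemma inversions_comp_gen:
  assumes x: "x \<in> Bn n" and i: "i < n" and "a = x (pre i)" "b = x (int i + 1)"
  shows "a < b \<Longrightarrow> inversions n (x \<circ> gen i) = inversions n x \<union> lab a b \<and> (a, b) \<notin> inversions n x"
    and "b < a \<Longrightarrow> inversions n (x \<circ> gen i) = inversions n x - lab b a \<and> (b, a) \<in> inversions n x"
proof -
  note g = gen_Bn[OF i]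
  have ab: "a \<in> Om n" "b \<in> Om n" using assms pre_Om Suc_Om by auto
  have less: "inv (x \<circ> gen i) v < inv (x \<circ> gen i) u \<longleftrightarrow>
    (if (v, u) \<in> lab a b then False else if (u, v) \<in> lab a b then True else inv x v < inv x u)"
    if "u \<in> Om n" "v \<in> Om n" for u v
  proof -
    have "inv x u \<noteq> 0" "inv x v \<noteq> 0" using that Bn_inv_Om[OF x] Om_nonzero by blast+
    from gen_less_iff[OF this, of i] show ?thesis
      unfolding inv_comp_Bn[OF x g] inv_gen o_apply lab_image[OF x] assms(3,4)[symmetric] .
  qed
  have pos: "inv x a < inv x b"
    using assms by (auto simp: pre_def)
  { assume "a < b"
    have "(u, v) \<in> inversions n (x \<circ> gen i) \<longleftrightarrow> (u, v) \<in> inversions n x \<union> lab a b" for u v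
    proof (cases "u \<in> Om n \<and> v \<in> Om n")
      case True
      have "(v, u) \<in> lab a b \<Longrightarrow> \<not> u < v" "(u, v) \<in> lab a b \<Longrightarrow> u < v"
        using lab_swap_iff[of v u a b] lab_swap_iff[of u v a b] \<open>a < b\<close> by auto
      with less[of u v] True show ?thesis by (auto simp: inversions_def full_def)
    next
      case False
      moreover have "(u, v) \<notin> lab a b" using False ab by (auto simp: lab_def)
      ultimately show ?thesis by (auto simp: inversions_def full_def)
    qed
    moreover have "(a, b) \<notin> inversions n x" using pos by (auto simp: inversions_def)
    ultimately show "inversions n (x \<circ> gen i) = inversions n x \<union> lab a b \<and> (a, b) \<notin> inversions n x"
      by auto }
  { assume "b < a"
    have sw: "(u, v) \<in> lab b a \<longleftrightarrow> (v, u) \<in> lab a b" for u v by (auto simp: lab_def)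
    have "(u, v) \<in> inversions n (x \<circ> gen i) \<longleftrightarrow> (u, v) \<in> inversions n x - lab b a" for u v
    proof (cases "u \<in> Om n \<and> v \<in> Om n")
      case True
      have "(u, v) \<in> lab a b \<Longrightarrow> \<not> u < v"
        using lab_swap_iff[of u v a b] \<open>b < a\<close> by auto
      with less[of u v] True sw show ?thesis by (auto simp: inversions_def full_def)
    next
      case False
      thus ?thesis by (auto simp: inversions_def full_def)
    qed
    moreover have "(b, a) \<in> inversions n x"
      using pos ab \<open>b < a\<close> by (auto simp: inversions_def full_def)
    ultimately show "inversions n (x \<circ> gen i) = inversions n x - lab b a \<and> (b, a) \<in> inversions n x"
      by auto }
qed

section \<open>Words, the exchange property and length\<close>

lemma word_prod_simps [simp]: "word_prod [] = id" "word_prod (i # ws) = gen i \<circ> word_prod ws"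
  by (simp_all add: word_prod_def)

lemma word_prod_append: "word_prod (vs @ ws) = word_prod vs \<circ> word_prod ws"
  by (induction vs) (auto simp: fun_eq_iff)

lemma word_prod_snoc: "word_prod (ws @ [i]) = word_prod ws \<circ> gen i"
  by (simp add: word_prod_append comp_def)

lemma word_prod_Bn: "set ws \<subseteq> {..<n} \<Longrightarrow> word_prod ws \<in> Bn n"
  by (induction ws) (auto simp: id_Bn gen_Bn Bn_comp)

lemma inversions_id [simp]: "inversions n id = {}"
  by (auto simp: inversions_def full_def)

lemma Bn_pre_neq_Suc: "x \<in> Bn n \<Longrightarrow> x (pre i) \<noteq> x (int i + 1)"
  by (simp add: Bn_eq_iff pre_def)

text \<open>The exchange property: the inversion \<open>(u, v)\<close> is created by some letter of the word, and
  deleting that letter amounts to multiplication by the reflection.\<close>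
lemma exchange:
  assumes "set ws \<subseteq> {..<n}" "(u, v) \<in> inversions n (word_prod ws)"
  shows "\<exists>vs. length vs < length ws \<and> set vs \<subseteq> {..<n} \<and>
           word_prod vs = swap u v \<circ> word_prod ws \<and> swap u v \<in> refls n"
  using assms
proof (induction ws rule: rev_induct)
  case Nil thus ?case by (auto simp: inversions_def full_def)
next
  case (snoc i ws)
  let ?x = "word_prod ws"
  have x: "?x \<in> Bn n" and i: "i < n" using snoc.prems word_prod_Bn by auto
  show ?case
  proof (cases "(u, v) \<in> inversions n ?x")
    case True
    have "set ws \<subseteq> {..<n}" using snoc.prems by simp
    from snoc.IH[OF this True] obtain vs where vs: "length vs < length ws" "set vs \<subseteq> {..<n}"
      "word_prod vs = swap u v \<circ> ?x" "swap u v \<in> refls n" by blast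
    have "word_prod (vs @ [i]) = swap u v \<circ> word_prod (ws @ [i])"
      unfolding word_prod_snoc vs(3) by (simp add: o_assoc)
    thus ?thesis using vs i by (intro exI[of _ "vs @ [i]"]) auto
  next
    case False
    let ?a = "?x (pre i)" and ?b = "?x (int i + 1)"
    have "(u, v) \<in> inversions n (?x \<circ> gen i)" using snoc.prems unfolding word_prod_snoc by blast
    hence "(u, v) \<in> lab ?a ?b"
      using False inversions_comp_gen[OF x i refl refl] Bn_pre_neq_Suc[OF x, of i]
      by (metis DiffD1 UnE linorder_neq_iff)
    moreover have "?a \<noteq> 0" "?b \<noteq> 0" using x pre_Om[OF i] Suc_Om[OF i] Om_nonzero[of _ n] by auto
    ultimately have sw: "swap u v = ?x \<circ> gen i \<circ> inv ?x"
      by (simp add: swap_lab swap_conj[OF x] gen_eq_swap)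
    have "swap u v \<circ> word_prod (ws @ [i]) = ?x"
      unfolding sw word_prod_snoc using x by (auto simp: fun_eq_iff)
    moreover have "swap u v \<in> refls n" unfolding refls_def sw using x i by blast
    ultimately show ?thesis using snoc.prems by (intro exI[of _ ws]) auto
  qed
qed

text \<open>The ascent at the centre makes \<open>x 1\<close> positive, so the increasing sequence
  \<open>x 1, ..., x n\<close> satisfies \<open>x i \<ge> i\<close>; counting down from
  \<open>x n \<le> n\<close> gives \<open>x i \<le> i\<close>.\<close>

lemma Bn_no_descent_id:
  assumes x: "x \<in> Bn n" and asc: "\<And>i. i < n \<Longrightarrow> x (pre i) < x (int i + 1)"
  shows "x = id"
proof -
  have up: "x (int k + 1) \<ge> int k + 1" if "k < n" for k
    using that
  proof (induction k)
    case 0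
    have "x (- 1) < x 1" using asc[OF 0] by (simp add: pre_def)
    thus ?case using Bn_uminus[OF x, of 1] by simp
  next
    case (Suc k)
    thus ?case using asc[of "Suc k"] by (simp add: pre_def algebra_simps)
  qed
  have down: "x (int n - int k) \<le> int n - int k" if "k < n" for k
    using that
  proof (induction k)
    case 0
    have "int n \<in> Om n" using 0 by (auto simp: Om_def)
    hence "x (int n) \<in> Om n" using x by simp
    thus ?case by (auto simp: Om_def)
  next
    case (Suc k)
    have "int (n - Suc k) = int n - int k - 1" using Suc.prems by auto
    thus ?case using asc[of "n - Suc k"] Suc by (simp add: pre_def split: if_splits)
  qed
  have pos: "x i = i" if "0 < i" "i \<le> int n" for i
  proof -
    have "int (nat (i - 1)) + 1 = i" "int n - int (n - nat i) = i" "nat (i - 1) < n" "n - nat i < n"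
      using that by auto
    thus ?thesis using up[of "nat (i - 1)"] down[of "n - nat i"] by fastforce
  qed
  have "x i = i" for i
  proof -
    consider "\<bar>i\<bar> > int n" | "i = 0" | "0 < i" "i \<le> int n" | "0 < - i" "- i \<le> int n" by linarith
    thus ?thesis
      by cases (use pos[of i] pos[of "- i"] Bn_uminus[OF x, of i] Bn_zero[OF x] Bn_outside[OF x] in auto)
  qed
  thus ?thesis by auto
qed

lemma Bn_word_exists:
  assumes "x \<in> Bn n" shows "\<exists>ws. set ws \<subseteq> {..<n} \<and> word_prod ws = x"
  using assms
proof (induction "card (inversions n x)" arbitrary: x rule: less_induct)
  case less
  show ?case
  proof (cases "\<forall>i<n. x (pre i) < x (int i + 1)")
    case True
    hence "x = id" using Bn_no_descent_id[OF less.prems] by blast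
    thus ?thesis by (intro exI[of _ "[]"]) auto
  next
    case False
    then obtain i where i: "i < n" "x (int i + 1) < x (pre i)"
      using Bn_pre_neq_Suc[OF less.prems] by (metis linorder_neq_iff)
    from inversions_comp_gen(2)[OF less.prems i(1) refl refl i(2)]
    have "inversions n (x \<circ> gen i) \<subset> inversions n x" by (auto simp: lab_def)
    hence "card (inversions n (x \<circ> gen i)) < card (inversions n x)"
      by (meson finite_full finite_subset inversions_full psubset_card_mono)
    moreover have "x \<circ> gen i \<in> Bn n" using less.prems i gen_Bn Bn_comp by blast
    ultimately obtain ws where ws: "set ws \<subseteq> {..<n}" "word_prod ws = x \<circ> gen i"
      using less.hyps by blast
    have "word_prod (ws @ [i]) = x" unfolding word_prod_snoc ws(2) by (auto simp: fun_eq_iff)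
    thus ?thesis using ws i by (intro exI[of _ "ws @ [i]"]) auto
  qed
qed

lemma len_word:
  assumes "x \<in> Bn n" shows "\<exists>ws. length ws = len n x \<and> set ws \<subseteq> {..<n} \<and> word_prod ws = x"
  unfolding len_def by (rule LeastI_ex) (use Bn_word_exists[OF assms] in blast)

lemma len_le: "set ws \<subseteq> {..<n} \<Longrightarrow> word_prod ws = x \<Longrightarrow> len n x \<le> length ws"
  unfolding len_def by (rule Least_le) blast

lemma len_swap_less:
  assumes "x \<in> Bn n" "(u, v) \<in> inversions n x"
  shows "len n (swap u v \<circ> x) < len n x" "swap u v \<in> refls n"
proof -
  obtain ws where ws: "length ws = len n x" "set ws \<subseteq> {..<n}" "word_prod ws = x"
    using len_word[OF assms(1)] by blast
  with exchange[OF ws(2), of u v] assms(2) obtain vs where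
    "length vs < len n x" "set vs \<subseteq> {..<n}" "word_prod vs = swap u v \<circ> x" "swap u v \<in> refls n" by auto
  thus "len n (swap u v \<circ> x) < len n x" "swap u v \<in> refls n"
    using len_le[of vs n "swap u v \<circ> x"] by auto
qed

lemma refls_swap:
  assumes "t \<in> refls n" shows "\<exists>u v. (u, v) \<in> full n \<and> t = swap u v"
proof -
  obtain x i where xi: "x \<in> Bn n" "i < n" "t = x \<circ> gen i \<circ> inv x"
    using assms unfolding refls_def by blast
  let ?a = "x (pre i)" and ?b = "x (int i + 1)"
  have "t = swap ?a ?b" using xi by (simp add: gen_eq_swap swap_conj)
  moreover have "?a \<in> Om n" "?b \<in> Om n" using xi pre_Om Suc_Om by auto
  moreover have "?a \<noteq> ?b" using Bn_pre_neq_Suc xi(1) by blast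
  moreover have "swap ?a ?b = swap ?b ?a" by (rule swap_commute)
  ultimately have "(?a, ?b) \<in> full n \<or> (?b, ?a) \<in> full n" "t = swap ?a ?b" "t = swap ?b ?a"
    by (auto simp: full_def)
  thus ?thesis by blast
qed

lemma refls_Bn: assumes "t \<in> refls n" shows "t \<in> Bn n"
  using assms unfolding refls_def by (auto intro!: Bn_comp gen_Bn Bn_inv)

lemma inv_swap [simp]: "u \<noteq> 0 \<Longrightarrow> v \<noteq> 0 \<Longrightarrow> inv (swap u v) = swap u v"
  by (rule inv_unique_comp) (auto simp: fun_eq_iff)

text \<open>The reflection \<open>t = swap u v\<close> exchanges the positions of \<open>u\<close>
  and \<open>v\<close>, so exactly one of \<open>x\<close> and \<open>t \<circ> x\<close> has the
  inversion \<open>(u, v)\<close>. Applying \<open>len_swap_less\<close> to that one decides which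
  is shorter.\<close>

lemma mem_invset_iff:
  assumes "x \<in> Bn n" "(u, v) \<in> full n" "swap u v \<in> refls n"
  shows "swap u v \<in> invset n x \<longleftrightarrow> (u, v) \<in> inversions n x"
proof -
  have uv: "u \<noteq> 0" "v \<noteq> 0" "u < v" using assms(2) Om_nonzero by (auto simp: full_def)
  let ?t = "swap u v"
  have "\<not> len n (?t \<circ> x) < len n x" if "(u, v) \<notin> inversions n x"
  proof -
    have t: "?t \<in> Bn n" using assms(3) refls_Bn by blast
    have "inv (?t \<circ> x) w = inv x (?t w)" for w
      using uv by (simp add: inv_comp_Bn[OF t assms(1)])
    hence "inv (?t \<circ> x) v = inv x u" "inv (?t \<circ> x) u = inv x v"
      by (auto simp: swap_def)
    moreover have "inv x u < inv x v"
    proof -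
      have "\<not> inv x v < inv x u" using that assms(2) by (simp add: inversions_def)
      moreover have "inv x u \<noteq> inv x v" using Bn_inv_eq_iff[OF assms(1), of u v] uv by simp
      ultimately show ?thesis by simp
    qed
    ultimately have "(u, v) \<in> inversions n (?t \<circ> x)" using assms(2) by (auto simp: inversions_def)
    from len_swap_less(1)[OF Bn_comp[OF t assms(1)] this]
    have "len n (?t \<circ> (?t \<circ> x)) < len n (?t \<circ> x)" .
    moreover have "?t \<circ> (?t \<circ> x) = x" using uv by (auto simp: fun_eq_iff)
    ultimately show ?thesis by simp
  qed
  thus ?thesis using len_swap_less[OF assms(1)] assms(3) by (auto simp: invset_def)
qed

lemma weak_le_iff:
  assumes "x \<in> Bn n" "y \<in> Bn n"
  shows "weak_le n x y \<longleftrightarrow> inversions n x \<subseteq> inversions n y"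
proof
  assume le: "weak_le n x y"
  show "inversions n x \<subseteq> inversions n y"
  proof (clarify)
    fix u v assume uv: "(u, v) \<in> inversions n x"
    hence r: "(u, v) \<in> full n" "swap u v \<in> refls n"
      using inversions_full len_swap_less(2)[OF assms(1)] by blast+
    thus "(u, v) \<in> inversions n y"
      using mem_invset_iff[OF _ r] assms uv le unfolding weak_le_def by blast
  qed
next
  assume sub: "inversions n x \<subseteq> inversions n y"
  show "weak_le n x y" unfolding weak_le_def
  proof
    fix t assume t: "t \<in> invset n x"
    hence r: "t \<in> refls n" by (auto simp: invset_def)
    then obtain u v where "(u, v) \<in> full n" "t = swap u v" using refls_swap by blast
    thus "t \<in> invset n y" using mem_invset_iff assms r t sub by blast
  qed
qed

section \<open>Biclosed sets and the lattice operations\<close>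

text \<open>Mirror-symmetric sets that are transitive and whose complement in \<open>full n\<close>
  is transitive. They are exactly the inversion sets, by \<open>biclosed_inversions\<close> and
  \<open>realize_biclosed\<close>.\<close>

definition biclosed :: "nat \<Rightarrow> (int \<times> int) set \<Rightarrow> bool" where
  "biclosed n K \<longleftrightarrow> K \<subseteq> full n \<and> (\<forall>a b. (a, b) \<in> K \<longrightarrow> (- b, - a) \<in> K) \<and>
     (\<forall>a b c. (a, b) \<in> K \<longrightarrow> (b, c) \<in> K \<longrightarrow> (a, c) \<in> K) \<and>
     (\<forall>a b c. (a, c) \<in> K \<longrightarrow> b \<in> Om n \<longrightarrow> a < b \<longrightarrow> b < c \<longrightarrow> (a, b) \<in> K \<or> (b, c) \<in> K)"

definition bjoin :: "(int \<times> int) set \<Rightarrow> (int \<times> int) set \<Rightarrow> (int \<times> int) set" where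
  "bjoin K L = (K \<union> L)\<^sup>+"

text \<open>Complementation in \<open>full n\<close> reverses inclusion and preserves
  \<open>biclosed\<close>, so it turns the join into the meet.\<close>

definition bmeet :: "nat \<Rightarrow> (int \<times> int) set \<Rightarrow> (int \<times> int) set \<Rightarrow> (int \<times> int) set" where
  "bmeet n K L = full n - bjoin (full n - K) (full n - L)"

lemma biclosedD:
  assumes "biclosed n K"
  shows biclosed_full: "(a, b) \<in> K \<Longrightarrow> a \<in> Om n \<and> b \<in> Om n \<and> a < b"
    and biclosed_uminus: "(a, b) \<in> K \<Longrightarrow> (- b, - a) \<in> K"
    and biclosed_trans: "(a, b) \<in> K \<Longrightarrow> (b, c) \<in> K \<Longrightarrow> (a, c) \<in> K"
    and biclosed_cotrans: "(a, c) \<in> K \<Longrightarrow> b \<in> Om n \<Longrightarrow> a < b \<Longrightarrow> b < c \<Longrightarrow> (a, b) \<in> K \<or> (b, c) \<in> K"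
  using assms unfolding biclosed_def full_def by blast+

lemma biclosed_subset: "biclosed n K \<Longrightarrow> K \<subseteq> full n"
  by (simp add: biclosed_def)

lemma inversions_iff: "(a, b) \<in> inversions n x \<longleftrightarrow> a \<in> Om n \<and> b \<in> Om n \<and> a < b \<and> inv x b < inv x a"
  by (auto simp: inversions_def full_def)

lemma biclosed_inversions: assumes "x \<in> Bn n" shows "biclosed n (inversions n x)"
proof -
  have "(a, b) \<in> inversions n x \<or> (b, c) \<in> inversions n x"
    if "(a, c) \<in> inversions n x" "b \<in> Om n" "a < b" "b < c" for a b c
    using that unfolding inversions_iff by linarith
  moreover have "(- b, - a) \<in> inversions n x" if "(a, b) \<in> inversions n x" for a b
    using that unfolding inversions_iff by (simp add: Bn_inv_uminus[OF assms])
  moreover have "(a, c) \<in> inversions n x"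
    if "(a, b) \<in> inversions n x" "(b, c) \<in> inversions n x" for a b c
    using that unfolding inversions_iff by linarith
  ultimately show ?thesis unfolding biclosed_def using inversions_full by blast
qed

lemma card_Om: "card (Om n) = 2 * n"
proof -
  have "Om n = {- int n..int n} - {0}" by (auto simp: Om_def)
  thus ?thesis by (simp add: card_Diff_subset)
qed

text \<open>The position of a value is its rank in \<open>r\<close>. Mirror symmetry makes the
  predecessors of \<open>- v\<close> the negatives of the successors of \<open>v\<close>, so that
  the ranks of \<open>v\<close> and \<open>- v\<close> add up to \<open>2 * n - 1\<close>.\<close>

lemma realize_order:
  assumes irr: "\<And>u. u \<in> Om n \<Longrightarrow> \<not> r u u"
    and tot: "\<And>u v. u \<in> Om n \<Longrightarrow> v \<in> Om n \<Longrightarrow> u \<noteq> v \<Longrightarrow> r u v \<or> r v u"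
    and tr: "\<And>u v w. u \<in> Om n \<Longrightarrow> v \<in> Om n \<Longrightarrow> w \<in> Om n \<Longrightarrow> r u v \<Longrightarrow> r v w \<Longrightarrow> r u w"
    and um: "\<And>u v. u \<in> Om n \<Longrightarrow> v \<in> Om n \<Longrightarrow> r u v \<Longrightarrow> r (- v) (- u)"
  shows "\<exists>x\<in>Bn n. \<forall>u\<in>Om n. \<forall>v\<in>Om n. inv x u < inv x v \<longleftrightarrow> r u v"
proof -
  define L where "L v = {w \<in> Om n. r w v}" for v
  define U where "U v = {w \<in> Om n. r v w}" for v
  have fin: "finite (L v)" "finite (U v)" for v by (auto simp: L_def U_def)
  have um': "r (- v) (- u) \<longleftrightarrow> r u v" if "u \<in> Om n" "v \<in> Om n" for u v
    using um[of u v] um[of "- v" "- u"] that by auto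
  have "L (- v) = uminus ` U v" if "v \<in> Om n" for v
  proof -
    have "w \<in> uminus ` U v" if "w \<in> L (- v)" for w
      using that um'[of v "- w"] \<open>v \<in> Om n\<close> by (intro image_eqI[of _ _ "- w"]) (auto simp: L_def U_def)
    thus ?thesis using um' that by (auto simp: L_def U_def)
  qed
  hence card_um: "card (L (- v)) = card (U v)" if "v \<in> Om n" for v
    using that by (simp add: card_image)
  have card_sum: "card (L v) + card (U v) = 2 * n - 1" "n > 0" if "v \<in> Om n" for v
  proof -
    have "L v \<union> U v = Om n - {v}"
      using that irr tot by (auto simp: L_def U_def)
    moreover have "L v \<inter> U v = {}"
      unfolding L_def U_def using that irr tr by blast
    ultimately have "card (L v) + card (U v) = card (Om n - {v})"
      using card_Un_disjoint[OF fin(1)[of v] fin(2)[of v]] by simp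
    thus "card (L v) + card (U v) = 2 * n - 1" using that by (simp add: card_Om)
    show "n > 0" using that by (auto simp: Om_def)
  qed
  have mono: "card (L u) < card (L v)" if "u \<in> Om n" "v \<in> Om n" "r u v" for u v
  proof -
    have "L u \<subseteq> L v" unfolding L_def using that tr by blast
    moreover have "u \<in> L v" "u \<notin> L u" using that irr by (simp_all add: L_def)
    ultimately have "L u \<subset> L v" by blast
    thus ?thesis using fin psubset_card_mono by blast
  qed
  \<comment> \<open>Ranks run from \<open>0\<close> to \<open>2 * n - 1\<close>. Subtracting
    \<open>n\<close> gives \<open>- n, ..., n - 1\<close>; the extra 1 from rank \<open>n\<close> on
    skips position 0.\<close>
  define pos where "pos v = (if v \<in> Om n
    then int (card (L v)) - int n + (if card (L v) \<ge> n then 1 else 0) else v)" for v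
  have pos_um: "pos (- v) = - pos v" for v
  proof (cases "v \<in> Om n")
    case True
    hence "int (card (L (- v))) = 2 * int n - 1 - int (card (L v))"
      using card_um[of v] card_sum[of v] by linarith
    thus ?thesis using True by (auto simp: pos_def)
  qed (auto simp: pos_def)
  have pos_Om: "pos v \<in> Om n" if "v \<in> Om n" for v
    using card_sum[OF that] that by (auto simp: pos_def Om_def)
  have pos_less: "pos u < pos v" if "u \<in> Om n" "v \<in> Om n" "r u v" for u v
    using mono[OF that] that by (auto simp: pos_def)
  have pos_iff: "pos u < pos v \<longleftrightarrow> r u v" if "u \<in> Om n" "v \<in> Om n" for u v
    using pos_less[OF that] pos_less[OF that(2,1)] tot[OF that] irr[OF that(1)] by force
  have inj: "inj_on pos (Om n)"
  proof (rule inj_onI)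
    fix u v assume "u \<in> Om n" "v \<in> Om n" "pos u = pos v"
    thus "u = v" using tot[of u v] pos_less[of u v] pos_less[of v u] by force
  qed
  have "pos ` Om n = Om n"
    by (rule card_subset_eq) (use pos_Om inj in \<open>auto simp: card_image\<close>)
  hence "bij_betw pos (Om n) (Om n)" using inj by (simp add: bij_betw_def)
  moreover have "bij_betw pos (- Om n) (- Om n)"
    using bij_betw_cong[of "- Om n" pos id "- Om n"] by (simp add: pos_def)
  ultimately have "bij_betw pos (Om n \<union> - Om n) (Om n \<union> - Om n)"
    by (rule bij_betw_combine) auto
  hence "bij pos" by simp
  moreover have "pos i = i" if "\<bar>i\<bar> > int n" for i using that by (auto simp: pos_def Om_def)
  ultimately have "pos \<in> Bn n" using pos_um by (auto simp: Bn_def signed_perm_def)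
  hence "inv pos \<in> Bn n" "inv (inv pos) = pos" using Bn_inv Bn_bij inv_inv_eq by blast+
  thus ?thesis using pos_iff by (intro bexI[of _ "inv pos"]) auto
qed

text \<open>Take the usual order with exactly the pairs in \<open>K\<close> reversed. Its
  transitivity is, according to the relative size of the three values, transitivity of
  \<open>K\<close> or of its complement.\<close>

lemma realize_biclosed:
  assumes K: "biclosed n K" shows "\<exists>x\<in>Bn n. inversions n x = K"
proof -
  define r where "r u v \<longleftrightarrow> u \<noteq> v \<and> (if u < v then (u, v) \<notin> K else (v, u) \<in> K)" for u v :: int
  have "\<exists>x\<in>Bn n. \<forall>u\<in>Om n. \<forall>v\<in>Om n. inv x u < inv x v \<longleftrightarrow> r u v"
  proof (rule realize_order)
    fix u v w assume uvw: "u \<in> Om n" "v \<in> Om n" "w \<in> Om n" "r u v" "r v w"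
    consider "u < v" "v < w" | "u < v" "w < v" "u < w" | "u < v" "w < v" "w < u" | "u < v" "w < v" "w = u"
      | "v < u" "v < w" "u < w" | "v < u" "v < w" "w < u" | "v < u" "v < w" "w = u" | "v < u" "w < v"
      using uvw by (force simp: r_def)
    thus "r u w"
    proof cases
      case 1 thus ?thesis using uvw biclosed_cotrans[OF K, of u w v] by (auto simp: r_def)
    next
      case 2 thus ?thesis using uvw biclosed_trans[OF K, of u w v] by (auto simp: r_def)
    next
      case 3 thus ?thesis using uvw biclosed_cotrans[OF K, of w v u] by (auto simp: r_def)
    next
      case 4 thus ?thesis using uvw by (auto simp: r_def)
    next
      case 5 thus ?thesis using uvw biclosed_trans[OF K, of v u w] by (auto simp: r_def)
    next
      case 6 thus ?thesis using uvw biclosed_cotrans[OF K, of v u w] by (auto simp: r_def)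
    next
      case 7 thus ?thesis using uvw by (auto simp: r_def)
    next
      case 8 thus ?thesis using uvw biclosed_trans[OF K, of w v u] by (auto simp: r_def)
    qed
  next
    fix u v assume "u \<in> Om n" "v \<in> Om n" "r u v"
    thus "r (- v) (- u)" using biclosed_uminus[OF K, of "- v" "- u"] biclosed_uminus[OF K, of v u]
      by (auto simp: r_def split: if_splits)
  qed (auto simp: r_def)
  then obtain x where x: "x \<in> Bn n" "\<And>u v. u \<in> Om n \<Longrightarrow> v \<in> Om n \<Longrightarrow> inv x u < inv x v \<longleftrightarrow> r u v"
    by blast
  have "(a, b) \<in> inversions n x \<longleftrightarrow> (a, b) \<in> K" for a b
    using x(2)[of b a] biclosed_full[OF K, of a b] unfolding inversions_iff r_def by fastforce
  hence "inversions n x = K" by auto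
  thus ?thesis using x(1) by blast
qed

text \<open>Equal inversion sets order the values alike, so \<open>inv y \<circ> x\<close> preserves
  the order of positions, has no descent and is the identity.\<close>

lemma inversions_inj:
  assumes "x \<in> Bn n" "y \<in> Bn n" "inversions n x = inversions n y" shows "x = y"
proof -
  have sub: "u \<in> Om n \<Longrightarrow> v \<in> Om n \<Longrightarrow> u < v \<Longrightarrow> inv x v < inv x u \<longleftrightarrow> inv y v < inv y u" for u v
    using assms(3) inversions_iff by blast
  have less: "inv x v < inv x u \<longleftrightarrow> inv y v < inv y u" if "u \<in> Om n" "v \<in> Om n" for u v
  proof -
    have "inv x u = inv x v \<longleftrightarrow> u = v" "inv y u = inv y v \<longleftrightarrow> u = v"
      using Bn_inv_eq_iff assms(1,2) by blast+
    thus ?thesis using sub[of u v] sub[of v u] that by (cases u v rule: linorder_cases) linarith+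
  qed
  let ?z = "inv y \<circ> x"
  have z: "?z \<in> Bn n" using assms Bn_comp Bn_inv by blast
  have "?z = id"
  proof (rule Bn_no_descent_id[OF z])
    fix i assume "i < n"
    hence "x (pre i) \<in> Om n" "x (int i + 1) \<in> Om n" using assms(1) pre_Om Suc_Om by auto
    from less[OF this(2,1)] show "?z (pre i) < ?z (int i + 1)"
      using assms(1) by (auto simp: pre_def split: if_splits)
  qed
  hence "y (inv y (x i)) = y i" for i by (metis comp_apply id_apply)
  thus ?thesis using assms(2) by (auto simp: fun_eq_iff)
qed

lemma biclosed_compl: assumes "biclosed n K" shows "biclosed n (full n - K)"
proof -
  have "(- b, - a) \<in> full n - K" if "(a, b) \<in> full n - K" for a b
    using that biclosed_uminus[OF assms, of "- b" "- a"] by (auto simp: full_def)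
  moreover have "(a, c) \<in> full n - K" if "(a, b) \<in> full n - K" "(b, c) \<in> full n - K" for a b c
    using that biclosed_cotrans[OF assms, of a c b] by (auto simp: full_def)
  moreover have "(a, b) \<in> full n - K \<or> (b, c) \<in> full n - K"
    if "(a, c) \<in> full n - K" "b \<in> Om n" "a < b" "b < c" for a b c
    using that biclosed_trans[OF assms, of a b c] by (auto simp: full_def)
  ultimately show ?thesis unfolding biclosed_def by blast
qed

lemma trans_full: "trans (full n)"
  by (auto simp: trans_def full_def)

lemma biclosed_trans_rel: "biclosed n K \<Longrightarrow> trans K"
  unfolding trans_def using biclosed_trans by blast

lemma bjoin_upper: "K \<subseteq> bjoin K L" "L \<subseteq> bjoin K L"
  by (auto simp: bjoin_def)

lemma bjoin_least:
  assumes "K \<subseteq> M" "L \<subseteq> M" "trans M" shows "bjoin K L \<subseteq> M"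
  unfolding bjoin_def using assms by (metis Un_least trancl_id trancl_mono_subset)

text \<open>For coclosedness, follow a chain of pairs from \<open>a\<close> to \<open>c\<close>.
  Values increase along it, so \<open>b\<close> is a vertex of the chain or falls inside one step;
  coclosedness of \<open>K\<close> or \<open>L\<close> then splits that step so that
  \<open>b\<close> is joined to the chain on one side.\<close>

lemma biclosed_bjoin:
  assumes "biclosed n K" "biclosed n L" shows "biclosed n (bjoin K L)"
proof -
  let ?T = "(K \<union> L)\<^sup>+"
  have full: "?T \<subseteq> full n"
    using bjoin_least[OF _ _ trans_full, of K n L] assms unfolding bjoin_def biclosed_def by blast
  have "(- b, - a) \<in> ?T" if "(a, b) \<in> ?T" for a b
    using that
  proof (induction rule: trancl_induct)
    case (base y)
    thus ?case using biclosed_uminus assms by blast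
  next
    case (step y z)
    hence "(- z, - y) \<in> ?T" using biclosed_uminus assms by blast
    thus ?case using step by (meson trancl_trans)
  qed
  moreover have "(a, b) \<in> ?T \<or> (b, c) \<in> ?T"
    if "(a, c) \<in> ?T" "b \<in> Om n" "a < b" "b < c" for a b c
    using that
  proof (induction rule: trancl_induct)
    case (base y)
    thus ?case using biclosed_cotrans assms by blast
  next
    case (step y z)
    consider "b < y" | "b = y" | "y < b" by linarith
    thus ?case
    proof cases
      case 1
      thus ?thesis using step by (meson trancl.trancl_into_trancl)
    next
      case 2
      thus ?thesis using step by blast
    next
      case 3
      hence "(y, b) \<in> K \<union> L \<or> (b, z) \<in> K \<union> L" using step biclosed_cotrans assms by blast
      thus ?thesis using step by (meson r_into_trancl trancl.trancl_into_trancl)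
    qed
  qed
  moreover have "(a, c) \<in> ?T" if "(a, b) \<in> ?T" "(b, c) \<in> ?T" for a b c
    using that by (rule trancl_trans)
  ultimately show ?thesis unfolding biclosed_def bjoin_def using full by blast
qed

lemma biclosed_bmeet: "biclosed n K \<Longrightarrow> biclosed n L \<Longrightarrow> biclosed n (bmeet n K L)"
  unfolding bmeet_def by (intro biclosed_compl biclosed_bjoin)

lemma bmeet_lower: "bmeet n K L \<subseteq> K" "bmeet n K L \<subseteq> L"
  unfolding bmeet_def using bjoin_upper by blast+

lemma bmeet_greatest:
  assumes "biclosed n M" "M \<subseteq> K" "M \<subseteq> L" shows "M \<subseteq> bmeet n K L"
proof -
  have "bjoin (full n - K) (full n - L) \<subseteq> full n - M"
    using assms biclosed_trans_rel[OF biclosed_compl] by (intro bjoin_least) blast+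
  thus ?thesis using assms(1) unfolding bmeet_def biclosed_def by blast
qed

lemma weak_join:
  assumes "x \<in> Bn n" "y \<in> Bn n"
  shows weak_join_Bn: "weak_join n x y \<in> Bn n"
    and inversions_weak_join: "inversions n (weak_join n x y) = bjoin (inversions n x) (inversions n y)"
proof -
  obtain z where z: "z \<in> Bn n" "inversions n z = bjoin (inversions n x) (inversions n y)"
    using realize_biclosed[OF biclosed_bjoin[OF biclosed_inversions biclosed_inversions]] assms by blast
  have least: "inversions n z \<subseteq> inversions n u"
    if "u \<in> Bn n" "inversions n x \<subseteq> inversions n u" "inversions n y \<subseteq> inversions n u" for u
    unfolding z(2) using that by (intro bjoin_least biclosed_trans_rel[of n] biclosed_inversions)
  have upper: "inversions n x \<subseteq> inversions n z" "inversions n y \<subseteq> inversions n z"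
    unfolding z(2) by (rule bjoin_upper)+
  have "weak_join n x y = z"
    unfolding weak_join_def
  proof (rule the_equality)
    show "z \<in> Bn n \<and> weak_le n x z \<and> weak_le n y z \<and>
      (\<forall>u\<in>Bn n. weak_le n x u \<and> weak_le n y u \<longrightarrow> weak_le n z u)"
      using z(1) upper least by (simp add: weak_le_iff assms)
  next
    fix w assume w: "w \<in> Bn n \<and> weak_le n x w \<and> weak_le n y w \<and>
      (\<forall>u\<in>Bn n. weak_le n x u \<and> weak_le n y u \<longrightarrow> weak_le n w u)"
    have "weak_le n x z" "weak_le n y z"
      using z(1) upper by (simp_all add: weak_le_iff assms)
    hence "weak_le n w z" using w z by blast
    thus "w = z" using w z(1) least[of w] assms
      by (intro inversions_inj[of _ n]) (auto simp: weak_le_iff)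
  qed
  thus "weak_join n x y \<in> Bn n"
    "inversions n (weak_join n x y) = bjoin (inversions n x) (inversions n y)" using z by auto
qed

lemma weak_meet:
  assumes "x \<in> Bn n" "y \<in> Bn n"
  shows weak_meet_Bn: "weak_meet n x y \<in> Bn n"
    and inversions_weak_meet: "inversions n (weak_meet n x y) = bmeet n (inversions n x) (inversions n y)"
proof -
  obtain z where z: "z \<in> Bn n" "inversions n z = bmeet n (inversions n x) (inversions n y)"
    using realize_biclosed[OF biclosed_bmeet[OF biclosed_inversions biclosed_inversions]] assms by blast
  have greatest: "inversions n u \<subseteq> inversions n z"
    if "u \<in> Bn n" "inversions n u \<subseteq> inversions n x" "inversions n u \<subseteq> inversions n y" for u
    unfolding z(2) using that by (intro bmeet_greatest biclosed_inversions)
  have lower: "inversions n z \<subseteq> inversions n x" "inversions n z \<subseteq> inversions n y"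
    unfolding z(2) by (rule bmeet_lower)+
  have "weak_meet n x y = z"
    unfolding weak_meet_def
  proof (rule the_equality)
    show "z \<in> Bn n \<and> weak_le n z x \<and> weak_le n z y \<and>
      (\<forall>u\<in>Bn n. weak_le n u x \<and> weak_le n u y \<longrightarrow> weak_le n u z)"
      using z(1) lower greatest by (simp add: weak_le_iff assms)
  next
    fix w assume w: "w \<in> Bn n \<and> weak_le n w x \<and> weak_le n w y \<and>
      (\<forall>u\<in>Bn n. weak_le n u x \<and> weak_le n u y \<longrightarrow> weak_le n u w)"
    have "weak_le n z x" "weak_le n z y"
      using z(1) lower by (simp_all add: weak_le_iff assms)
    hence "weak_le n z w" using w z by blast
    thus "w = z" using w z(1) greatest[of w] assms
      by (intro inversions_inj[of _ n]) (auto simp: weak_le_iff)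
  qed
  thus "weak_meet n x y \<in> Bn n"
    "inversions n (weak_meet n x y) = bmeet n (inversions n x) (inversions n y)" using z by auto
qed

section \<open>Bottoms of the congruence classes\<close>

text \<open>No subsequence \<open>b c a\<close> with \<open>a < b < c\<close> and \<open>(0 < b) = \<delta>\<close> in full notation; the \<open>else\<close> branch is
  the mirror image of the \<open>then\<close> branch.\<close>
definition aligned :: "nat \<Rightarrow> bool \<Rightarrow> (int \<times> int) set \<Rightarrow> bool" where
  "aligned n \<delta> K \<longleftrightarrow> (\<forall>a b c. (a, c) \<in> K \<longrightarrow> b \<in> Om n \<longrightarrow> a < b \<longrightarrow> b < c \<longrightarrow>
     (if (0 < b) = \<delta> then (b, c) \<in> K else (a, b) \<in> K))"

text \<open>The largest aligned subset, obtained by unrolling the closure condition of \<open>aligned\<close>.\<close>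
definition proj :: "nat \<Rightarrow> bool \<Rightarrow> (int \<times> int) set \<Rightarrow> (int \<times> int) set" where
  "proj n \<delta> K = {(a, c) \<in> full n. \<forall>d\<in>Om n. \<forall>d'\<in>Om n. a \<le> d \<longrightarrow> d < d' \<longrightarrow> d' \<le> c \<longrightarrow>
     d = a \<or> (0 < d) = \<delta> \<longrightarrow> d' = c \<or> (0 < d') = (\<not> \<delta>) \<longrightarrow> (d, d') \<in> K}"

lemma proj_iff: "(a, c) \<in> proj n \<delta> K \<longleftrightarrow> a \<in> Om n \<and> c \<in> Om n \<and> a < c \<and>
    (\<forall>d\<in>Om n. \<forall>d'\<in>Om n. a \<le> d \<longrightarrow> d < d' \<longrightarrow> d' \<le> c \<longrightarrow>
     d = a \<or> (0 < d) = \<delta> \<longrightarrow> d' = c \<or> (0 < d') = (\<not> \<delta>) \<longrightarrow> (d, d') \<in> K)"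
  by (auto simp: proj_def full_def)

lemma proj_full: "proj n \<delta> K \<subseteq> full n"
  by (auto simp: proj_def)

lemma proj_subset: "proj n \<delta> K \<subseteq> K"
  unfolding subset_iff split_paired_All proj_iff by blast

lemma proj_mono: "K \<subseteq> L \<Longrightarrow> proj n \<delta> K \<subseteq> proj n \<delta> L"
  unfolding subset_iff split_paired_All proj_iff by blast

lemma alignedD:
  assumes "aligned n \<delta> K" "(a, c) \<in> K" "b \<in> Om n" "a < b" "b < c"
  shows "(0 < b) = \<delta> \<Longrightarrow> (b, c) \<in> K" and "(0 < b) = (\<not> \<delta>) \<Longrightarrow> (a, b) \<in> K"
proof -
  have "if (0 < b) = \<delta> then (b, c) \<in> K else (a, b) \<in> K"
    using assms unfolding aligned_def by blast
  thus "(0 < b) = \<delta> \<Longrightarrow> (b, c) \<in> K" and "(0 < b) = (\<not> \<delta>) \<Longrightarrow> (a, b) \<in> K" by auto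
qed

text \<open>A value \<open>b\<close> of sign \<delta> is itself an admissible left end
  \<open>d\<close> for \<open>(a, c)\<close>, so the conditions defining membership of
  \<open>(b, c)\<close> are among those for \<open>(a, c)\<close>. Right ends behave likewise for
  the opposite sign.\<close>

lemma aligned_proj: "aligned n \<delta> (proj n \<delta> K)"
  unfolding aligned_def
proof (intro allI impI)
  fix a b c assume ac: "(a, c) \<in> proj n \<delta> K" and b: "b \<in> Om n" "a < b" "b < c"
  have D: "(d, d') \<in> K" if "d \<in> Om n" "d' \<in> Om n" "a \<le> d" "d < d'" "d' \<le> c"
    "d = a \<or> (0 < d) = \<delta>" "d' = c \<or> (0 < d') = (\<not> \<delta>)" for d d'
    using ac that unfolding proj_iff by blast
  have O: "a \<in> Om n" "c \<in> Om n" using ac unfolding proj_iff by blast+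
  have "(b, c) \<in> proj n \<delta> K" if "(0 < b) = \<delta>"
    unfolding proj_iff
  proof (intro conjI ballI impI)
    fix d d' assume d: "d \<in> Om n" "d' \<in> Om n" "b \<le> d" "d < d'" "d' \<le> c"
      "d = b \<or> (0 < d) = \<delta>" "d' = c \<or> (0 < d') = (\<not> \<delta>)"
    hence "a \<le> d" "(0 < d) = \<delta>" using b that by auto
    thus "(d, d') \<in> K" using D d by blast
  qed (use b O in auto)
  moreover have "(a, b) \<in> proj n \<delta> K" if "(0 < b) = (\<not> \<delta>)"
    unfolding proj_iff
  proof (intro conjI ballI impI)
    fix d d' assume d: "d \<in> Om n" "d' \<in> Om n" "a \<le> d" "d < d'" "d' \<le> b"
      "d = a \<or> (0 < d) = \<delta>" "d' = b \<or> (0 < d') = (\<not> \<delta>)"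
    hence "d' \<le> c" "(0 < d') = (\<not> \<delta>)" using b that by auto
    thus "(d, d') \<in> K" using D d by blast
  qed (use b O in auto)
  ultimately show "if (0 < b) = \<delta> then (b, c) \<in> proj n \<delta> K else (a, b) \<in> proj n \<delta> K" by auto
qed

text \<open>Negation exchanges admissible left and right ends. For transitivity, a pair
  \<open>d < b < d'\<close> is composed at \<open>b\<close>, which ends the first pair and starts
  the second. Coclosedness is weaker than alignment.\<close>

lemma biclosed_proj:
  assumes K: "biclosed n K" shows "biclosed n (proj n \<delta> K)"
proof -
  have "(- b, - a) \<in> proj n \<delta> K" if "(a, b) \<in> proj n \<delta> K" for a b
    unfolding proj_iff
  proof (intro conjI ballI impI)
    fix d d' assume d: "d \<in> Om n" "d' \<in> Om n" "- b \<le> d" "d < d'" "d' \<le> - a"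
      "d = - b \<or> (0 < d) = \<delta>" "d' = - a \<or> (0 < d') = (\<not> \<delta>)"
    have "- d' = a \<or> (0 < - d') = \<delta>" "- d = b \<or> (0 < - d) = (\<not> \<delta>)"
      using d(6,7) Om_nonzero[OF d(1)] Om_nonzero[OF d(2)] by auto
    moreover have "- d' \<in> Om n" "- d \<in> Om n" "a \<le> - d'" "- d' < - d" "- d \<le> b" using d by auto
    ultimately have "(- d', - d) \<in> K" using that unfolding proj_iff by blast
    thus "(d, d') \<in> K" using biclosed_uminus[OF K, of "- d'" "- d"] by simp
  qed (use that in \<open>auto simp: proj_iff\<close>)
  moreover have "(a, c) \<in> proj n \<delta> K" if ab: "(a, b) \<in> proj n \<delta> K" and bc: "(b, c) \<in> proj n \<delta> K" for a b c
    unfolding proj_iff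
  proof (intro conjI ballI impI)
    fix d d' assume d: "d \<in> Om n" "d' \<in> Om n" "a \<le> d" "d < d'" "d' \<le> c"
      "d = a \<or> (0 < d) = \<delta>" "d' = c \<or> (0 < d') = (\<not> \<delta>)"
    have b: "b \<in> Om n" "a < b" "b < c" using ab bc by (auto simp: proj_iff)
    have L: "(e, e') \<in> K" if "e \<in> Om n" "e' \<in> Om n" "a \<le> e" "e < e'" "e' \<le> b"
      "e = a \<or> (0 < e) = \<delta>" "e' = b \<or> (0 < e') = (\<not> \<delta>)" for e e'
      using ab that unfolding proj_iff by blast
    have R: "(e, e') \<in> K" if "e \<in> Om n" "e' \<in> Om n" "b \<le> e" "e < e'" "e' \<le> c"
      "e = b \<or> (0 < e) = \<delta>" "e' = c \<or> (0 < e') = (\<not> \<delta>)" for e e'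
      using bc that unfolding proj_iff by blast
    consider "d' \<le> b" | "b \<le> d" | "d < b" "b < d'" by linarith
    thus "(d, d') \<in> K"
    proof cases
      case 1 thus ?thesis using L[of d d'] d b by linarith
    next
      case 2 thus ?thesis using R[of d d'] d b by linarith
    next
      case 3
      have "(d, b) \<in> K" "(b, d') \<in> K" using L[of d b] R[of b d'] d b 3 by auto
      thus ?thesis using biclosed_trans[OF K] by blast
    qed
  qed (use that in \<open>auto simp: proj_iff\<close>)
  moreover have "(a, b) \<in> proj n \<delta> K \<or> (b, c) \<in> proj n \<delta> K"
    if "(a, c) \<in> proj n \<delta> K" "b \<in> Om n" "a < b" "b < c" for a b c
    using alignedD[OF aligned_proj that] by blast
  ultimately show ?thesis unfolding biclosed_def using proj_full by blast
qed

lemma proj_greatest: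
  assumes "aligned n \<delta> L" "L \<subseteq> full n" "L \<subseteq> K" shows "L \<subseteq> proj n \<delta> K"
proof (clarify)
  fix a c assume ac: "(a, c) \<in> L"
  show "(a, c) \<in> proj n \<delta> K" unfolding proj_iff
  proof (intro conjI ballI impI)
    fix d d' assume d: "d \<in> Om n" "d' \<in> Om n" "a \<le> d" "d < d'" "d' \<le> c"
      "d = a \<or> (0 < d) = \<delta>" "d' = c \<or> (0 < d') = (\<not> \<delta>)"
    \<comment> \<open>Alignment trims the pair on the left to \<open>d\<close>, then on the right to
      \<open>d'\<close>.\<close>
    have "(d, c) \<in> L" using alignedD(1)[OF assms(1) ac, of d] d ac by force
    hence "(d, d') \<in> L" using alignedD(2)[OF assms(1), of d c d'] d by force
    thus "(d, d') \<in> K" using assms(3) by blast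
  qed (use ac assms(2) in \<open>auto simp: full_def\<close>)
qed

lemma proj_aligned: "aligned n \<delta> K \<Longrightarrow> K \<subseteq> full n \<Longrightarrow> proj n \<delta> K = K"
  using proj_greatest[of n \<delta> K K] proj_subset by blast

text \<open>The chain argument of \<open>biclosed_bjoin\<close> again: the side on which the split
  step is kept now depends on the sign of \<open>b\<close> alone, so it is the same for steps from
  \<open>K\<close> and from \<open>L\<close>.\<close>

lemma aligned_bjoin:
  assumes "aligned n \<delta> K" "aligned n \<delta> L"
  shows "aligned n \<delta> (bjoin K L)"
proof -
  let ?T = "(K \<union> L)\<^sup>+"
  have edge: "((0 < b) = \<delta> \<longrightarrow> (b, z) \<in> ?T) \<and> ((0 < b) = (\<not> \<delta>) \<longrightarrow> (y, b) \<in> ?T)"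
    if "(y, z) \<in> K \<union> L" "b \<in> Om n" "y < b" "b < z" for y z b
    using that alignedD[OF assms(1), of y z b] alignedD[OF assms(2), of y z b] by blast
  have path: "((0 < b) = \<delta> \<longrightarrow> (b, c) \<in> ?T) \<and> ((0 < b) = (\<not> \<delta>) \<longrightarrow> (a, b) \<in> ?T)"
    if "(a, c) \<in> ?T" "b \<in> Om n" "a < b" "b < c" for a b c
    using that
  proof (induction rule: trancl_induct)
    case (base y)
    thus ?case by (intro edge)
  next
    case (step y z)
    consider "b < y" | "b = y" | "y < b" by linarith
    thus ?case
    proof cases
      case 1
      hence "((0 < b) = \<delta> \<longrightarrow> (b, y) \<in> ?T) \<and> ((0 < b) = (\<not> \<delta>) \<longrightarrow> (a, b) \<in> ?T)"
        using step.IH step.prems by simp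
      thus ?thesis using step(2) trancl.trancl_into_trancl[of b y "K \<union> L" z] by blast
    next
      case 2
      thus ?thesis using step(1,2) by blast
    next
      case 3
      from edge[OF step(2) step.prems(1) this step.prems(3)]
      show ?thesis using trancl_trans[OF step(1), of b] by blast
    qed
  qed
  show ?thesis unfolding aligned_def bjoin_def
  proof (intro allI impI)
    fix a b c assume "(a, c) \<in> ?T" "b \<in> Om n" "a < b" "b < c"
    from path[OF this] show "if (0 < b) = \<delta> then (b, c) \<in> ?T else (a, b) \<in> ?T" by auto
  qed
qed

text \<open>In general \<open>K\<close> may contain only \<open>(a, b)\<close> and \<open>L\<close>
  only \<open>(b, c)\<close>, and the intersection fails to be coclosed. For aligned sets the sign
  of \<open>b\<close> selects the same pair in both.\<close>

lemma aligned_Int: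
  assumes "aligned n \<delta> K" "aligned n \<delta> L" "biclosed n K" "biclosed n L"
  shows "aligned n \<delta> (K \<inter> L)" "biclosed n (K \<inter> L)"
proof -
  show al: "aligned n \<delta> (K \<inter> L)" unfolding aligned_def
  proof (intro allI impI)
    fix a b c assume "(a, c) \<in> K \<inter> L" "b \<in> Om n" "a < b" "b < c"
    thus "if (0 < b) = \<delta> then (b, c) \<in> K \<inter> L else (a, b) \<in> K \<inter> L"
      using alignedD[OF assms(1), of a c b] alignedD[OF assms(2), of a c b] by auto
  qed
  have "(a, b) \<in> K \<inter> L \<or> (b, c) \<in> K \<inter> L"
    if "(a, c) \<in> K \<inter> L" "b \<in> Om n" "a < b" "b < c" for a b c
    using alignedD[OF al that] by blast
  moreover have "(- b, - a) \<in> K \<inter> L" if "(a, b) \<in> K \<inter> L" for a b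
    using that biclosed_uminus assms(3,4) by blast
  moreover have "(a, c) \<in> K \<inter> L" if "(a, b) \<in> K \<inter> L" "(b, c) \<in> K \<inter> L" for a b c
    using that biclosed_trans[OF assms(3), of a b c] biclosed_trans[OF assms(4), of a b c] by blast
  ultimately show "biclosed n (K \<inter> L)"
    using biclosed_subset[OF assms(3)] unfolding biclosed_def by blast
qed

lemma bmeet_aligned:
  assumes "aligned n \<delta> K" "aligned n \<delta> L" "biclosed n K" "biclosed n L"
  shows "bmeet n K L = K \<inter> L"
proof
  show "bmeet n K L \<subseteq> K \<inter> L" by (intro Int_greatest bmeet_lower)
  show "K \<inter> L \<subseteq> bmeet n K L" by (intro bmeet_greatest aligned_Int(2)[OF assms]) auto
qed

text \<open>The intersection of the two projections is biclosed, hence below the meet, and aligned,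
  hence below the projection of the meet.\<close>

lemma proj_bmeet:
  assumes "biclosed n K" "biclosed n L"
  shows "proj n \<delta> (bmeet n K L) = proj n \<delta> K \<inter> proj n \<delta> L"
proof
  show "proj n \<delta> (bmeet n K L) \<subseteq> proj n \<delta> K \<inter> proj n \<delta> L"
    by (intro Int_greatest proj_mono bmeet_lower)
  note int = aligned_Int[OF aligned_proj aligned_proj biclosed_proj biclosed_proj, OF assms, of \<delta>]
  have "proj n \<delta> K \<inter> proj n \<delta> L \<subseteq> bmeet n K L"
    by (intro bmeet_greatest int le_infI1[OF proj_subset] le_infI2[OF proj_subset])
  thus "proj n \<delta> K \<inter> proj n \<delta> L \<subseteq> proj n \<delta> (bmeet n K L)"
    by (intro proj_greatest int biclosed_subset)
qed

text \<open>The top of a congruence class depends only on its bottom: a pair that is an inversion of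
  \<open>K\<close> but not of \<open>proj n \<delta> K\<close>, of minimal length, contradicts coclosedness.\<close>
lemma proj_compl_proj:
  assumes K: "biclosed n K"
  shows "proj n (\<not> \<delta>) (full n - proj n \<delta> K) = proj n (\<not> \<delta>) (full n - K)"
proof
  show "proj n (\<not> \<delta>) (full n - K) \<subseteq> proj n (\<not> \<delta>) (full n - proj n \<delta> K)"
    by (intro proj_mono Diff_mono proj_subset order_refl)
  show "proj n (\<not> \<delta>) (full n - proj n \<delta> K) \<subseteq> proj n (\<not> \<delta>) (full n - K)"
  proof (clarify)
    fix a c assume ac: "(a, c) \<in> proj n (\<not> \<delta>) (full n - proj n \<delta> K)"
    have "(d, d') \<notin> K" if "d \<in> Om n" "d' \<in> Om n" "a \<le> d" "d < d'" "d' \<le> c"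
      "d = a \<or> (0 < d) = (\<not> \<delta>)" "d' = c \<or> (0 < d') = \<delta>" for d d'
      using that
    proof (induction "nat (d' - d)" arbitrary: d d' rule: less_induct)
      case less
      show ?case
      proof
        assume dd: "(d, d') \<in> K"
        have "(d, d') \<notin> proj n \<delta> K" using ac less.prems unfolding proj_iff[of a c] by auto
        \<comment> \<open>The pair \<open>(e, e')\<close> witnesses that \<open>(d, d')\<close>
          fails to be projected. Its ends have the signs that make \<open>(e', d')\<close> and
          \<open>(d, e)\<close> again instances of the claim, unless they are degenerate. Both are
          thus outside \<open>K\<close>, and coclosedness pushes \<open>(d, d')\<close> first to
          \<open>(d, e')\<close> and then to \<open>(e, e')\<close>.\<close>
        then obtain e e' where e: "e \<in> Om n" "e' \<in> Om n" "d \<le> e" "e < e'" "e' \<le> d'"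
          "e = d \<or> (0 < e) = \<delta>" "e' = d' \<or> (0 < e') = (\<not> \<delta>)" "(e, e') \<notin> K"
          using less.prems unfolding proj_iff by blast
        have "(d, e') \<in> K"
        proof (cases "e' = d'")
          case False
          hence "(e', d') \<notin> K" using less.hyps[of d' e'] less.prems e by auto
          thus ?thesis using biclosed_cotrans[OF K dd, of e'] e False by auto
        qed (use dd in simp)
        moreover have "(d, e) \<notin> K"
        proof (cases "e = d")
          case True thus ?thesis using biclosed_full[OF K, of d d] by auto
        next
          case False
          thus ?thesis using less.hyps[of e d] less.prems e by auto
        qed
        ultimately show False using biclosed_cotrans[OF K, of d e' e] e by force
      qed
    qed
    thus "(a, c) \<in> proj n (\<not> \<delta>) (full n - K)"
      using ac unfolding proj_iff by (auto simp: full_def)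
  qed
qed

lemma compl_compl: "K \<subseteq> full n \<Longrightarrow> full n - (full n - K) = K"
  by blast

lemma proj_eq_iff_compl:
  assumes "biclosed n K" "biclosed n L"
  shows "proj n \<delta> K = proj n \<delta> L \<longleftrightarrow> proj n (\<not> \<delta>) (full n - K) = proj n (\<not> \<delta>) (full n - L)"
proof
  assume "proj n \<delta> K = proj n \<delta> L"
  thus "proj n (\<not> \<delta>) (full n - K) = proj n (\<not> \<delta>) (full n - L)"
    using proj_compl_proj[OF assms(1), of \<delta>] proj_compl_proj[OF assms(2), of \<delta>] by simp
next
  assume "proj n (\<not> \<delta>) (full n - K) = proj n (\<not> \<delta>) (full n - L)"
  thus "proj n \<delta> K = proj n \<delta> L"
    using proj_compl_proj[OF biclosed_compl[OF assms(1)], of "\<not> \<delta>"]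
      proj_compl_proj[OF biclosed_compl[OF assms(2)], of "\<not> \<delta>"]
    by (simp add: compl_compl biclosed_subset assms)
qed

lemma compl_bjoin:
  assumes "biclosed n K" "biclosed n L"
  shows "full n - bjoin K L = bmeet n (full n - K) (full n - L)"
  using assms by (simp add: bmeet_def compl_compl biclosed_subset)

text \<open>After complementation the join is a meet and \<delta> is negated, so
  \<open>proj_bmeet\<close> applies; \<open>proj_eq_iff_compl\<close> translates the hypothesis
  there and the conclusion back.\<close>

lemma proj_bjoin_cong:
  assumes "biclosed n K" "biclosed n K'" "biclosed n L" "proj n \<delta> K = proj n \<delta> K'"
  shows "proj n \<delta> (bjoin K L) = proj n \<delta> (bjoin K' L)"
proof -
  have "proj n (\<not> \<delta>) (full n - K) = proj n (\<not> \<delta>) (full n - K')"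
    using assms proj_eq_iff_compl by blast
  hence "proj n (\<not> \<delta>) (full n - bjoin K L) = proj n (\<not> \<delta>) (full n - bjoin K' L)"
    using assms(1-3) by (simp add: compl_bjoin proj_bmeet biclosed_compl)
  thus ?thesis using assms(1-3) proj_eq_iff_compl[of n "bjoin K L" "bjoin K' L" \<delta>] biclosed_bjoin by blast
qed

definition proj_cong :: "nat \<Rightarrow> bool \<Rightarrow> ((int \<Rightarrow> int) \<times> (int \<Rightarrow> int)) set" where
  "proj_cong n \<delta> = {(x, y). x \<in> Bn n \<and> y \<in> Bn n \<and>
     proj n \<delta> (inversions n x) = proj n \<delta> (inversions n y)}"

lemma lattice_cong_proj_cong: "lattice_cong n (proj_cong n \<delta>)"
  unfolding lattice_cong_def
proof (intro conjI ballI impI)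
  show "equiv (Bn n) (proj_cong n \<delta>)"
    by (auto simp: equiv_def refl_on_def sym_def trans_def proj_cong_def)
  fix x y z assume xyz: "x \<in> Bn n" "y \<in> Bn n" "z \<in> Bn n" "(x, y) \<in> proj_cong n \<delta>"
  hence eq: "proj n \<delta> (inversions n x) = proj n \<delta> (inversions n y)" by (simp add: proj_cong_def)
  show "(weak_join n x z, weak_join n y z) \<in> proj_cong n \<delta>"
    using proj_bjoin_cong[OF xyz(1-3)[THEN biclosed_inversions] eq] xyz(1-3)
    by (simp add: proj_cong_def weak_join_Bn inversions_weak_join)
  show "(weak_meet n x z, weak_meet n y z) \<in> proj_cong n \<delta>"
    using xyz(1-3) eq
    by (simp add: proj_cong_def weak_meet_Bn inversions_weak_meet proj_bmeet biclosed_inversions)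
qed

definition aligned_perms :: "nat \<Rightarrow> bool \<Rightarrow> (int \<Rightarrow> int) set" where
  "aligned_perms n \<delta> = {x \<in> Bn n. aligned n \<delta> (inversions n x)}"

lemma weak_sublattice_aligned: "weak_sublattice n (aligned_perms n \<delta>)"
  unfolding weak_sublattice_def
proof (intro conjI ballI)
  show "aligned_perms n \<delta> \<subseteq> Bn n" by (auto simp: aligned_perms_def)
  fix x y assume "x \<in> aligned_perms n \<delta>" "y \<in> aligned_perms n \<delta>"
  thus "weak_join n x y \<in> aligned_perms n \<delta>" "weak_meet n x y \<in> aligned_perms n \<delta>"
    by (simp_all add: aligned_perms_def weak_join_Bn weak_meet_Bn inversions_weak_join
        inversions_weak_meet bmeet_aligned[of n \<delta>] biclosed_inversions aligned_bjoin aligned_Int(1))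
qed

section \<open>Forcing in lattice congruences\<close>

definition covers :: "nat \<Rightarrow> (int \<Rightarrow> int) \<Rightarrow> (int \<Rightarrow> int) \<Rightarrow> int \<Rightarrow> int \<Rightarrow> bool" where
  "covers n x x' a c \<longleftrightarrow> x \<in> Bn n \<and> x' \<in> Bn n \<and> (a, c) \<in> inversions n x \<and>
     inversions n x' = inversions n x - lab a c"

lemma coversD:
  assumes "covers n x x' a c"
  shows "x \<in> Bn n" "x' \<in> Bn n" "(a, c) \<in> inversions n x" "(- c, - a) \<in> inversions n x"
    "inversions n x' = inversions n x - lab a c"
    "(a, c) \<notin> inversions n x'" "(- c, - a) \<notin> inversions n x'"
    "a \<in> Om n" "c \<in> Om n" "a < c"
  using assms biclosed_uminus[OF biclosed_inversions, of x n a c]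
  by (auto simp: covers_def lab_def inversions_iff)

lemma covers_uminus: "covers n x x' a c \<Longrightarrow> covers n x x' (- c) (- a)"
  using coversD(4)[of n x x' a c] unfolding covers_def lab_def by (simp add: insert_commute)

text \<open>In the notation the exchanged values are neighbours, so \<open>e\<close> is left of both
  or right of both. In terms of inversion sets, coclosedness of \<open>x\<close> yields one
  alternative and closedness of \<open>x'\<close> excludes having both.\<close>

lemma covers_split:
  assumes "covers n x x' a c" "e \<in> Om n" "a < e" "e < c"
  shows "(a, e) \<in> inversions n x \<longleftrightarrow> (e, c) \<notin> inversions n x"
proof -
  note D = coversD[OF assms(1)]
  have "(a, e) \<in> inversions n x \<or> (e, c) \<in> inversions n x"
    using biclosed_cotrans[OF biclosed_inversions[OF D(1)] D(3)] assms by blast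
  moreover have "\<not> ((a, e) \<in> inversions n x' \<and> (e, c) \<in> inversions n x')"
    using biclosed_trans[OF biclosed_inversions[OF D(2)], of a e c] D(6) by blast
  moreover have "(a, e) \<notin> lab a c" "(e, c) \<notin> lab a c"
    using assms(3,4) by (auto simp: lab_def)
  ultimately show ?thesis using D(5) by blast
qed

lemma covers_gen:
  assumes "x \<in> Bn n" "i < n" "x (int i + 1) < x (pre i)"
  shows "covers n x (x \<circ> gen i) (x (int i + 1)) (x (pre i))"
  using inversions_comp_gen(2)[OF assms(1,2) refl refl assms(3)] assms Bn_comp gen_Bn
  unfolding covers_def by blast

lemma mem_inversions_gen:
  assumes "x \<in> Bn n" "i < n" "x (int i + 1) < x (pre i)" "e \<in> Om n"
    "x (int i + 1) < e"
  shows "(x (int i + 1), e) \<in> inversions n x \<longleftrightarrow> inv x e < int i + 1"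
proof -
  have "x (int i + 1) \<in> Om n" using assms(1,2) Suc_Om by simp
  thus ?thesis using assms unfolding inversions_iff by simp
qed

text \<open>If both sets contain \<open>(a, c)\<close> and separate the values between \<open>a\<close> and \<open>c\<close> in the same way,
  no chain of non-inversions leads from \<open>a\<close> to \<open>c\<close>.\<close>
lemma mem_bmeet:
  assumes K: "biclosed n K" and L: "biclosed n L" and ac: "(a, c) \<in> K" "(a, c) \<in> L"
    and split: "\<And>e. e \<in> Om n \<Longrightarrow> a < e \<Longrightarrow> e < c \<Longrightarrow> (a, e) \<in> K \<longleftrightarrow> (a, e) \<in> L"
  shows "(a, c) \<in> bmeet n K L"
proof -
  \<comment> \<open>Invariant along a chain of non-inversions starting at \<open>a\<close>: it has
    jumped over \<open>c\<close>, or it stands at a value that lies right of \<open>a\<close> in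
    both sets.\<close>
  have "z > c \<or> (z \<in> Om n \<and> z < c \<and> (a, z) \<notin> K \<and> (a, z) \<notin> L)"
    if "(a, z) \<in> ((full n - K) \<union> (full n - L))\<^sup>+" for z
    using that
  proof (induction rule: trancl_induct)
    case (base y)
    hence "a < y" "y \<in> Om n" "(a, y) \<notin> K \<or> (a, y) \<notin> L" by (auto simp: full_def)
    thus ?case using split[of y] ac by (cases y c rule: linorder_cases) auto
  next
    case (step y z)
    hence yz: "y < z" "y \<in> Om n" "z \<in> Om n" "(y, z) \<notin> K \<or> (y, z) \<notin> L" by (auto simp: full_def)
    show ?case
    proof (cases "y > c")
      case True thus ?thesis using yz by simp
    next
      case False
      hence y: "y < c" "(a, y) \<notin> K" "(a, y) \<notin> L" using step.IH by auto
      have "a < y" using step.hyps(1) by (induction rule: trancl_induct) (auto simp: full_def)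
      hence "(y, c) \<in> K" "(y, c) \<in> L"
        using biclosed_cotrans[OF K ac(1) yz(2)] biclosed_cotrans[OF L ac(2) yz(2)] y by blast+
      moreover have "(a, z) \<notin> K \<or> (a, z) \<notin> L"
        using biclosed_cotrans[OF K _ yz(2) \<open>a < y\<close> yz(1)] biclosed_cotrans[OF L _ yz(2) \<open>a < y\<close> yz(1)]
          y yz(4) by blast
      ultimately show ?thesis using split[of z] \<open>a < y\<close> yz by (cases z c rule: linorder_cases) auto
    qed
  qed
  from this[of c] have "(a, c) \<notin> bjoin (full n - K) (full n - L)" unfolding bjoin_def by auto
  thus ?thesis using ac(1) biclosed_subset[OF K] unfolding bmeet_def by blast
qed

lemma weak_join_absorb:
  assumes "x \<in> Bn n" "y \<in> Bn n" "inversions n x \<subseteq> inversions n y"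
  shows "weak_join n x y = y" "weak_join n y x = y"
proof -
  have "bjoin (inversions n x) (inversions n y) = inversions n y"
    "bjoin (inversions n y) (inversions n x) = inversions n y"
    using bjoin_least[OF _ _ biclosed_trans_rel[OF biclosed_inversions[OF assms(2)]]] bjoin_upper assms(3)
    by (simp_all add: subset_antisym)
  thus "weak_join n x y = y" "weak_join n y x = y"
    using assms by (simp_all add: inversions_inj[of _ n] weak_join_Bn inversions_weak_join)
qed

lemma weak_meet_absorb:
  assumes "x \<in> Bn n" "y \<in> Bn n" "inversions n x \<subseteq> inversions n y"
  shows "weak_meet n x y = x" "weak_meet n y x = x"
proof -
  have "bmeet n (inversions n x) (inversions n y) = inversions n x"
    "bmeet n (inversions n y) (inversions n x) = inversions n x"
    using bmeet_greatest[OF biclosed_inversions[OF assms(1)]] bmeet_lower assms(3)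
    by (simp_all add: subset_antisym)
  thus "weak_meet n x y = x" "weak_meet n y x = x"
    using assms by (simp_all add: inversions_inj[of _ n] weak_meet_Bn inversions_weak_meet)
qed

locale weak_congruence =
  fixes n :: nat and R :: "((int \<Rightarrow> int) \<times> (int \<Rightarrow> int)) set"
  assumes cong: "lattice_cong n R"
begin

lemma R_equiv: "equiv (Bn n) R"
  using cong by (simp add: lattice_cong_def)

lemma R_Bn: "(x, y) \<in> R \<Longrightarrow> x \<in> Bn n \<and> y \<in> Bn n"
  using R_equiv by (auto simp: equiv_def refl_on_def)

lemma R_refl: "x \<in> Bn n \<Longrightarrow> (x, x) \<in> R"
  using R_equiv by (auto simp: equiv_def refl_on_def)

lemma R_sym: "(x, y) \<in> R \<Longrightarrow> (y, x) \<in> R"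
  using R_equiv by (auto simp: equiv_def sym_def)

lemma R_trans: "(x, y) \<in> R \<Longrightarrow> (y, z) \<in> R \<Longrightarrow> (x, z) \<in> R"
  using R_equiv unfolding equiv_def trans_def by blast

lemma R_join: "(x, y) \<in> R \<Longrightarrow> z \<in> Bn n \<Longrightarrow> (weak_join n x z, weak_join n y z) \<in> R"
  using cong R_Bn unfolding lattice_cong_def by blast

lemma R_meet: "(x, y) \<in> R \<Longrightarrow> z \<in> Bn n \<Longrightarrow> (weak_meet n x z, weak_meet n y z) \<in> R"
  using cong R_Bn unfolding lattice_cong_def by blast

lemma R_convex:
  assumes "(x, z) \<in> R" "y \<in> Bn n" "inversions n x \<subseteq> inversions n y" "inversions n y \<subseteq> inversions n z"
  shows "(x, y) \<in> R" "(y, z) \<in> R"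
proof -
  have xz: "x \<in> Bn n" "z \<in> Bn n" using R_Bn assms(1) by auto
  have "(weak_join n x y, weak_join n z y) \<in> R" using R_join assms by blast
  thus yz: "(y, z) \<in> R"
    using weak_join_absorb(1)[of x n y] weak_join_absorb(2)[of y n z] xz assms by simp
  show "(x, y) \<in> R" using R_trans[OF assms(1) R_sym[OF yz]] .
qed

text \<open>Join the congruent pair with \<open>x'\<close>: the lower element is absorbed, the upper
  one comes to lie above \<open>x\<close>, and convexity contracts the cover.\<close>

lemma join_force:
  assumes "covers n x x' a c" "(y1, y2) \<in> R" "inversions n y1 \<subseteq> inversions n x'"
    "(a, c) \<in> bjoin (inversions n y2) (inversions n x')"
  shows "(x, x') \<in> R"
proof -
  note D = coversD[OF assms(1)]
  have y: "y1 \<in> Bn n" "y2 \<in> Bn n" using R_Bn assms(2) by auto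
  let ?w = "weak_join n y2 x'"
  have "(x', ?w) \<in> R" using R_join[OF assms(2) D(2)] weak_join_absorb(1)[OF y(1) D(2) assms(3)] by simp
  moreover have "inversions n x \<subseteq> inversions n ?w"
  proof -
    have "(- c, - a) \<in> bjoin (inversions n y2) (inversions n x')"
      using biclosed_uminus[OF biclosed_bjoin[OF biclosed_inversions biclosed_inversions]] y D(2) assms(4) by blast
    moreover have "inversions n x \<subseteq> inversions n x' \<union> {(a, c), (- c, - a)}"
      using D(5) by (auto simp: lab_def)
    ultimately show ?thesis
      using assms(4) bjoin_upper(2)[of "inversions n x'" "inversions n y2"] y D(2)
      by (auto simp: inversions_weak_join)
  qed
  moreover have "inversions n x' \<subseteq> inversions n x" using D(5) by blast
  ultimately show ?thesis using R_convex(1)[of x' ?w x] D(1) R_sym by blast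
qed

text \<open>Dually, meet with \<open>x\<close>: the upper element yields \<open>x\<close>, the lower
  one falls below \<open>x'\<close>.\<close>

lemma meet_force:
  assumes "covers n x x' a c" "(y1, y2) \<in> R" "inversions n x \<subseteq> inversions n y2"
    "(a, c) \<notin> bmeet n (inversions n y1) (inversions n x)"
  shows "(x, x') \<in> R"
proof -
  note D = coversD[OF assms(1)]
  have y: "y1 \<in> Bn n" "y2 \<in> Bn n" using R_Bn assms(2) by auto
  let ?w = "weak_meet n y1 x"
  have w: "(?w, x) \<in> R" using R_meet[OF assms(2) D(1)] weak_meet_absorb(2)[OF D(1) y(2) assms(3)] by simp
  have I: "inversions n ?w = bmeet n (inversions n y1) (inversions n x)"
    by (simp add: inversions_weak_meet y D(1))
  have "(- c, - a) \<notin> bmeet n (inversions n y1) (inversions n x)"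
    using biclosed_uminus[OF biclosed_bmeet[OF biclosed_inversions biclosed_inversions], of y1 n x "- c" "- a"]
      y D(1) assms(4) by auto
  hence "inversions n ?w \<subseteq> inversions n x'"
    unfolding I D(5) using assms(4) bmeet_lower(2)[of n "inversions n y1" "inversions n x"]
    by (auto simp: lab_def)
  moreover have "inversions n x' \<subseteq> inversions n x" using D(5) by blast
  ultimately show ?thesis using R_convex(2)[OF w D(2)] R_sym by blast
qed

lemma join_force_step:
  assumes "covers n x x' a c" "(y1, y2) \<in> R" "inversions n y1 \<subseteq> inversions n x'"
    "(a, e) \<in> inversions n y2 \<union> inversions n x'" "(e, c) \<in> inversions n y2 \<union> inversions n x'"
  shows "(x, x') \<in> R"
proof (rule join_force[OF assms(1-3)])
  show "(a, c) \<in> bjoin (inversions n y2) (inversions n x')"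
    unfolding bjoin_def using assms(4,5) by (meson r_into_trancl trancl_trans)
qed

lemma meet_force_step:
  assumes "covers n x x' a c" "(y1, y2) \<in> R" "inversions n x \<subseteq> inversions n y2"
    "e \<in> Om n" "a < e" "e < c"
    "(a, e) \<notin> inversions n y1 \<inter> inversions n x" "(e, c) \<notin> inversions n y1 \<inter> inversions n x"
  shows "(x, x') \<in> R"
proof (rule meet_force[OF assms(1-3)])
  have y: "y1 \<in> Bn n" "x \<in> Bn n" using R_Bn assms(2) coversD(1)[OF assms(1)] by auto
  show "(a, c) \<notin> bmeet n (inversions n y1) (inversions n x)"
    using biclosed_cotrans[OF biclosed_bmeet[OF biclosed_inversions biclosed_inversions], of y1 n x a c e]
      y assms(4-8) bmeet_lower[of n "inversions n y1" "inversions n x"] by blast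
qed

text \<open>The contracted cover is transported down by meeting with \<open>y\<close> and up again
  by joining with \<open>y'\<close>. The hypothesis on the separated values is what keeps
  \<open>(a, c)\<close> in the meet of \<open>x\<close> and \<open>y\<close>.\<close>

lemma covers_equiv:
  assumes x: "covers n x x' a c" "(x, x') \<in> R" and y: "covers n y y' a c"
    and split: "\<And>e. e \<in> Om n \<Longrightarrow> a < e \<Longrightarrow> e < c \<Longrightarrow> (a, e) \<in> inversions n x \<longleftrightarrow> (a, e) \<in> inversions n y"
  shows "(y, y') \<in> R"
proof -
  note X = coversD[OF x(1)] and Y = coversD[OF y]
  note I = inversions_weak_meet[OF X(1) Y(1)] inversions_weak_meet[OF X(2) Y(1)]
  show ?thesis
  proof (rule join_force[OF y])
    show "(weak_meet n x' y, weak_meet n x y) \<in> R" using R_meet[OF R_sym[OF x(2)] Y(1)] .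
    show "inversions n (weak_meet n x' y) \<subseteq> inversions n y'"
      unfolding I Y(5) using bmeet_lower[of n "inversions n x'" "inversions n y"] X(6,7)
      by (auto simp: lab_def)
    have "(a, c) \<in> inversions n (weak_meet n x y)"
      unfolding I using biclosed_inversions X(1,3) Y(1,3) split by (intro mem_bmeet)
    thus "(a, c) \<in> bjoin (inversions n (weak_meet n x y)) (inversions n y')"
      using bjoin_upper by blast
  qed
qed

end

section \<open>Moving a value next to a given descent\<close>

lemma insert_key:
  assumes x: "x \<in> Bn n" and e: "e \<in> Om n" and p: "odd p"
  defines "k \<equiv> \<lambda>v. if v = e then p else if v = - e then - p else 4 * inv x v"
  shows "\<exists>y\<in>Bn n. \<forall>u\<in>Om n. \<forall>v\<in>Om n. inv y u < inv y v \<longleftrightarrow> k u < k v"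
proof (rule realize_order)
  have e0: "e \<noteq> 0" using e Om_nonzero by blast
  have um: "k (- v) = - k v" for v
    using e0 by (auto simp: k_def Bn_inv_uminus[OF x])
  \<comment> \<open>Old values have keys divisible by 4, the moved value and its negative have odd
    opposite keys; parity excludes ties.\<close>
  have inj: "u = v" if "k u = k v" for u v
  proof -
    have "4 * inv x w \<noteq> p" "4 * inv x w \<noteq> - p" "p \<noteq> - p" for w
      using p by presburger+
    thus ?thesis using that Bn_inv_eq_iff[OF x, of u v] unfolding k_def
      by (auto split: if_splits dest: sym)
  qed
  fix u v
  show "u \<noteq> v \<Longrightarrow> k u < k v \<or> k v < k u" using inj[of u v] by linarith
  show "k u < k v \<Longrightarrow> k (- v) < k (- u)" by (simp add: um)
qed auto

text \<open>A gap after position \<open>i\<close> would be filled by some value. The bound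
  \<open>0 \<le> i\<close> keeps \<open>i + 1\<close> away from the skipped position 0;
  \<open>i = 0\<close> is used at the centre.\<close>

lemma consecutive_positions:
  assumes y: "y \<in> Bn n" and "v \<in> Om n" "0 \<le> i" "i < inv y v"
    "\<And>w. w \<in> Om n \<Longrightarrow> inv y w < inv y v \<Longrightarrow> inv y w \<le> i"
  shows "inv y v = i + 1"
proof (rule ccontr)
  assume ne: "inv y v \<noteq> i + 1"
  have "inv y v \<in> Om n" using assms by simp
  hence "i + 1 \<in> Om n" using assms(3,4) by (auto simp: Om_def)
  hence "y (i + 1) \<in> Om n" "inv y (y (i + 1)) = i + 1" using y by auto
  thus False using assms(5)[of "y (i + 1)"] ne assms(4) by auto
qed

text \<open>The key \<open>4 * i + 5\<close> lies just above \<open>4 * (i + 1)\<close>, the key of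
  the lower value of the descent. The descent may end up at a position \<open>j\<close> other than
  \<open>i\<close>, because \<open>e\<close> and \<open>- e\<close> leave their old places.\<close>

lemma insert_right:
  assumes x: "x \<in> Bn n" and i: "0 < i" "i < n" and e: "e \<in> Om n"
    and ne: "e \<noteq> x (int i)" "e \<noteq> - x (int i)" "e \<noteq> x (int i + 1)" "e \<noteq> - x (int i + 1)"
  shows "\<exists>y\<in>Bn n. \<exists>j. 0 < j \<and> j + 1 < n \<and> y (int j) = x (int i) \<and> y (int j + 1) = x (int i + 1) \<and>
    y (int j + 2) = e \<and> (\<forall>v\<in>Om n. v \<noteq> e \<longrightarrow> v \<noteq> - e \<longrightarrow> (inv y v < int j + 1 \<longleftrightarrow> inv x v < int i + 1))"
proof -
  let ?c = "x (int i)" and ?a = "x (int i + 1)" and ?p = "4 * int i + 5"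
  define k where "k v = (if v = e then ?p else if v = - e then - ?p else 4 * inv x v)" for v
  have "odd ?p" by simp
  from insert_key[OF x e this] obtain y where y: "y \<in> Bn n"
    and yk: "\<And>u v. u \<in> Om n \<Longrightarrow> v \<in> Om n \<Longrightarrow> inv y u < inv y v \<longleftrightarrow> k u < k v"
    unfolding k_def by blast
  have O: "?c \<in> Om n" "?a \<in> Om n" "- ?c \<in> Om n"
    using x i Suc_Om[of i n] pre_Om[of i n] by (auto simp: pre_def)
  have k: "k ?c = 4 * int i" "k (- ?c) = - (4 * int i)" "k ?a = 4 * int i + 4" "k e = 4 * int i + 5"
    using ne x by (auto simp: k_def Bn_inv_uminus)
  have c0: "0 < inv y ?c"
    using yk[OF O(3,1)] k i Bn_inv_uminus[OF y, of ?c] by simp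
  have kw: "k w \<le> 4 * int i \<or> k w = 4 * int i + 4 \<or> k w \<ge> 4 * int i + 5" for w
    by (auto simp: k_def)
  have a: "inv y ?a = inv y ?c + 1"
  proof (rule consecutive_positions[OF y O(2)])
    show "0 \<le> inv y ?c" using c0 by simp
    show "inv y ?c < inv y ?a" using yk[OF O(1,2)] k by simp
    fix w assume "w \<in> Om n" "inv y w < inv y ?a"
    hence "\<not> k ?c < k w" using yk[of w ?a] kw[of w] k O by auto
    thus "inv y w \<le> inv y ?c" using yk[of ?c w] \<open>w \<in> Om n\<close> O by simp
  qed
  have e': "inv y e = inv y ?a + 1"
  proof (rule consecutive_positions[OF y e])
    show "0 \<le> inv y ?a" using c0 a by simp
    show "inv y ?a < inv y e" using yk[OF O(2) e] k by simp
    fix w assume "w \<in> Om n" "inv y w < inv y e"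
    hence "\<not> k ?a < k w" using yk[of w e] kw[of w] k e by auto
    thus "inv y w \<le> inv y ?a" using yk[of ?a w] \<open>w \<in> Om n\<close> O by simp
  qed
  define j where "j = nat (inv y ?c)"
  have j: "int j = inv y ?c" "0 < j" using c0 by (auto simp: j_def)
  have "inv y e \<in> Om n" using y e by simp
  hence "j + 1 < n" using a e' j by (auto simp: Om_def)
  moreover have "y (int j) = ?c" "y (int j + 1) = ?a" "y (int j + 2) = e"
    using a e' y unfolding j(1) by (metis Bn_apply_inv add.assoc one_add_one)+
  moreover have "inv y v < int j + 1 \<longleftrightarrow> inv x v < int i + 1" if "v \<in> Om n" "v \<noteq> e" "v \<noteq> - e" for v
  proof -
    have "inv y v < inv y ?a \<longleftrightarrow> k v < k ?a" using yk[OF that(1) O(2)] .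
    thus ?thesis using that k unfolding a j(1) by (auto simp: k_def)
  qed
  ultimately show ?thesis using y j by blast
qed

text \<open>The key \<open>4 * i - 1\<close> lies just below \<open>4 * i\<close>, the key of the
  upper value of the descent, and is positive, so \<open>- e\<close> stays away from the three
  positions.\<close>

lemma insert_left:
  assumes x: "x \<in> Bn n" and i: "0 < i" "i < n" and e: "e \<in> Om n"
    and ne: "e \<noteq> x (int i)" "e \<noteq> - x (int i)" "e \<noteq> x (int i + 1)" "e \<noteq> - x (int i + 1)"
  shows "\<exists>y\<in>Bn n. \<exists>j. 0 < j \<and> j + 1 < n \<and> y (int j) = e \<and> y (int j + 1) = x (int i) \<and>
    y (int j + 2) = x (int i + 1) \<and>
    (\<forall>v\<in>Om n. v \<noteq> e \<longrightarrow> v \<noteq> - e \<longrightarrow> (inv y v < int j + 2 \<longleftrightarrow> inv x v < int i + 1))"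
proof -
  let ?c = "x (int i)" and ?a = "x (int i + 1)" and ?p = "4 * int i - 1"
  define k where "k v = (if v = e then ?p else if v = - e then - ?p else 4 * inv x v)" for v
  have "odd ?p" by simp
  from insert_key[OF x e this] obtain y where y: "y \<in> Bn n"
    and yk: "\<And>u v. u \<in> Om n \<Longrightarrow> v \<in> Om n \<Longrightarrow> inv y u < inv y v \<longleftrightarrow> k u < k v"
    unfolding k_def by blast
  have e0: "e \<noteq> 0" "- e \<in> Om n" using e Om_nonzero by auto
  have O: "?c \<in> Om n" "?a \<in> Om n"
    using x i Suc_Om[of i n] pre_Om[of i n] by (auto simp: pre_def)
  have k: "k ?c = 4 * int i" "k (- e) = - (4 * int i - 1)" "k ?a = 4 * int i + 4" "k e = 4 * int i - 1"
    using ne x e0 by (auto simp: k_def)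
  have c0: "0 < inv y e"
    using yk[OF e0(2) e] k i Bn_inv_uminus[OF y, of e] by simp
  have kw: "k w \<le> 4 * int i - 1 \<or> k w = 4 * int i \<or> k w \<ge> 4 * int i + 4" for w
    using i by (auto simp: k_def)
  have c: "inv y ?c = inv y e + 1"
  proof (rule consecutive_positions[OF y O(1)])
    show "0 \<le> inv y e" using c0 by simp
    show "inv y e < inv y ?c" using yk[OF e O(1)] k by simp
    fix w assume "w \<in> Om n" "inv y w < inv y ?c"
    hence "\<not> k e < k w" using yk[of w ?c] kw[of w] k O by auto
    thus "inv y w \<le> inv y e" using yk[of e w] \<open>w \<in> Om n\<close> e by simp
  qed
  have a: "inv y ?a = inv y ?c + 1"
  proof (rule consecutive_positions[OF y O(2)])
    show "0 \<le> inv y ?c" using c0 c by simp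
    show "inv y ?c < inv y ?a" using yk[OF O] k by simp
    fix w assume "w \<in> Om n" "inv y w < inv y ?a"
    hence "\<not> k ?c < k w" using yk[of w ?a] kw[of w] k O by auto
    thus "inv y w \<le> inv y ?c" using yk[of ?c w] \<open>w \<in> Om n\<close> O by simp
  qed
  define j where "j = nat (inv y e)"
  have j: "int j = inv y e" "0 < j" using c0 by (auto simp: j_def)
  have "inv y ?a \<in> Om n" using y O by simp
  hence "j + 1 < n" using a c j by (auto simp: Om_def)
  moreover have "y (int j) = e" "y (int j + 1) = ?c" "y (int j + 2) = ?a"
    using a c y unfolding j(1) by (metis Bn_apply_inv add.assoc one_add_one)+
  moreover have "inv y v < int j + 2 \<longleftrightarrow> inv x v < int i + 1" if "v \<in> Om n" "v \<noteq> e" "v \<noteq> - e" for v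
  proof -
    have "inv y v < inv y ?a \<longleftrightarrow> k v < k ?a" using yk[OF that(1) O(2)] .
    moreover have "inv y ?a = int j + 2" using a c j by simp
    ultimately show ?thesis using that k by (auto simp: k_def)
  qed
  ultimately show ?thesis using y j by blast
qed

text \<open>The key 5 follows 4, the key of position 1, so the middle of the full notation becomes
  \<open>- e, - x 1, x 1, e\<close>.\<close>

lemma insert_center:
  assumes x: "x \<in> Bn n" and n: "2 \<le> n" and e: "e \<in> Om n" and ne: "e \<noteq> x 1" "e \<noteq> - x 1"
  shows "\<exists>y\<in>Bn n. y 1 = x 1 \<and> y 2 = e \<and>
    (\<forall>v\<in>Om n. v \<noteq> e \<longrightarrow> v \<noteq> - e \<longrightarrow> (inv y v < 1 \<longleftrightarrow> inv x v < 1))"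
proof -
  let ?a = "x 1"
  define k where "k v = (if v = e then 5 else if v = - e then - 5 else 4 * inv x v)" for v :: int
  from insert_key[OF x e, of 5] obtain y where y: "y \<in> Bn n"
    and yk: "\<And>u v. u \<in> Om n \<Longrightarrow> v \<in> Om n \<Longrightarrow> inv y u < inv y v \<longleftrightarrow> k u < k v"
    unfolding k_def by auto
  have "(1::int) \<in> Om n" using n by (auto simp: Om_def)
  hence O: "?a \<in> Om n" "- ?a \<in> Om n" using x by auto
  have k: "k ?a = 4" "k (- ?a) = - 4" "k e = 5"
    using ne x by (auto simp: k_def Bn_inv_uminus)
  have a0: "0 < inv y ?a"
    using yk[OF O(2,1)] k Bn_inv_uminus[OF y, of ?a] by simp
  have kw: "k w \<le> - 4 \<or> k w = 4 \<or> k w \<ge> 5" if "w \<in> Om n" for w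
  proof -
    have "inv x w \<noteq> 0" using Bn_inv_Om[OF x] that Om_nonzero by blast
    thus ?thesis by (auto simp: k_def)
  qed
  have a: "inv y ?a = 0 + 1"
  proof (rule consecutive_positions[OF y O(1) order_refl a0])
    fix w assume w: "w \<in> Om n" "inv y w < inv y ?a"
    hence "k w \<le> k (- ?a)" using yk[of w ?a] kw[of w] k O by auto
    hence "inv y w \<le> inv y (- ?a)" using yk[of "- ?a" w] w O by auto
    thus "inv y w \<le> 0" using a0 Bn_inv_uminus[OF y, of ?a] by simp
  qed
  have e': "inv y e = inv y ?a + 1"
  proof (rule consecutive_positions[OF y e])
    show "0 \<le> inv y ?a" using a0 by simp
    show "inv y ?a < inv y e" using yk[OF O(1) e] k by simp
    fix w assume "w \<in> Om n" "inv y w < inv y e"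
    hence "\<not> k ?a < k w" using yk[of w e] kw[of w] k e by auto
    thus "inv y w \<le> inv y ?a" using yk[of ?a w] \<open>w \<in> Om n\<close> O by simp
  qed
  have "y 1 = ?a" "y 2 = e"
    using a e' y by (metis Bn_apply_inv add_0 one_add_one)+
  moreover have "inv y v < 1 \<longleftrightarrow> inv x v < 1" if "v \<in> Om n" "v \<noteq> e" "v \<noteq> - e" for v
  proof -
    have "inv y v < inv y ?a \<longleftrightarrow> k v < k ?a" using yk[OF that(1) O(1)] .
    thus ?thesis using that k a by (auto simp: k_def)
  qed
  ultimately show ?thesis using y by blast
qed

section \<open>Forcing inside hexagons and octagons\<close>

lemma inversions_ascent:
  assumes "x \<in> Bn n" "i < n" "x (pre i) = a" "x (int i + 1) = b" "a < b"
  shows "inversions n (x \<circ> gen i) = inversions n x \<union> lab a b \<and> (a, b) \<notin> inversions n x"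
  using inversions_comp_gen(1)[OF assms(1,2) assms(3,4)[symmetric] assms(5)] .

lemma inversions_descent:
  assumes "x \<in> Bn n" "i < n" "x (pre i) = a" "x (int i + 1) = b" "b < a"
  shows "inversions n (x \<circ> gen i) = inversions n x - lab b a \<and> (b, a) \<in> inversions n x"
  using inversions_comp_gen(2)[OF assms(1,2) assms(3,4)[symmetric] assms(5)] .

lemma gen_below: "0 < j \<Longrightarrow> k = j \<or> k = j + 1 \<Longrightarrow> q < int j \<Longrightarrow> gen k q < int j"
  and gen_above: "0 < j \<Longrightarrow> k = j \<or> k = j + 1 \<Longrightarrow> q > int j + 2 \<Longrightarrow> gen k q > int j + 2"
  by (auto simp: gen_def)

lemma inv_comp_gen: "y \<in> Bn n \<Longrightarrow> k < n \<Longrightarrow> inv (y \<circ> gen k) v = gen k (inv y v)"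
  by (simp add: inv_comp_Bn gen_Bn)

lemma comp_gen_gen [simp]: "y \<circ> gen k \<circ> gen k = y"
  by (simp add: fun_eq_iff)

context weak_congruence
begin

text \<open>The value \<open>b\<close> lies between \<open>a\<close> and \<open>e\<close> or between
  \<open>e\<close> and \<open>c\<close>. The corresponding shorter exchange occurs in the hexagon of
  the arrangements of \<open>a, e, c\<close> and is contracted by \<open>IH\<close>; this edge
  forces the one exchanging \<open>a\<close> and \<open>c\<close>.\<close>

lemma hexagon_right:
  assumes y: "y \<in> Bn n" and j: "0 < j" "j + 1 < n"
    and vals: "y (int j) = c" "y (int j + 1) = a" "y (int j + 2) = e"
    and ord: "a < e" "e < c" "a < b" "b < c" and b: "b \<in> Om n" "b \<noteq> e"
    and bad: "((0 < b) = \<delta>) = (inv y b < int j + 1)"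
    and IH: "\<And>x i b. x \<in> Bn n \<Longrightarrow> i < n \<Longrightarrow> b \<in> Om n \<Longrightarrow> x (int i + 1) < b \<Longrightarrow> b < x (pre i) \<Longrightarrow>
      x (pre i) - x (int i + 1) < c - a \<Longrightarrow> ((0 < b) = \<delta>) = (inv x b < int i + 1) \<Longrightarrow> (x, x \<circ> gen i) \<in> R"
  shows "(y, y \<circ> gen j) \<in> R"
proof -
  define J where "J = j + 1"
  have jn: "j < n" "J < n" and J: "int J = int j + 1" using j by (auto simp: J_def)
  have pre: "pre j = int j" "pre J = int j + 1" using j by (auto simp: pre_def J_def)
  have g: "gen j (int j) = int j + 1" "gen j (int j + 1) = int j" "gen j (int j + 2) = int j + 2"
    "gen J (int j) = int j" "gen J (int j + 1) = int j + 2" "gen J (int j + 2) = int j + 1"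
    using j by (auto simp: gen_def J_def)
  have pos: "inv y b < int j \<or> inv y b > int j + 2"
  proof -
    have "b \<noteq> y (int j)" "b \<noteq> y (int j + 1)" "b \<noteq> y (int j + 2)" using ord b vals by auto
    hence "inv y b \<noteq> int j" "inv y b \<noteq> int j + 1" "inv y b \<noteq> int j + 2" using y Bn_inv_eq by metis+
    thus ?thesis by linarith
  qed
  have eO: "e \<in> Om n" using y j vals(3) Bn_Om[OF y, of "int j + 2"] by (auto simp: Om_def)
  have step: "y' \<in> Bn n \<Longrightarrow> k = j \<or> k = J \<Longrightarrow> y' \<circ> gen k \<in> Bn n" for y' k
    using Bn_comp gen_Bn jn by blast
  \<comment> \<open>Only the side of \<open>b\<close> is tracked, not its position: \<open>b\<close>
    may be the negative of one of the three values and then moves within the mirrored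
    window.\<close>
  have side: "(inv (y' \<circ> gen k) b < int j \<or> inv (y' \<circ> gen k) b > int j + 2) \<and>
      (inv (y' \<circ> gen k) b < int j + 1 \<longleftrightarrow> inv y' b < int j + 1)"
    if "y' \<in> Bn n" "k = j \<or> k = J" "inv y' b < int j \<or> inv y' b > int j + 2" for y' k
    using that gen_below[OF j(1) that(2)[unfolded J_def], of "inv y' b"] gen_above[OF j(1) that(2)[unfolded J_def], of "inv y' b"] jn
    by (auto simp: inv_comp_gen)
  have cov: "covers n y (y \<circ> gen j) a c"
    using covers_gen[OF y jn(1)] vals ord by (simp add: pre)
  show ?thesis
  proof (cases "b < e")
    case True
    \<comment> \<open>On the three positions: \<open>y\<close> is \<open>c a e\<close>,
      \<open>?x'\<close> is \<open>a c e\<close>, \<open>?y1\<close> is \<open>a e c\<close>,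
      \<open>?y2\<close> is \<open>e a c\<close>. The join of \<open>?x'\<close> and
      \<open>?y2\<close> contains \<open>(a, e)\<close> and \<open>(e, c)\<close>.\<close>
    let ?x' = "y \<circ> gen j"
    let ?y1 = "?x' \<circ> gen J"
    let ?y2 = "?y1 \<circ> gen j"
    have B: "?x' \<in> Bn n" "?y1 \<in> Bn n" "?y2 \<in> Bn n" using y step by blast+
    have I1: "inversions n ?y1 = inversions n ?x' - lab e c" "(e, c) \<in> inversions n ?x'"
      using inversions_descent[OF B(1) jn(2), of c e] vals ord by (auto simp: pre g J add.assoc)
    have I2: "inversions n ?y2 = inversions n ?y1 \<union> lab a e"
      using inversions_ascent[OF B(2) jn(1), of a e] vals ord by (auto simp: pre g J)
    have "inv ?y2 b < int j + 1 \<longleftrightarrow> inv y b < int j + 1"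
      using side[OF y, of j] side[OF B(1), of J] side[OF B(2), of j] pos by blast
    hence "(?y2, ?y2 \<circ> gen j) \<in> R"
      using vals ord b bad True by (intro IH[OF B(3) jn(1) b(1)]) (simp_all add: pre g J)
    hence "(?y1, ?y2) \<in> R" using R_sym by simp
    thus ?thesis
      by (rule join_force_step[OF cov, of _ _ e]) (use I1 I2 in \<open>auto simp: lab_def\<close>)
  next
    case False
    \<comment> \<open>Here \<open>?y2\<close> is \<open>c e a\<close> and \<open>?y1\<close> is
      \<open>e c a\<close>. In the meet of \<open>y\<close> with \<open>?y1\<close> neither
      \<open>(a, e)\<close> nor \<open>(e, c)\<close> survives.\<close>
    let ?y2 = "y \<circ> gen J"
    let ?y1 = "?y2 \<circ> gen j"
    have B: "?y2 \<in> Bn n" "?y1 \<in> Bn n" using y step by blast+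
    have I2: "inversions n ?y2 = inversions n y \<union> lab a e" "(a, e) \<notin> inversions n y"
      using inversions_ascent[OF y jn(2), of a e] vals ord by (auto simp: pre J add.assoc)
    have I1: "inversions n ?y1 = inversions n ?y2 - lab e c"
      using inversions_descent[OF B(1) jn(1), of c e] vals ord by (auto simp: pre g J)
    have "inv ?y2 b < int j + 1 \<longleftrightarrow> inv y b < int j + 1"
      using side[OF y, of J] pos by blast
    hence "(?y2, ?y2 \<circ> gen j) \<in> R"
      using vals ord b bad False by (intro IH[OF B(1) jn(1) b(1)]) (simp_all add: pre g J)
    hence "(?y1, ?y2) \<in> R" using R_sym by simp
    thus ?thesis
      by (rule meet_force_step[OF cov, of _ _ e]) (use I1 I2 eO ord in \<open>auto simp: lab_def\<close>)
  qed
qed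

text \<open>The same hexagon with \<open>e\<close> in front of the descent: meet and join change
  places between the two cases.\<close>

lemma hexagon_left:
  assumes y: "y \<in> Bn n" and j: "0 < j" "j + 1 < n"
    and vals: "y (int j) = e" "y (int j + 1) = c" "y (int j + 2) = a"
    and ord: "a < e" "e < c" "a < b" "b < c" and b: "b \<in> Om n" "b \<noteq> e"
    and bad: "((0 < b) = \<delta>) = (inv y b < int j + 2)"
    and IH: "\<And>x i b. x \<in> Bn n \<Longrightarrow> i < n \<Longrightarrow> b \<in> Om n \<Longrightarrow> x (int i + 1) < b \<Longrightarrow> b < x (pre i) \<Longrightarrow>
      x (pre i) - x (int i + 1) < c - a \<Longrightarrow> ((0 < b) = \<delta>) = (inv x b < int i + 1) \<Longrightarrow> (x, x \<circ> gen i) \<in> R"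
  shows "(y, y \<circ> gen (j + 1)) \<in> R"
proof -
  define J where "J = j + 1"
  have jn: "j < n" "J < n" and J: "int J = int j + 1" using j by (auto simp: J_def)
  have pre: "pre j = int j" "pre J = int j + 1" using j by (auto simp: pre_def J_def)
  have g: "gen j (int j) = int j + 1" "gen j (int j + 1) = int j" "gen j (int j + 2) = int j + 2"
    "gen J (int j) = int j" "gen J (int j + 1) = int j + 2" "gen J (int j + 2) = int j + 1"
    using j by (auto simp: gen_def J_def)
  have pos: "inv y b < int j \<or> inv y b > int j + 2"
  proof -
    have "b \<noteq> y (int j)" "b \<noteq> y (int j + 1)" "b \<noteq> y (int j + 2)" using ord b vals by auto
    hence "inv y b \<noteq> int j" "inv y b \<noteq> int j + 1" "inv y b \<noteq> int j + 2" using y Bn_inv_eq by metis+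
    thus ?thesis by linarith
  qed
  have eO: "e \<in> Om n" using y j vals(1) Bn_Om[OF y, of "int j"] by (auto simp: Om_def)
  have step: "y' \<in> Bn n \<Longrightarrow> k = j \<or> k = J \<Longrightarrow> y' \<circ> gen k \<in> Bn n" for y' k
    using Bn_comp gen_Bn jn by blast
  have side: "(inv (y' \<circ> gen k) b < int j \<or> inv (y' \<circ> gen k) b > int j + 2) \<and>
      (inv (y' \<circ> gen k) b < int j + 2 \<longleftrightarrow> inv y' b < int j + 2)"
    if "y' \<in> Bn n" "k = j \<or> k = J" "inv y' b < int j \<or> inv y' b > int j + 2" for y' k
    using that gen_below[OF j(1) that(2)[unfolded J_def], of "inv y' b"] gen_above[OF j(1) that(2)[unfolded J_def], of "inv y' b"] jn
    by (auto simp: inv_comp_gen)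
  have cov: "covers n y (y \<circ> gen J) a c"
    using covers_gen[OF y jn(2)] vals ord by (simp add: pre J add.assoc)
  have "(y, y \<circ> gen J) \<in> R"
  proof (cases "b < e")
    case True
    \<comment> \<open>From \<open>e c a\<close>: \<open>?y2\<close> is \<open>c e a\<close>,
      \<open>?y1\<close> is \<open>c a e\<close>.\<close>
    let ?y2 = "y \<circ> gen j"
    let ?y1 = "?y2 \<circ> gen J"
    have B: "?y2 \<in> Bn n" "?y1 \<in> Bn n" using y step by blast+
    have I2: "inversions n ?y2 = inversions n y \<union> lab e c" "(e, c) \<notin> inversions n y"
      using inversions_ascent[OF y jn(1), of e c] vals ord by (auto simp: pre J)
    have I1: "inversions n ?y1 = inversions n ?y2 - lab a e"
      using inversions_descent[OF B(1) jn(2), of e a] vals ord by (auto simp: pre g J add.assoc)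
    have "inv ?y2 b < int j + 2 \<longleftrightarrow> inv y b < int j + 2"
      using side[OF y, of j] pos by blast
    hence "(?y2, ?y2 \<circ> gen J) \<in> R"
      using vals ord b bad True by (intro IH[OF B(1) jn(2) b(1)]) (simp_all add: pre g J add.assoc)
    hence "(?y1, ?y2) \<in> R" using R_sym by simp
    thus ?thesis
      by (rule meet_force_step[OF cov, of _ _ e]) (use I1 I2 eO ord in \<open>auto simp: lab_def\<close>)
  next
    case False
    \<comment> \<open>From \<open>e c a\<close>: \<open>?x'\<close> is \<open>e a c\<close>,
      \<open>?y1\<close> is \<open>a e c\<close>, \<open>?y2\<close> is
      \<open>a c e\<close>.\<close>
    let ?x' = "y \<circ> gen J"
    let ?y1 = "?x' \<circ> gen j"
    let ?y2 = "?y1 \<circ> gen J"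
    have B: "?x' \<in> Bn n" "?y1 \<in> Bn n" "?y2 \<in> Bn n" using y step by blast+
    have I1: "inversions n ?y1 = inversions n ?x' - lab a e" "(a, e) \<in> inversions n ?x'"
      using inversions_descent[OF B(1) jn(1), of e a] vals ord by (auto simp: pre g J)
    have I2: "inversions n ?y2 = inversions n ?y1 \<union> lab e c"
      using inversions_ascent[OF B(2) jn(2), of e c] vals ord by (auto simp: pre g J add.assoc)
    have "inv ?y2 b < int j + 2 \<longleftrightarrow> inv y b < int j + 2"
      using side[OF y, of J] side[OF B(1), of j] side[OF B(2), of J] pos by blast
    hence "(?y2, ?y2 \<circ> gen J) \<in> R"
      using vals ord b bad False by (intro IH[OF B(3) jn(2) b(1)]) (simp_all add: pre g J add.assoc)
    hence "(?y1, ?y2) \<in> R" using R_sym by simp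
    thus ?thesis
      by (rule join_force_step[OF cov, of _ _ e]) (use I1 I2 in \<open>auto simp: lab_def\<close>)
  qed
  thus ?thesis by (simp add: J_def)
qed

text \<open>With \<open>f = \<bar>e\<bar>\<close>, the value \<open>b\<close> lies below
  \<open>f\<close>, and the central exchange \<open>(- f, f)\<close> spans it, or above
  \<open>f\<close>, and \<open>(f, c)\<close> does so up to negation. Both are shorter than
  \<open>2 * c\<close>. The sign of \<open>e\<close> tells on which side of the octagon
  \<open>y\<close> lies, hence whether a meet or a join does the forcing.\<close>

lemma octagon:
  assumes y: "y \<in> Bn n" and n: "2 \<le> n"
    and vals: "y 1 = - c" "y 2 = e"
    and ord: "0 < b" "b < c" "\<bar>e\<bar> < c" "e \<noteq> 0" "\<bar>e\<bar> \<noteq> b" and b: "b \<in> Om n"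
    and bad: "\<delta> = (inv y b < 1)"
    and IH: "\<And>x i b. x \<in> Bn n \<Longrightarrow> i < n \<Longrightarrow> b \<in> Om n \<Longrightarrow> x (int i + 1) < b \<Longrightarrow> b < x (pre i) \<Longrightarrow>
      x (pre i) - x (int i + 1) < 2 * c \<Longrightarrow> ((0 < b) = \<delta>) = (inv x b < int i + 1) \<Longrightarrow> (x, x \<circ> gen i) \<in> R"
  shows "(y, y \<circ> gen 0) \<in> R"
proof -
  have n01: "0 < n" "1 < n" using n by auto
  have ec: "- c < e" "e < c" "0 < c" using ord by linarith+
  have pre: "pre 0 = - 1" "pre (Suc 0) = 1" by (auto simp: pre_def)
  have g: "gen 0 1 = - 1" "gen 0 (- 1) = 1" "gen 0 2 = 2" "gen (Suc 0) 1 = 2" "gen (Suc 0) 2 = 1"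
    "gen (Suc 0) (- 1) = - 2" "gen 0 (- 2) = - 2"
    by (auto simp: gen_def)
  have um: "y (- 1) = c" "y (- 2) = - e" using vals Bn_uminus[OF y] by auto
  have pos: "inv y b < - 2 \<or> inv y b > 2"
  proof -
    have "b \<noteq> y 1" "b \<noteq> y 2" "b \<noteq> y (- 1)" "b \<noteq> y (- 2)" using ord vals um by auto
    hence "inv y b \<noteq> 1" "inv y b \<noteq> 2" "inv y b \<noteq> - 1" "inv y b \<noteq> - 2" using y Bn_inv_eq by metis+
    moreover have "inv y b \<noteq> 0" using Bn_inv_Om[OF y] b Om_nonzero by blast
    ultimately show ?thesis by linarith
  qed
  have step: "y' \<in> Bn n \<Longrightarrow> k = 0 \<or> k = Suc 0 \<Longrightarrow> y' \<circ> gen k \<in> Bn n" for y' k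
    using Bn_comp gen_Bn n01 by auto
  have side: "(inv (y' \<circ> gen k) b = inv y' b)"
    if "y' \<in> Bn n" "k = 0 \<or> k = Suc 0" "inv y' b < - 2 \<or> inv y' b > 2" for y' k
  proof -
    have "gen k q = q" if "q < - 2 \<or> q > 2" for q
      using that \<open>k = 0 \<or> k = Suc 0\<close> by (auto simp: gen_def)
    thus ?thesis using that n01 by (auto simp: inv_comp_gen)
  qed
  have cO: "c \<in> Om n"
    using Bn_Om[OF y, of "- 1"] um n by (auto simp: Om_def)
  have eO: "e \<in> Om n" "- e \<in> Om n"
    using Bn_Om[OF y, of 2] vals n by (auto simp: Om_def)
  have cov: "covers n y (y \<circ> gen 0) (- c) c"
    using covers_gen[OF y n01(1)] vals um ord by (simp add: pre)
  have mir: "(- v, - u) \<in> inversions n x" if "x \<in> Bn n" "(u, v) \<in> inversions n x" for x u v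
    using biclosed_uminus[OF biclosed_inversions] that by blast
  show ?thesis
  proof (cases "e < 0")
    case e: True
    show ?thesis
    proof (cases "b < - e")
      case True
      \<comment> \<open>Positions 1 and 2: \<open>y\<close> is \<open>- c, e\<close>,
        \<open>?y2\<close> is \<open>e, - c\<close>, \<open>?y1\<close> is \<open>- e, - c\<close>.
        In the meet the chain \<open>- c < e < - e < c\<close> consists of non-inversions, hence two
        uses of coclosedness.\<close>
      let ?y2 = "y \<circ> gen (Suc 0)"
      let ?y1 = "?y2 \<circ> gen 0"
      have B: "?y2 \<in> Bn n" "?y1 \<in> Bn n" using y step by blast+
      have I2: "inversions n ?y2 = inversions n y \<union> lab (- c) e" "(- c, e) \<notin> inversions n y"
        using inversions_ascent[OF y, of "Suc 0" "- c" e] n01 vals ec by (simp_all add: pre)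
      have I1: "inversions n ?y1 = inversions n ?y2 - lab e (- e)"
        using inversions_descent[OF B(1) n01(1), of "- e" e] vals um ec e by (simp_all add: pre g)
      have "inv ?y2 b = inv y b" using side[OF y] pos by blast
      hence "(?y2, ?y2 \<circ> gen 0) \<in> R"
        using vals um ord bad True by (intro IH[OF B(1) n01(1) b]) (simp_all add: pre g)
      hence R: "(?y1, ?y2) \<in> R" using R_sym by simp
      have ec': "e < - e" "- e < c" using e ec by simp_all
      have "(- e, c) \<notin> inversions n y" using I2(2) mir[OF y, of "- e" c] by auto
      moreover have "(e, - e) \<notin> inversions n ?y1" using I1 by (auto simp: lab_def)
      ultimately have "(e, c) \<notin> bmeet n (inversions n ?y1) (inversions n y)"
        using biclosed_cotrans[OF biclosed_bmeet[OF biclosed_inversions[OF B(2)] biclosed_inversions[OF y]], of e c "- e"]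
          bmeet_lower[of n "inversions n ?y1" "inversions n y"] eO(2) ec' by blast
      hence "(- c, c) \<notin> bmeet n (inversions n ?y1) (inversions n y)"
        using biclosed_cotrans[OF biclosed_bmeet[OF biclosed_inversions[OF B(2)] biclosed_inversions[OF y]], of "- c" c e]
          bmeet_lower[of n "inversions n ?y1" "inversions n y"] eO(1) ec I2(2) by blast
      thus ?thesis using meet_force[OF cov R] I2 by blast
    next
      case False
      \<comment> \<open>Positions 1 and 2: \<open>?x'\<close> is \<open>c, e\<close>,
        \<open>?y0\<close> is \<open>e, c\<close>, \<open>?y1\<close> is \<open>- e, c\<close>,
        \<open>?y2\<close> is \<open>c, - e\<close>. The chain \<open>- c < - e < c\<close> lies in
        the join.\<close>
      let ?x' = "y \<circ> gen 0"
      let ?y0 = "?x' \<circ> gen (Suc 0)"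
      let ?y1 = "?y0 \<circ> gen 0"
      let ?y2 = "?y1 \<circ> gen (Suc 0)"
      have B: "?x' \<in> Bn n" "?y0 \<in> Bn n" "?y1 \<in> Bn n" "?y2 \<in> Bn n" using y step by blast+
      have I0: "inversions n ?y0 = inversions n ?x' - lab e c" "(e, c) \<in> inversions n ?x'"
        using inversions_descent[OF B(1), of "Suc 0" c e] n01 vals um ec by (simp_all add: pre g)
      have I1: "inversions n ?y1 = inversions n ?y0 - lab e (- e)"
        using inversions_descent[OF B(2) n01(1), of "- e" e] vals um ec e by (simp_all add: pre g)
      have I2: "inversions n ?y2 = inversions n ?y1 \<union> lab (- e) c"
        using inversions_ascent[OF B(3), of "Suc 0" "- e" c] n01 vals um ec by (simp_all add: pre g)
      have "inv ?y2 b = inv y b" using side[OF y] side[OF B(1)] side[OF B(2)] side[OF B(3)] pos by simp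
      hence "(?y2, ?y2 \<circ> gen (Suc 0)) \<in> R"
        using vals um ord bad False pos n01 e by (intro IH[OF B(4) _ b]) (auto simp: pre g)
      hence R: "(?y1, ?y2) \<in> R" using R_sym by simp
      have "(- c, - e) \<in> inversions n ?x'" using I0(2) mir[OF B(1), of e c] by auto
      moreover have "(- e, c) \<in> inversions n ?y2" using I2 by (auto simp: lab_def)
      moreover have "inversions n ?y1 \<subseteq> inversions n ?x'" using I0 I1 by blast
      ultimately show ?thesis using join_force_step[OF cov R, of "- e"] by blast
    qed
  next
    case e: False
    have e0: "0 < e" using e ord(4) by linarith
    show ?thesis
    proof (cases "b < e")
      case True
      \<comment> \<open>Positions 1 and 2: \<open>?x'\<close> is \<open>c, e\<close>,
        \<open>?y1\<close> is \<open>e, c\<close>, \<open>?y2\<close> is \<open>- e, c\<close>. The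
        chain \<open>- c < - e < e < c\<close> lies in the join.\<close>
      let ?x' = "y \<circ> gen 0"
      let ?y1 = "?x' \<circ> gen (Suc 0)"
      let ?y2 = "?y1 \<circ> gen 0"
      have B: "?x' \<in> Bn n" "?y1 \<in> Bn n" "?y2 \<in> Bn n" using y step by blast+
      have I1: "inversions n ?y1 = inversions n ?x' - lab e c" "(e, c) \<in> inversions n ?x'"
        using inversions_descent[OF B(1), of "Suc 0" c e] n01 vals um ec by (simp_all add: pre g)
      have I2: "inversions n ?y2 = inversions n ?y1 \<union> lab (- e) e"
        using inversions_ascent[OF B(2) n01(1), of "- e" e] vals um ec e0 by (simp_all add: pre g)
      have "inv ?y2 b = inv y b" using side[OF y] side[OF B(1)] side[OF B(2)] pos by simp
      hence "(?y2, ?y2 \<circ> gen 0) \<in> R"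
        using vals um ord bad True e by (intro IH[OF B(3) n01(1) b]) (simp_all add: pre g)
      hence R: "(?y1, ?y2) \<in> R" using R_sym by simp
      have 1: "(- c, - e) \<in> inversions n ?x'" using I1(2) mir[OF B(1), of e c] by auto
      have 2: "(- e, e) \<in> inversions n ?y2" using I2 by (auto simp: lab_def)
      have "(- c, c) \<in> bjoin (inversions n ?y2) (inversions n ?x')"
        unfolding bjoin_def using 1 2 I1(2) by (meson UnI1 UnI2 r_into_trancl trancl_trans)
      moreover have "inversions n ?y1 \<subseteq> inversions n ?x'" using I1 by blast
      ultimately show ?thesis using join_force[OF cov R] by blast
    next
      case False
      \<comment> \<open>Positions 1 and 2: \<open>?y0\<close> is \<open>e, - c\<close>,
        \<open>?y2\<close> is \<open>- e, - c\<close>, \<open>?y1\<close> is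
        \<open>- c, - e\<close>. The contracted exchange is \<open>(- c, - e)\<close>, so
        \<open>IH\<close> is used with \<open>- b\<close> in place of \<open>b\<close>.\<close>
      let ?y0 = "y \<circ> gen (Suc 0)"
      let ?y2 = "?y0 \<circ> gen 0"
      let ?y1 = "?y2 \<circ> gen (Suc 0)"
      have B: "?y0 \<in> Bn n" "?y2 \<in> Bn n" "?y1 \<in> Bn n" using y step by blast+
      have I0: "inversions n ?y0 = inversions n y \<union> lab (- c) e" "(- c, e) \<notin> inversions n y"
        using inversions_ascent[OF y, of "Suc 0" "- c" e] n01 vals ec by (simp_all add: pre)
      have I2: "inversions n ?y2 = inversions n ?y0 \<union> lab (- e) e"
        using inversions_ascent[OF B(1) n01(1), of "- e" e] vals um ec e0 by (simp_all add: pre g)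
      have I1: "inversions n ?y1 = inversions n ?y2 - lab (- c) (- e)"
        using inversions_descent[OF B(2), of "Suc 0" "- e" "- c"] n01 vals um ec e0 by (simp_all add: pre g)
      have "inv ?y2 b = inv y b" using side[OF y] side[OF B(1)] pos by simp
      moreover have "inv ?y2 (- b) = - inv ?y2 b" using Bn_inv_uminus[OF B(2)] .
      ultimately have "(?y2, ?y2 \<circ> gen (Suc 0)) \<in> R"
        using vals um ord bad False pos n01 e b by (intro IH[OF B(2), of _ "- b"]) (auto simp: pre g)
      hence R: "(?y1, ?y2) \<in> R" using R_sym by simp
      have "(- c, - e) \<notin> inversions n ?y1" using I1 by (auto simp: lab_def)
      hence "(e, c) \<notin> inversions n ?y1" using mir[OF B(3), of e c] by auto
      moreover have "inversions n y \<subseteq> inversions n ?y2" using I0 I2 by blast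
      ultimately show ?thesis using meet_force_step[OF cov R _ eO(1) ec(1,2)] I0(2) by blast
    qed
  qed
qed

end

section \<open>The congruence generated by an orientation\<close>

lemma mcox_alt_word:
  "0 < i \<Longrightarrow> word_prod (alt_word i (i + 1) (mcox (i + 1) i - 1)) = gen i \<circ> gen (i + 1)"
  "0 < i \<Longrightarrow> word_prod (alt_word (i + 1) i (mcox i (i + 1) - 1)) = gen (i + 1) \<circ> gen i"
  "word_prod (alt_word 0 (0 + 1) (mcox (0 + 1) 0 - 1)) = gen 0 \<circ> gen 1 \<circ> gen 0"
  "word_prod (alt_word (0 + 1) 0 (mcox 0 (0 + 1) - 1)) = gen 1 \<circ> gen 0 \<circ> gen 1"
  by (auto simp: mcox_def alt_word_def doubleton_eq_iff upt_rec numeral_2_eq_2 numeral_3_eq_3 fun_eq_iff)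

lemma inversions_gen: "i < n \<Longrightarrow> inversions n (gen i) = lab (pre i) (int i + 1)"
  using inversions_ascent[OF id_Bn, of i n "pre i" "int i + 1"] by (simp add: pre_def)

lemma inversions_gen_gen:
  assumes "0 < i" "i + 1 < n"
  shows "inversions n (gen i) = lab (int i) (int i + 1)"
    and "inversions n (gen (i + 1)) = lab (int i + 1) (int i + 2)"
    and "inversions n (gen i \<circ> gen (i + 1)) = lab (int i) (int i + 1) \<union> lab (int i) (int i + 2)"
    and "inversions n (gen (i + 1) \<circ> gen i) = lab (int i + 1) (int i + 2) \<union> lab (int i) (int i + 2)"
proof -
  have n: "i < n" "i + 1 < n" using assms by auto
  have pre: "pre i = int i" "pre (i + 1) = int i + 1" using assms by (auto simp: pre_def)
  show I: "inversions n (gen i) = lab (int i) (int i + 1)"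
    unfolding inversions_gen[OF n(1)] pre by simp
  show J: "inversions n (gen (i + 1)) = lab (int i + 1) (int i + 2)"
    unfolding inversions_gen[OF n(2)] pre by (simp add: add.commute)
  show "inversions n (gen i \<circ> gen (i + 1)) = lab (int i) (int i + 1) \<union> lab (int i) (int i + 2)"
    using inversions_ascent[OF gen_Bn[OF n(1)] n(2), of "int i" "int i + 2"] assms
    unfolding I pre by (simp add: gen_def)
  show "inversions n (gen (i + 1) \<circ> gen i) = lab (int i + 1) (int i + 2) \<union> lab (int i) (int i + 2)"
    using inversions_ascent[OF gen_Bn[OF n(2)] n(1), of "int i" "int i + 2"] assms
    unfolding J pre by (simp add: gen_def)
qed

lemma inversions_gen_B2:
  assumes "2 \<le> n"
  shows "inversions n (gen 0) = lab (- 1) 1"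
    and "inversions n (gen 0 \<circ> gen 1) = lab (- 1) 1 \<union> lab (- 1) 2"
    and "inversions n (gen 0 \<circ> gen 1 \<circ> gen 0) = lab (- 1) 1 \<union> lab (- 1) 2 \<union> lab (- 2) 2"
    and "inversions n (gen 1) = lab 1 2"
    and "inversions n (gen 1 \<circ> gen 0) = lab 1 2 \<union> lab (- 2) 2"
    and "inversions n (gen 1 \<circ> gen 0 \<circ> gen 1) = lab 1 2 \<union> lab (- 2) 2 \<union> lab (- 2) 1"
proof -
  have n: "0 < n" "1 < n" using assms by auto
  have pre: "pre 0 = - 1" "pre 1 = 1" "pre (Suc 0) = 1" by (auto simp: pre_def)
  have B: "gen 0 \<in> Bn n" "gen 1 \<in> Bn n" "gen 0 \<circ> gen 1 \<in> Bn n" "gen 1 \<circ> gen 0 \<in> Bn n"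
    by (intro Bn_comp gen_Bn n)+
  show I0: "inversions n (gen 0) = lab (- 1) 1" using inversions_gen[OF n(1)] by (simp add: pre)
  show I1: "inversions n (gen 0 \<circ> gen 1) = lab (- 1) 1 \<union> lab (- 1) 2"
    using inversions_ascent[OF B(1) n(2), of "- 1" 2] unfolding I0 pre by (simp add: gen_def)
  show "inversions n (gen 0 \<circ> gen 1 \<circ> gen 0) = lab (- 1) 1 \<union> lab (- 1) 2 \<union> lab (- 2) 2"
    using inversions_ascent[OF B(3) n(1), of "- 2" 2] unfolding I1 pre by (simp add: gen_def)
  show J0: "inversions n (gen 1) = lab 1 2" using inversions_gen[OF n(2)] by (simp add: pre)
  show J1: "inversions n (gen 1 \<circ> gen 0) = lab 1 2 \<union> lab (- 2) 2"
    using inversions_ascent[OF B(2) n(1), of "- 2" 2] unfolding J0 pre by (simp add: gen_def)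
  show "inversions n (gen 1 \<circ> gen 0 \<circ> gen 1) = lab 1 2 \<union> lab (- 2) 2 \<union> lab (- 2) 1"
    using inversions_ascent[OF B(4) n(2), of "- 2" 1] unfolding J1 pre by (simp add: gen_def)
qed

text \<open>For \<open>i > 0\<close>, \<open>orient_down\<close> makes \<open>gen i\<close>
  congruent to \<open>gen i \<circ> gen (i + 1)\<close>, with entries
  \<open>i + 1, i + 2, i\<close>: a \<open>b c a\<close> with positive \<open>b\<close>.
  \<open>orient_up\<close> gives \<open>i + 2, i, i + 1\<close>, whose mirror image is a
  \<open>b c a\<close> with negative \<open>b\<close>. This fixes the matching of \<delta> with the
  orientation.\<close>

locale generated_congruence = weak_congruence +
  fixes \<delta> :: bool
  assumes gens: "gen_pairs (if \<delta> then orient_down n else orient_up n) \<subseteq> R"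
begin

lemma gens_down:
  assumes "\<delta>" "i + 1 < n"
  shows "(gen i, word_prod (alt_word i (i + 1) (mcox (i + 1) i - 1))) \<in> R"
proof -
  have "(i + 1, i) \<in> orient_down n" using assms by (auto simp: orient_down_def)
  thus ?thesis using gens assms(1) by (force simp: gen_pairs_def)
qed

lemma gens_up:
  assumes "\<not> \<delta>" "i + 1 < n"
  shows "(gen (i + 1), word_prod (alt_word (i + 1) i (mcox i (i + 1) - 1))) \<in> R"
proof -
  have "(i, i + 1) \<in> orient_up n" using assms by (auto simp: orient_up_def)
  thus ?thesis using gens assms(1) by (force simp: gen_pairs_def)
qed

text \<open>For \<open>m = 3\<close> the generating pair is itself a cover, and \<delta> tells on
  which side the only intermediate value \<open>i + 1\<close> stands.\<close>

lemma base_covers: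
  assumes "0 < i" "i + 1 < n"
  shows "\<exists>x x'. covers n x x' (int i) (int i + 2) \<and> (x, x') \<in> R \<and>
    ((int i, int i + 1) \<in> inversions n x) = \<delta>"
proof -
  have n: "i < n" "i + 1 < n" using assms by auto
  show ?thesis
  proof (cases \<delta>)
    case True
    let ?x = "gen i \<circ> gen (i + 1)"
    have B: "gen i \<in> Bn n" "?x \<in> Bn n" by (intro Bn_comp gen_Bn n)+
    note I = inversions_gen_gen(3)[OF assms] and I0 = inversions_gen_gen(1)[OF assms]
    have "covers n ?x (gen i) (int i) (int i + 2)"
      unfolding covers_def I I0 using B by (auto simp: lab_def)
    moreover have "(?x, gen i) \<in> R"
      using gens_down[OF True assms(2)] R_sym unfolding mcox_alt_word(1)[OF assms(1)] by blast
    moreover have "(int i, int i + 1) \<in> inversions n ?x" using I by (auto simp: lab_def)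
    ultimately show ?thesis using True by blast
  next
    case False
    let ?x = "gen (i + 1) \<circ> gen i"
    have B: "gen (i + 1) \<in> Bn n" "?x \<in> Bn n" by (intro Bn_comp gen_Bn n)+
    note I = inversions_gen_gen(4)[OF assms] and I0 = inversions_gen_gen(2)[OF assms]
    have "covers n ?x (gen (i + 1)) (int i) (int i + 2)"
      unfolding covers_def I I0 using B by (auto simp: lab_def)
    moreover have "(?x, gen (i + 1)) \<in> R"
      using gens_up[OF False assms(2)] R_sym unfolding mcox_alt_word(2)[OF assms(1)] by blast
    moreover have "(int i, int i + 1) \<notin> inversions n ?x" using I assms by (auto simp: lab_def)
    ultimately show ?thesis using False by blast
  qed
qed

text \<open>For \<open>m = 4\<close> the generating pair spans two covers; convexity contracts each
  of them, which gives two kinds of exchange at once.\<close>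

lemma base_covers_B2:
  assumes "2 \<le> n"
  shows "\<exists>x x'. covers n x x' (- 1) 2 \<and> (x, x') \<in> R \<and> ((- 1, 1) \<in> inversions n x) = \<delta>"
    and "\<exists>x x'. covers n x x' (- 2) 2 \<and> (x, x') \<in> R \<and> ((- 2, 1) \<in> inversions n x) = \<delta>"
proof -
  have n: "0 < n" "1 < n" using assms by auto
  have "(\<exists>x x'. covers n x x' (- 1) 2 \<and> (x, x') \<in> R \<and> ((- 1, 1) \<in> inversions n x) = \<delta>) \<and>
    (\<exists>x x'. covers n x x' (- 2) 2 \<and> (x, x') \<in> R \<and> ((- 2, 1) \<in> inversions n x) = \<delta>)"
  proof (cases \<delta>)
    case True
    let ?x0 = "gen 0" let ?x1 = "gen 0 \<circ> gen 1" let ?x2 = "gen 0 \<circ> gen 1 \<circ> gen 0"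
    have B: "?x0 \<in> Bn n" "?x1 \<in> Bn n" "?x2 \<in> Bn n" by (intro Bn_comp gen_Bn n)+
    note I0 = inversions_gen_B2(1)[OF assms] and I1 = inversions_gen_B2(2)[OF assms]
      and I2 = inversions_gen_B2(3)[OF assms]
    have R: "(?x0, ?x2) \<in> R" using gens_down[OF True, of 0] assms unfolding mcox_alt_word(3) by simp
    have "(?x0, ?x1) \<in> R" "(?x1, ?x2) \<in> R" using R_convex[OF R B(2)] I0 I1 I2 by blast+
    hence "(?x1, ?x0) \<in> R" "(?x2, ?x1) \<in> R" using R_sym by blast+
    moreover have "covers n ?x1 ?x0 (- 1) 2" "covers n ?x2 ?x1 (- 2) 2"
      unfolding covers_def I0 I1 I2 using B by (auto simp: lab_def)
    moreover have "(- 1, 1) \<in> inversions n ?x1" "(- 2, 1) \<in> inversions n ?x2"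
      unfolding I1 I2 by (auto simp: lab_def)
    ultimately show ?thesis using True by blast
  next
    case False
    let ?x0 = "gen 1" let ?x1 = "gen 1 \<circ> gen 0" let ?x2 = "gen 1 \<circ> gen 0 \<circ> gen 1"
    have B: "?x0 \<in> Bn n" "?x1 \<in> Bn n" "?x2 \<in> Bn n" by (intro Bn_comp gen_Bn n)+
    note I0 = inversions_gen_B2(4)[OF assms] and I1 = inversions_gen_B2(5)[OF assms]
      and I2 = inversions_gen_B2(6)[OF assms]
    have R: "(?x0, ?x2) \<in> R" using gens_up[OF False, of 0] assms unfolding mcox_alt_word(4) by simp
    have "(?x0, ?x1) \<in> R" "(?x1, ?x2) \<in> R" using R_convex[OF R B(2)] I0 I1 I2 by blast+
    hence "(?x1, ?x0) \<in> R" "(?x2, ?x1) \<in> R" using R_sym by blast+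
    moreover have "covers n ?x1 ?x0 (- 2) 2" "covers n ?x2 ?x1 (- 1) 2"
      unfolding covers_def I0 I1 I2 using B by (auto simp: lab_def)
    moreover have "(- 1, 1) \<notin> inversions n ?x2" "(- 2, 1) \<notin> inversions n ?x1"
      unfolding I1 I2 by (auto simp: lab_def)
    ultimately show ?thesis using False by blast
  qed
  thus "\<exists>x x'. covers n x x' (- 1) 2 \<and> (x, x') \<in> R \<and> ((- 1, 1) \<in> inversions n x) = \<delta>"
    and "\<exists>x x'. covers n x x' (- 2) 2 \<and> (x, x') \<in> R \<and> ((- 2, 1) \<in> inversions n x) = \<delta>" by blast+
qed

lemma force_base:
  assumes "covers n y y' (int i) (int i + 2)" "0 < i" "((int i, int i + 1) \<in> inversions n y) = \<delta>"
  shows "(y, y') \<in> R"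
proof -
  have "i + 1 < n" using coversD(9)[OF assms(1)] by (auto simp: Om_def)
  from base_covers[OF assms(2) this] obtain x x' where x: "covers n x x' (int i) (int i + 2)"
    "(x, x') \<in> R" "((int i, int i + 1) \<in> inversions n x) = \<delta>" by blast
  show ?thesis
  proof (rule covers_equiv[OF x(1,2) assms(1)])
    fix e assume "int i < e" "e < int i + 2"
    hence "e = int i + 1" by simp
    thus "(int i, e) \<in> inversions n x \<longleftrightarrow> (int i, e) \<in> inversions n y" using x(3) assms(3) by simp
  qed
qed

lemma force_base_12:
  assumes "covers n y y' (- 1) 2" "((- 1, 1) \<in> inversions n y) = \<delta>"
  shows "(y, y') \<in> R"
proof -
  have "2 \<le> n" using coversD(9)[OF assms(1)] by (auto simp: Om_def)
  from base_covers_B2(1)[OF this] obtain x x' where x: "covers n x x' (- 1) 2"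
    "(x, x') \<in> R" "((- 1, 1) \<in> inversions n x) = \<delta>" by blast
  show ?thesis
  proof (rule covers_equiv[OF x(1,2) assms(1)])
    fix e :: int assume "e \<in> Om n" "- 1 < e" "e < 2"
    hence "e = 1" using Om_nonzero[of e n] by linarith
    thus "(- 1, e) \<in> inversions n x \<longleftrightarrow> (- 1, e) \<in> inversions n y" using x(3) assms(2) by simp
  qed
qed

lemma force_base_22:
  assumes "covers n y y' (- 2) 2" "((- 2, 1) \<in> inversions n y) = \<delta>"
  shows "(y, y') \<in> R"
proof -
  have "2 \<le> n" using coversD(9)[OF assms(1)] by (auto simp: Om_def)
  from base_covers_B2(2)[OF this] obtain x x' where x: "covers n x x' (- 2) 2"
    "(x, x') \<in> R" "((- 2, 1) \<in> inversions n x) = \<delta>" by blast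
  have O: "(1::int) \<in> Om n" using \<open>2 \<le> n\<close> by (auto simp: Om_def)
  \<comment> \<open>Of the two intermediate values \<open>1\<close> and \<open>- 1\<close>, one lies
    on each side of the central pair, so the side of \<open>1\<close> determines everything.\<close>
  have m: "(- 2, - 1) \<in> inversions n w \<longleftrightarrow> (- 2, 1) \<notin> inversions n w" if "covers n w w' (- 2) 2" for w w'
    using covers_split[OF that O] biclosed_uminus[OF biclosed_inversions[OF coversD(1)[OF that]], of 1 2]
      biclosed_uminus[OF biclosed_inversions[OF coversD(1)[OF that]], of "- 2" "- 1"] by auto
  show ?thesis
  proof (rule covers_equiv[OF x(1,2) assms(1)])
    fix e :: int assume "e \<in> Om n" "- 2 < e" "e < 2"
    hence "e = 1 \<or> e = - 1" using Om_nonzero[of e n] by linarith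
    thus "(- 2, e) \<in> inversions n x \<longleftrightarrow> (- 2, e) \<in> inversions n y"
      using x(3) assms(2) m[OF x(1)] m[OF assms(1)] by auto
  qed
qed

text \<open>The exceptional label: besides \<open>b = 2\<close>, the only value strictly between \<open>-1\<close> and \<open>3\<close> is \<open>1\<close>,
  the mirror image of an exchanged value, which cannot be moved next to the pair.\<close>
lemma force_base_13:
  assumes y: "covers n y y' (- 1) 3" and 2: "((- 1, 2) \<in> inversions n y) = \<delta>"
    and 1: "((- 1, 1) \<in> inversions n y) = (\<not> \<delta>)"
  shows "(y, y') \<in> R"
proof -
  note Y = coversD[OF y]
  have n: "3 \<le> n" using Y(9) by (auto simp: Om_def)
  hence O: "(1::int) \<in> Om n" "(2::int) \<in> Om n" "(3::int) \<in> Om n" by (auto simp: Om_def)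
  have n12: "1 < n" "2 < n" "1 + 1 < n" using n by auto
  have pre: "pre 1 = 1" "pre 2 = 2" by (auto simp: pre_def)
  let ?u = "gen 2" and ?v = "gen 2 \<circ> gen 1"
  have B: "?u \<in> Bn n" "?v \<in> Bn n" by (intro Bn_comp gen_Bn n12)+
  have I0: "inversions n ?u = lab 2 3" using inversions_gen[OF n12(2)] by (simp add: pre)
  have I1: "inversions n ?v = lab 2 3 \<union> lab 1 3"
    using inversions_ascent[OF B(1) n12(1), of 1 3] unfolding I0 pre by (simp add: gen_def)
  have split: "(- 1, 2) \<in> inversions n y \<longleftrightarrow> (2, 3) \<notin> inversions n y"
    using covers_split[OF y O(2)] by simp
  show ?thesis
  proof (cases \<delta>)
    case False
    \<comment> \<open>The pair is split at \<open>1\<close>: \<open>(- 1, 1)\<close> is already an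
      inversion of \<open>y'\<close>, and joining with \<open>?v\<close> supplies
      \<open>(1, 3)\<close>.\<close>
    have R: "(?u, ?v) \<in> R"
      using gens_up[OF False n12(3)]
      unfolding one_add_one mcox_alt_word(2)[OF zero_less_one, unfolded one_add_one] .
    have "(2, 3) \<in> inversions n y" using split 2 False by simp
    hence "lab 2 3 \<subseteq> inversions n y'"
      unfolding Y(5) using biclosed_uminus[OF biclosed_inversions[OF Y(1)], of 2 3] by (auto simp: lab_def)
    moreover have "(- 1, 1) \<in> inversions n y'" unfolding Y(5) using 1 False by (auto simp: lab_def)
    ultimately show ?thesis
      using join_force_step[OF y R, of 1] unfolding I0 I1 by (auto simp: lab_def)
  next
    case True
    \<comment> \<open>Dually, complements of inversion sets give the pair at the top of the order:
      \<open>z\<close> lies above everything without \<open>(2, 3)\<close>, and \<open>z'\<close>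
      lacks \<open>(1, 3)\<close>.\<close>
    obtain z where z: "z \<in> Bn n" "inversions n z = full n - lab 2 3"
      using realize_biclosed[OF biclosed_compl[OF biclosed_inversions[OF B(1)]]] unfolding I0 by blast
    obtain z' where z': "z' \<in> Bn n" "inversions n z' = full n - (lab 2 3 \<union> lab 1 3)"
      using realize_biclosed[OF biclosed_compl[OF biclosed_inversions[OF B(2)]]] unfolding I1 by blast
    have "covers n z z' (int 1) (int 1 + 2)"
      unfolding covers_def z(2) z'(2) using z(1) z'(1) O by (auto simp: lab_def full_def)
    moreover have "(int 1, int 1 + 1) \<in> inversions n z"
      unfolding z(2) using O by (auto simp: lab_def full_def)
    ultimately have R: "(z', z) \<in> R" using force_base[of z z' 1] True R_sym by simp
    have n23: "(2, 3) \<notin> inversions n y" using split 2 True by simp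
    hence "inversions n y \<subseteq> inversions n z"
      unfolding z(2) using inversions_full biclosed_uminus[OF biclosed_inversions[OF Y(1)], of "- 3" "- 2"]
      by (auto simp: lab_def)
    moreover have "(1, 3) \<notin> inversions n z'" unfolding z'(2) by (auto simp: lab_def)
    moreover have "(- 1, 1) \<notin> inversions n y" using 1 True by simp
    ultimately show ?thesis using meet_force_step[OF y R, of 1] O by simp
  qed
qed

text \<open>If no value can be inserted, few labels remain. For \<open>a > 0\<close> both
  \<open>a + 1\<close> and \<open>c - 1\<close> must be \<open>b\<close>. For \<open>a < - 1\<close>
  both \<open>1\<close> and \<open>- 1\<close> would have to be \<open>b\<close>, and for
  \<open>a = - 1\<close>, \<open>c > 3\<close> both \<open>2\<close> and \<open>3\<close>.\<close>

lemma force_small: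
  assumes y: "covers n y y' a c" and ac: "0 < a + c"
    and b: "b \<in> Om n" "a < b" "b < c" "((a, b) \<in> inversions n y) = ((0 < b) = \<delta>)"
    and small: "\<And>b e. b \<in> Om n \<Longrightarrow> a < b \<Longrightarrow> b < c \<Longrightarrow> ((a, b) \<in> inversions n y) = ((0 < b) = \<delta>) \<Longrightarrow>
      e \<in> Om n \<Longrightarrow> a < e \<Longrightarrow> e < c \<Longrightarrow> e = b \<or> e = - a \<or> e = - c"
  shows "(y, y') \<in> R"
proof -
  note Y = coversD[OF y]
  have O: "e \<in> Om n" if "a < e" "e < c" "e \<noteq> 0" for e
    using Y(8,9) that by (auto simp: Om_def)
  note s = small[OF b]
  show ?thesis
  proof (cases "0 < a")
    case True
    have "a + 1 = b" "c - 1 = b"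
      using s[of "a + 1"] s[of "c - 1"] O[of "a + 1"] O[of "c - 1"] b True by linarith+
    hence "c = a + 2" "b = a + 1" by auto
    moreover obtain i where "a = int i" "0 < i" using zero_less_imp_eq_int[OF True] by auto
    ultimately show ?thesis using force_base[of y y' i] y b(4) by simp
  next
    case False
    hence a: "a < 0" using Y(8) Om_nonzero by force
    have "a = - 1"
    proof (rule ccontr)
      assume "a \<noteq> - 1"
      hence "a < - 1" "2 < c" using a ac by auto
      hence "- 1 = b" "1 = b" using s[of "- 1"] s[of 1] O[of "- 1"] O[of 1] by linarith+
      thus False by simp
    qed
    moreover have "c \<le> 3"
    proof (rule ccontr)
      assume "\<not> c \<le> 3"
      hence "2 = b" "3 = b" using s[of 2] s[of 3] O[of 2] O[of 3] \<open>a = - 1\<close> by linarith+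
      thus False by simp
    qed
    ultimately consider "a = - 1" "c = 2" | "a = - 1" "c = 3" using ac by linarith
    thus ?thesis
    proof cases
      case 1
      hence "b = 1" using b Om_nonzero[of b n] by linarith
      thus ?thesis using force_base_12[of y y'] y b 1 by simp
    next
      case 2
      \<comment> \<open>Were \<open>1\<close> the offending value, \<open>2\<close> would be free to
        be inserted.\<close>
      have "b \<noteq> 1" using s[of 2] O[of 2] 2 by auto
      hence b2: "b = 2" using b Om_nonzero[of b n] 2 by linarith
      \<comment> \<open>The same remark shows that \<open>1\<close> stands on its permitted side, as
        \<open>force_base_13\<close> demands.\<close>
      have "((- 1, 1) \<in> inversions n y) \<noteq> ((0 < (1::int)) = \<delta>)"
        using small[of 1 2] O[of 1] O[of 2] 2 by auto
      thus ?thesis using force_base_13[of y y'] y b b2 2 by auto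
    qed
  qed
qed

end

section \<open>Contraction of every descent across a forbidden value\<close>

context generated_congruence
begin

text \<open>At the centre a forbidden \<open>b\<close> and its negative \<open>- b\<close> are
  equivalent, because the sign and the side both flip. So \<open>b\<close> is replaced by its
  absolute value \<open>d\<close>, and the octagon applies once another absolute value below
  \<open>c\<close> is at hand.\<close>

lemma force_center:
  assumes x: "x \<in> Bn n" and n: "0 < n" and b: "b \<in> Om n" "x 1 < b" "b < - x 1"
    and bad: "((0 < b) = \<delta>) = (inv x b < 1)"
    and IH: "\<And>x' i b. x' \<in> Bn n \<Longrightarrow> i < n \<Longrightarrow> b \<in> Om n \<Longrightarrow> x' (int i + 1) < b \<Longrightarrow> b < x' (pre i) \<Longrightarrow>
      x' (pre i) - x' (int i + 1) < 2 * (- x 1) \<Longrightarrow> ((0 < b) = \<delta>) = (inv x' b < int i + 1) \<Longrightarrow>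
      (x', x' \<circ> gen i) \<in> R"
  shows "(x, x \<circ> gen 0) \<in> R"
proof -
  define c where "c = - x 1"
  have x1: "x 1 = - c" "x (- 1) = c" using Bn_uminus[OF x, of 1] by (simp_all add: c_def)
  have "(1::int) \<in> Om n" using n by (auto simp: Om_def)
  hence cO: "c \<in> Om n" using Bn_Om[OF x, of 1] x1 by simp
  have c2: "2 \<le> c" using b x1 Om_nonzero[of b n] by simp
  have n2: "2 \<le> n" using cO c2 by (auto simp: Om_def)
  define d where "d = \<bar>b\<bar>"
  have d: "d \<in> Om n" "0 < d" "d < c" using b x1 by (auto simp: d_def Om_def)
  have nz: "inv x v \<noteq> 0" if "v \<in> Om n" for v using Bn_inv_Om[OF x] that Om_nonzero by blast
  have bad': "\<delta> = (inv x d < 1)"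
  proof (cases "0 < b")
    case True thus ?thesis using bad by (simp add: d_def)
  next
    case False
    hence "d = - b" using Om_nonzero[OF b(1)] by (simp add: d_def)
    thus ?thesis using False bad nz[OF b(1)] Bn_inv_uminus[OF x, of b] by auto
  qed
  have cov: "covers n x (x \<circ> gen 0) (- c) c"
    using covers_gen[OF x n] x1 d by (simp add: pre_def)
  have mem: "(- c, v) \<in> inversions n w \<longleftrightarrow> inv w v < 1"
    if "w \<in> Bn n" "w 1 = - c" "v \<in> Om n" "- c < v" for w v
    using mem_inversions_gen[OF that(1) n, of v] Bn_uminus[OF that(1), of 1] that(2-4) d
    by (simp add: pre_def)
  show ?thesis
  proof (cases "c = 2")
    case True
    hence "d = 1" using d by simp
    thus ?thesis using force_base_22[of x "x \<circ> gen 0"] cov True mem[OF x x1(1) d(1)] bad' by simp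
  next
    case False
    \<comment> \<open>Any absolute value below \<open>c\<close> other than \<open>d\<close> serves;
      \<open>1\<close> or \<open>2\<close> is available because now
      \<open>c \<ge> 3\<close>.\<close>
    define f :: int where "f = (if d = 1 then 2 else 1)"
    have f: "f \<in> Om n" "0 < f" "f < c" "f \<noteq> d" using False c2 cO by (auto simp: f_def Om_def)
    \<comment> \<open>The sign is chosen so that \<open>e\<close> already lies right of the centre;
      inserting it at position 2 changes no side.\<close>
    define e where "e = (if 0 < inv x f then f else - f)"
    have e: "e \<in> Om n" "\<bar>e\<bar> = f" "e \<noteq> 0" using f by (auto simp: e_def)
    have ex: "0 < inv x e" using nz[OF f(1)] Bn_inv_uminus[OF x, of f] by (auto simp: e_def)
    have "e \<noteq> x 1" "e \<noteq> - x 1" using e f x1 by auto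
    from insert_center[OF x n2 e(1) this] obtain y where y: "y \<in> Bn n" "y 1 = - c" "y 2 = e"
      and side: "\<And>v. v \<in> Om n \<Longrightarrow> v \<noteq> e \<Longrightarrow> v \<noteq> - e \<Longrightarrow> inv y v < 1 \<longleftrightarrow> inv x v < 1"
      using x1 by auto
    have "d \<noteq> e" "d \<noteq> - e" using e f d by auto
    hence bady: "\<delta> = (inv y d < 1)" using side[OF d(1)] bad' by simp
    have "\<bar>e\<bar> < c" "\<bar>e\<bar> \<noteq> d" using e f by auto
    hence R: "(y, y \<circ> gen 0) \<in> R"
      by (rule octagon[OF y(1) n2 y(2,3) d(2,3) _ e(3) _ d(1) bady IH[folded c_def]])
    have covy: "covers n y (y \<circ> gen 0) (- c) c"
      using covers_gen[OF y(1) n] y(2) Bn_uminus[OF y(1), of 1] d by (simp add: pre_def)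
    show ?thesis
    proof (rule covers_equiv[OF covy R cov])
      fix v assume v: "v \<in> Om n" "- c < v" "v < c"
      have "inv y e = 2" using y by auto
      hence "inv y v < 1 \<longleftrightarrow> inv x v < 1"
        using side[OF v(1)] ex Bn_inv_uminus[OF y(1), of e] Bn_inv_uminus[OF x, of e]
        by (cases "v = e \<or> v = - e") auto
      thus "(- c, v) \<in> inversions n y \<longleftrightarrow> (- c, v) \<in> inversions n x"
        using mem[OF y(1,2) v(1,2)] mem[OF x x1(1) v(1,2)] by simp
    qed
  qed
qed

text \<open>The free value goes to the side of the descent on which it already stands, so that
  \<open>covers_equiv\<close> applies. On the right this is harmless, since \<open>- e\<close> is on
  the left anyway. On the left \<open>- e\<close> comes along; if it lies between \<open>a\<close>
  and \<open>c\<close> and right of the descent, \<open>- e\<close> is inserted on the right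
  instead.\<close>

lemma force_insert:
  assumes x: "x \<in> Bn n" and i: "0 < i" "i < n" and ac: "x (int i + 1) = a" "x (int i) = c"
    and b: "b \<in> Om n" "a < b" "b < c" and bad: "((0 < b) = \<delta>) = (inv x b < int i + 1)"
    and e: "e \<in> Om n" "a < e" "e < c" "e \<noteq> b" "e \<noteq> - a" "e \<noteq> - c"
    and IH: "\<And>x i b. x \<in> Bn n \<Longrightarrow> i < n \<Longrightarrow> b \<in> Om n \<Longrightarrow> x (int i + 1) < b \<Longrightarrow> b < x (pre i) \<Longrightarrow>
      x (pre i) - x (int i + 1) < c - a \<Longrightarrow> ((0 < b) = \<delta>) = (inv x b < int i + 1) \<Longrightarrow>
      (x, x \<circ> gen i) \<in> R"
  shows "(x, x \<circ> gen i) \<in> R"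
proof -
  have pre: "pre i = int i" using i by (simp add: pre_def)
  have cov: "covers n x (x \<circ> gen i) a c"
    using covers_gen[OF x i(2)] ac b by (simp add: pre)
  have mem: "(a, v) \<in> inversions n w \<longleftrightarrow> inv w v < int k + 1"
    if "w \<in> Bn n" "k < n" "0 < k" "w (int k + 1) = a" "w (int k) = c" "v \<in> Om n" "a < v" for w k v
    using mem_inversions_gen[OF that(1,2), of v] that b by (simp add: pre_def)
  have right: "(x, x \<circ> gen i) \<in> R"
    if b: "b \<in> Om n" "a < b" "b < c" and bad: "((0 < b) = \<delta>) = (inv x b < int i + 1)"
      and e: "e \<in> Om n" "a < e" "e < c" "e \<noteq> b" "e \<noteq> - a" "e \<noteq> - c" "\<not> inv x e < int i + 1" for b e
  proof -
    have "e \<noteq> x (int i)" "e \<noteq> - x (int i)" "e \<noteq> x (int i + 1)" "e \<noteq> - x (int i + 1)" using e ac by auto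
    from insert_right[OF x i e(1) this] obtain y j where y: "y \<in> Bn n" and j: "0 < j" "j + 1 < n"
      and v: "y (int j) = c" "y (int j + 1) = a" "y (int j + 2) = e"
      and side: "\<And>v. v \<in> Om n \<Longrightarrow> v \<noteq> e \<Longrightarrow> v \<noteq> - e \<Longrightarrow> inv y v < int j + 1 \<longleftrightarrow> inv x v < int i + 1"
      unfolding ac by blast
    have j': "j < n" using j by simp
    have pe: "inv y e = int j + 2" using v y by auto
    have side': "inv y v < int j + 1 \<longleftrightarrow> inv x v < int i + 1" if "v \<in> Om n" for v
      using side[OF that] pe e(7) Bn_inv_uminus[OF y, of e] Bn_inv_uminus[OF x, of e]
      by (cases "v = e \<or> v = - e") auto
    have bady: "((0 < b) = \<delta>) = (inv y b < int j + 1)" using bad side'[OF b(1)] by simp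
    have "(y, y \<circ> gen j) \<in> R"
      by (rule hexagon_right[OF y j v e(2,3) b(2,3,1) e(4)[symmetric] bady IH])
    moreover have "covers n y (y \<circ> gen j) a c"
      using covers_gen[OF y j'] v b j by (simp add: pre_def)
    ultimately show ?thesis
      using covers_equiv[OF _ _ cov, of y "y \<circ> gen j"] mem[OF y j' j(1) v(2,1)] mem[OF x i(2,1) ac] side'
      by blast
  qed
  show ?thesis
  proof (cases "inv x e < int i + 1")
    case False
    thus ?thesis using right[OF b bad e] by blast
  next
    case left: True
    have me: "- e \<in> Om n" "inv x (- e) = - inv x e" using e(1) Bn_inv_uminus[OF x] by auto
    show ?thesis
    proof (cases "a < - e \<and> - e < c \<and> \<not> inv x (- e) < int i + 1")
      case True
      show ?thesis
      proof (cases "b = - e")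
        case True
        \<comment> \<open>The value to be inserted is \<open>b\<close> itself; its negative
          \<open>e\<close>, with opposite sign and side, takes over the role of
          \<open>b\<close>.\<close>
        have "((0 < e) = \<delta>) = (inv x e < int i + 1)"
          using bad left True \<open>a < - e \<and> - e < c \<and> \<not> inv x (- e) < int i + 1\<close> Om_nonzero[OF e(1)] by auto
        thus ?thesis using right[of e "- e"] e me True \<open>a < - e \<and> - e < c \<and> \<not> inv x (- e) < int i + 1\<close>
          Om_nonzero[OF e(1)] by auto
      next
        case False
        thus ?thesis using right[OF b bad me(1)] True e by auto
      qed
    next
      case False
      have "e \<noteq> x (int i)" "e \<noteq> - x (int i)" "e \<noteq> x (int i + 1)" "e \<noteq> - x (int i + 1)" using e ac by auto
      from insert_left[OF x i e(1) this] obtain y j where y: "y \<in> Bn n" and j: "0 < j" "j + 1 < n"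
        and v: "y (int j) = e" "y (int j + 1) = c" "y (int j + 2) = a"
        and side: "\<And>v. v \<in> Om n \<Longrightarrow> v \<noteq> e \<Longrightarrow> v \<noteq> - e \<Longrightarrow> inv y v < int j + 2 \<longleftrightarrow> inv x v < int i + 1"
        unfolding ac by blast
      define J where "J = j + 1"
      have J: "J < n" "0 < J" "y (int J + 1) = a" "y (int J) = c" "int J = int j + 1"
        using j v by (simp_all add: J_def add.commute)
      have pe: "inv y e = int j" using v y by auto
      \<comment> \<open>If \<open>- e\<close> lies between \<open>a\<close> and \<open>c\<close>, it
        was left of the descent too, so placing both on the left is consistent.\<close>
      have side': "inv y v < int j + 2 \<longleftrightarrow> inv x v < int i + 1" if "v \<in> Om n" "a < v" "v < c" for v
        using side[OF that(1)] pe left False me that Bn_inv_uminus[OF y, of e]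
        by (cases "v = e \<or> v = - e") auto
      have bady: "((0 < b) = \<delta>) = (inv y b < int j + 2)" using bad side'[OF b] by simp
      have "(y, y \<circ> gen J) \<in> R"
        unfolding J_def by (rule hexagon_left[OF y j v e(2,3) b(2,3,1) e(4)[symmetric] bady IH])
      moreover have "covers n y (y \<circ> gen J) a c"
        using covers_gen[OF y J(1)] J b by (simp add: pre_def)
      ultimately show ?thesis
        using covers_equiv[OF _ _ cov, of y "y \<circ> gen J"] mem[OF y J(1-4)] mem[OF x i(2,1) ac] side' J(5)
        by (simp add: add.commute)
    qed
  qed
qed

text \<open>In the full notation, the forbidden configuration is an entry \<open>b\<close> whose sign agrees with
  \<open>\<delta>\<close> to the left of a descent across \<open>b\<close>, or its mirror image.\<close>
lemma force_descent:
  assumes "x \<in> Bn n" "i < n" "b \<in> Om n" "x (int i + 1) < b" "b < x (pre i)"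
    "((0 < b) = \<delta>) = (inv x b < int i + 1)"
  shows "(x, x \<circ> gen i) \<in> R"
  using assms
proof (induction "nat (x (pre i) - x (int i + 1))" arbitrary: x i b rule: less_induct)
  case less
  note x = less.prems(1) and i = less.prems(2) and b = less.prems(3-5) and bad = less.prems(6)
  have IH: "(x', x' \<circ> gen i') \<in> R"
    if "x' \<in> Bn n" "i' < n" "b' \<in> Om n" "x' (int i' + 1) < b'" "b' < x' (pre i')"
      "x' (pre i') - x' (int i' + 1) < x (pre i) - x (int i + 1)"
      "((0 < b') = \<delta>) = (inv x' b' < int i' + 1)" for x' i' b'
    using that less.hyps[of x' i' b'] by simp
  show ?case
  proof (cases "i = 0")
    case True
    have "x (pre i) = - x 1" "x (int i + 1) = x 1" using True Bn_uminus[OF x, of 1] by (simp_all add: pre_def)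
    thus ?thesis using force_center[OF x, of b] i b bad IH True by simp
  next
    case False
    hence i0: "0 < i" and pre: "pre i = int i" by (auto simp: pre_def)
    define a where "a = x (int i + 1)"
    define c where "c = x (int i)"
    have cov: "covers n x (x \<circ> gen i) a c"
      using covers_gen[OF x i] b by (simp add: pre a_def c_def)
    note O = coversD(8-10)[OF cov]
    have mem: "(a, v) \<in> inversions n x \<longleftrightarrow> inv x v < int i + 1" if "v \<in> Om n" "a < v" for v
      using mem_inversions_gen[OF x i] that O b by (simp add: pre a_def c_def)
    \<comment> \<open>The search for a free \<open>e\<close> ranges over all offending
      \<open>b\<close>, not only the given one; its failure then also restricts other offending
      values.\<close>
    show ?thesis
    proof (cases "\<exists>b e. b \<in> Om n \<and> a < b \<and> b < c \<and> ((0 < b) = \<delta>) = (inv x b < int i + 1) \<and>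
        e \<in> Om n \<and> a < e \<and> e < c \<and> e \<noteq> b \<and> e \<noteq> - a \<and> e \<noteq> - c")
      case True
      then obtain b e where be: "b \<in> Om n" "a < b" "b < c" "((0 < b) = \<delta>) = (inv x b < int i + 1)"
        "e \<in> Om n" "a < e" "e < c" "e \<noteq> b" "e \<noteq> - a" "e \<noteq> - c" by blast
      show ?thesis
        using force_insert[OF x i0 i a_def[symmetric] c_def[symmetric] be] IH
        unfolding pre a_def[symmetric] c_def[symmetric] by blast
    next
      case False
      hence small: "e = b \<or> e = - a \<or> e = - c"
        if "b \<in> Om n" "a < b" "b < c" "((a, b) \<in> inversions n x) = ((0 < b) = \<delta>)"
          "e \<in> Om n" "a < e" "e < c" for b e
        using that mem[of b] by blast
      have bI: "((a, b) \<in> inversions n x) = ((0 < b) = \<delta>)" "a < b" "b < c"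
        using mem[of b] b bad by (auto simp: a_def c_def pre)
      have "x (int i) \<noteq> x (- (int i + 1))" using Bn_eq_iff[OF x] by simp
      hence "a + c \<noteq> 0" using Bn_uminus[OF x, of "int i + 1"] by (simp add: a_def c_def)
      then consider "0 < a + c" | "a + c < 0" by linarith
      thus ?thesis
      proof cases
        case 1
        thus ?thesis using force_small[OF cov 1 b(1) bI(2,3,1)] small by blast
      next
        case 2
        \<comment> \<open>Under negation of the label \<open>v\<close> becomes \<open>- v\<close>,
          and both its sign and its side flip, so being an offending value is preserved.\<close>
        have mir: "((- c, v) \<in> inversions n x) = ((0 < v) = \<delta>) \<longleftrightarrow>
            ((a, - v) \<in> inversions n x) = ((0 < - v) = \<delta>)" if "v \<in> Om n" "- c < v" "v < - a" for v
        proof -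
          have "(- c, v) \<in> inversions n x \<longleftrightarrow> (- v, c) \<in> inversions n x"
            using biclosed_uminus[OF biclosed_inversions[OF x], of "- c" v]
              biclosed_uminus[OF biclosed_inversions[OF x], of "- v" c] by auto
          moreover have "(a, - v) \<in> inversions n x \<longleftrightarrow> (- v, c) \<notin> inversions n x"
            using covers_split[OF cov, of "- v"] that by simp
          ultimately show ?thesis using Om_nonzero[OF that(1)] by auto
        qed
        show ?thesis
        proof (rule force_small[OF covers_uminus[OF cov]])
          show "0 < - c + - a" using 2 by simp
          show "- b \<in> Om n" "- c < - b" "- b < - a" using b(1) bI by auto
          show "((- c, - b) \<in> inversions n x) = ((0 < - b) = \<delta>)"
            using mir[of "- b"] b(1) bI by simp
          fix b' e' assume h: "b' \<in> Om n" "- c < b'" "b' < - a"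
            "((- c, b') \<in> inversions n x) = ((0 < b') = \<delta>)" "e' \<in> Om n" "- c < e'" "e' < - a"
          have "- e' = - b' \<or> - e' = - a \<or> - e' = - c"
            using small[of "- b'" "- e'"] mir[OF h(1-3)] h by simp
          thus "e' = b' \<or> e' = - (- c) \<or> e' = - (- a)" by auto
        qed
      qed
    qed
  qed
qed

end

text \<open>A violation of the \<open>else\<close> branch reads \<open>c a b\<close> with
  \<open>b\<close> of the opposite sign; its mirror image \<open>- b, - a, - c\<close> has the shape
  of the \<open>then\<close> branch.\<close>

lemma not_aligned_iff:
  assumes x: "x \<in> Bn n"
  shows "\<not> aligned n \<delta> (inversions n x) \<longleftrightarrow>
    (\<exists>p q r. p \<in> Om n \<and> q \<in> Om n \<and> r \<in> Om n \<and> p < q \<and> q < r \<and> x r < x p \<and> x p < x q \<and> (0 < x p) = \<delta>)"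
    (is "_ \<longleftrightarrow> ?R")
proof
  assume "\<not> aligned n \<delta> (inversions n x)"
  then obtain a b c where h: "(a, c) \<in> inversions n x" "b \<in> Om n" "a < b" "b < c"
    "\<not> (if (0 < b) = \<delta> then (b, c) \<in> inversions n x else (a, b) \<in> inversions n x)"
    unfolding aligned_def by blast
  have ac: "a \<in> Om n" "c \<in> Om n" "inv x c < inv x a" using h(1) unfolding inversions_iff by blast+
  have ne: "inv x b \<noteq> inv x c" "inv x a \<noteq> inv x b" using Bn_inv_eq_iff[OF x] h by auto
  show ?R
  proof (cases "(0 < b) = \<delta>")
    case True
    hence "inv x b < inv x c" using h ac ne unfolding inversions_iff by auto
    thus ?thesis using h ac x True
      by (intro exI[of _ "inv x b"] exI[of _ "inv x c"] exI[of _ "inv x a"]) auto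
  next
    case False
    hence "inv x a < inv x b" using h ac ne unfolding inversions_iff by auto
    thus ?thesis using h ac x False Bn_uminus[OF x] Om_nonzero[OF h(2)]
      by (intro exI[of _ "- inv x b"] exI[of _ "- inv x a"] exI[of _ "- inv x c"]) auto
  qed
next
  assume ?R
  then obtain p q r where h: "p \<in> Om n" "q \<in> Om n" "r \<in> Om n" "p < q" "q < r" "x r < x p" "x p < x q"
    "(0 < x p) = \<delta>" by blast
  hence "(x r, x q) \<in> inversions n x" "(x p, x q) \<notin> inversions n x" "x p \<in> Om n"
    unfolding inversions_iff using x by auto
  thus "\<not> aligned n \<delta> (inversions n x)" using alignedD(1)[of n \<delta> _ "x r" "x q" "x p"] h by blast
qed

context generated_congruence
begin

text \<open>After \<open>q\<close>, the first entry below \<open>b = x p\<close> is preceded by an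
  entry above \<open>b\<close>. These neighbours form a descent across \<open>b\<close> with
  \<open>b\<close> still on its left.\<close>

lemma force_not_aligned:
  assumes x: "x \<in> Bn n" and na: "\<not> aligned n \<delta> (inversions n x)"
  shows "\<exists>i<n. x (int i + 1) < x (pre i) \<and> (x, x \<circ> gen i) \<in> R"
proof -
  obtain p q r where h: "p \<in> Om n" "q \<in> Om n" "r \<in> Om n" "p < q" "q < r" "x r < x p" "x p < x q"
    "(0 < x p) = \<delta>" using na unfolding not_aligned_iff[OF x] by blast
  let ?b = "x p"
  let ?A = "{s \<in> Om n. q < s \<and> x s < ?b}"
  have A: "finite ?A" "?A \<noteq> {}" using h by auto
  define s where "s = Min ?A"
  have s: "s \<in> Om n" "q < s" "x s < ?b" using Min_in[OF A] by (auto simp: s_def)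
  have s_le: "s \<le> t" if "t \<in> Om n" "q < t" "x t < ?b" for t
    using Min_le[OF A(1), of t] that by (simp add: s_def)
  define s' where "s' = (if s = 1 then - 1 else s - 1)"
  have s': "s' \<in> Om n" "q \<le> s'" "s' < s"
    using s h(2) by (auto simp: s'_def Om_def)
  have "\<not> x s' < ?b" using s_le[of s'] s' h(7) by (cases "s' = q") auto
  moreover have "x s' \<noteq> ?b" using Bn_eq_iff[OF x] s' h(4) by auto
  ultimately have xs': "?b < x s'" by simp
  have bO: "?b \<in> Om n" "- ?b \<in> Om n" using x h(1) by auto
  show ?thesis
  proof (cases "0 < s")
    case True
    define i where "i = nat (s - 1)"
    have i: "int i + 1 = s" "pre i = s'" "i < n"
      using True s(1) by (auto simp: i_def pre_def s'_def Om_def)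
    have "(x, x \<circ> gen i) \<in> R"
      using s(3) xs' h s' x by (intro force_descent[OF x i(3) bO(1)]) (auto simp: i)
    thus ?thesis using i s(3) xs' by auto
  next
    case False
    \<comment> \<open>The descent lies in the negative half; its mirror image at positions
      \<open>- s\<close>, \<open>- s'\<close> has \<open>- b\<close> on its right.\<close>
    define i where "i = nat (- s)"
    have i: "int i + 1 = - s'" "pre i = - s" "i < n"
      using False s(1) s' by (auto simp: i_def pre_def s'_def Om_def)
    have "(x, x \<circ> gen i) \<in> R"
      using s(3) xs' h s' x Bn_uminus[OF x] Bn_inv_uminus[OF x] Om_nonzero[OF bO(1)]
      by (intro force_descent[OF x i(3) bO(2)]) (auto simp: i)
    thus ?thesis using i s(3) xs' Bn_uminus[OF x] by (intro exI[of _ i]) auto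
  qed
qed

lemma reaches_aligned:
  assumes "x \<in> Bn n" shows "\<exists>y\<in>aligned_perms n \<delta>. (x, y) \<in> R"
  using assms
proof (induction "card (inversions n x)" arbitrary: x rule: less_induct)
  case less
  show ?case
  proof (cases "aligned n \<delta> (inversions n x)")
    case True
    thus ?thesis using less.prems R_refl by (auto simp: aligned_perms_def)
  next
    case False
    from force_not_aligned[OF less.prems this] obtain i where i: "i < n" "x (int i + 1) < x (pre i)"
      "(x, x \<circ> gen i) \<in> R" by blast
    from inversions_descent[OF less.prems i(1) refl refl i(2)]
    have "inversions n (x \<circ> gen i) \<subset> inversions n x" by (auto simp: lab_def)
    hence "card (inversions n (x \<circ> gen i)) < card (inversions n x)"
      by (meson finite_full finite_subset inversions_full psubset_card_mono)
    from less.hyps[OF this] obtain y where "y \<in> aligned_perms n \<delta>" "(x \<circ> gen i, y) \<in> R"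
      using R_Bn[OF i(3)] by blast
    thus ?thesis using R_trans[OF i(3)] by blast
  qed
qed

end

section \<open>Identification of the generated congruence\<close>

lemma lattice_cong_Int:
  assumes "lattice_cong n R" "lattice_cong n R'" shows "lattice_cong n (R \<inter> R')"
proof -
  have E: "equiv (Bn n) R" "equiv (Bn n) R'" using assms by (simp_all add: lattice_cong_def)
  have "refl_on (Bn n) (R \<inter> R')" "sym (R \<inter> R')" "trans (R \<inter> R')"
    using E refl_on_Int[of "Bn n" R "Bn n" R'] sym_Int[of R R'] trans_Int[of R R'] by (simp_all add: equiv_def)
  hence "equiv (Bn n) (R \<inter> R')" using E by (auto simp: equiv_def)
  moreover have "(weak_join n x z, weak_join n y z) \<in> R \<inter> R' \<and> (weak_meet n x z, weak_meet n y z) \<in> R \<inter> R'"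
    if "x \<in> Bn n" "y \<in> Bn n" "z \<in> Bn n" "(x, y) \<in> R \<inter> R'" for x y z
    using that assms by (simp add: lattice_cong_def)
  ultimately show ?thesis by (simp add: lattice_cong_def)
qed

lemma proj_congI:
  assumes u: "u \<in> Bn n" and w: "w \<in> Bn n" and sub: "inversions n u \<subseteq> inversions n w"
    and new: "inversions n w - inversions n u \<subseteq> - proj n \<delta> (inversions n w)"
  shows "(u, w) \<in> proj_cong n \<delta>"
proof -
  have "proj n \<delta> (inversions n w) \<subseteq> inversions n u"
    using new proj_subset[of n \<delta> "inversions n w"] by blast
  hence "proj n \<delta> (inversions n w) \<subseteq> proj n \<delta> (inversions n u)"
    by (intro proj_greatest aligned_proj proj_full)
  thus ?thesis using u w proj_mono[OF sub, of n \<delta>] by (auto simp: proj_cong_def)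
qed

lemma not_proj_lab:
  assumes K: "biclosed n K" and b: "b \<in> Om n" "a < b" "b < c"
    and nK: "(0 < b) = \<delta> \<Longrightarrow> (b, c) \<notin> K" "(0 < b) = (\<not> \<delta>) \<Longrightarrow> (a, b) \<notin> K"
  shows "lab a c \<subseteq> - proj n \<delta> K"
proof -
  have "(a, c) \<notin> proj n \<delta> K"
    using alignedD[OF aligned_proj, of a c n \<delta> K b] b nK proj_subset[of n \<delta> K] by blast
  thus ?thesis using biclosed_uminus[OF biclosed_proj[OF K, of \<delta>], of "- c" "- a"] by (auto simp: lab_def)
qed

lemma gen_pairs_proj_cong:
  assumes n: "2 \<le> n"
  shows "gen_pairs (if \<delta> then orient_down n else orient_up n) \<subseteq> proj_cong n \<delta>"
proof (clarify)
  fix u w assume uw: "(u, w) \<in> gen_pairs (if \<delta> then orient_down n else orient_up n)"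
  have O: "(1::int) \<in> Om n" "(- 1::int) \<in> Om n" using n by (auto simp: Om_def)
  show "(u, w) \<in> proj_cong n \<delta>"
  proof (cases \<delta>)
    case True
    then obtain i where i: "i + 1 < n" "u = gen i" "w = word_prod (alt_word i (i + 1) (mcox (i + 1) i - 1))"
      using uw by (auto simp: gen_pairs_def orient_down_def)
    have B: "gen i \<in> Bn n" "gen (i + 1) \<in> Bn n" using i by (auto intro: gen_Bn)
    show ?thesis
    proof (cases "i = 0")
      case False
      hence w: "w = gen i \<circ> gen (i + 1)" using i mcox_alt_word(1) by simp
      note I = inversions_gen_gen(1,3)[OF _ i(1)] 
      have iO: "int i + 1 \<in> Om n" using i by (auto simp: Om_def)
      have wB: "w \<in> Bn n" unfolding w by (rule Bn_comp[OF B])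
      have Iw: "inversions n w = lab (int i) (int i + 1) \<union> lab (int i) (int i + 2)"
        unfolding w using I(2) False by simp
      have "lab (int i) (int i + 2) \<subseteq> - proj n \<delta> (inversions n w)"
        by (rule not_proj_lab[OF biclosed_inversions[OF wB] iO]) (use True in \<open>auto simp: Iw lab_def\<close>)
      thus ?thesis
        using proj_congI[OF B(1) wB, of \<delta>] I(1) False Iw unfolding i(2) by blast
    next
      case i0: True
      hence w: "w = gen 0 \<circ> gen 1 \<circ> gen 0" using i mcox_alt_word(3) by simp
      have wB: "w \<in> Bn n" unfolding w using n by (intro Bn_comp gen_Bn) auto
      note Iw = inversions_gen_B2(3)[OF n, folded w]
      have "lab (- 1) 2 \<subseteq> - proj n \<delta> (inversions n w)" "lab (- 2) 2 \<subseteq> - proj n \<delta> (inversions n w)"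
        by (rule not_proj_lab[OF biclosed_inversions[OF wB] O(1)]; use True in \<open>auto simp: Iw lab_def\<close>)+
      thus ?thesis
        using proj_congI[OF B(1) wB, of \<delta>] inversions_gen_B2(1)[OF n] i0 Iw unfolding i(2) by blast
    qed
  next
    case False
    then obtain i where i: "i + 1 < n" "u = gen (i + 1)" "w = word_prod (alt_word (i + 1) i (mcox i (i + 1) - 1))"
      using uw by (auto simp: gen_pairs_def orient_up_def)
    have B: "gen i \<in> Bn n" "gen (i + 1) \<in> Bn n" using i by (auto intro: gen_Bn)
    show ?thesis
    proof (cases "i = 0")
      case i0: False
      hence w: "w = gen (i + 1) \<circ> gen i" using i mcox_alt_word(2) by simp
      note I = inversions_gen_gen(2,4)[OF _ i(1)] 
      have iO: "int i + 1 \<in> Om n" using i by (auto simp: Om_def)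
      have wB: "w \<in> Bn n" unfolding w by (rule Bn_comp[OF B(2,1)])
      have Iw: "inversions n w = lab (int i + 1) (int i + 2) \<union> lab (int i) (int i + 2)"
        unfolding w using I(2) i0 by simp
      have "lab (int i) (int i + 2) \<subseteq> - proj n \<delta> (inversions n w)"
        by (rule not_proj_lab[OF biclosed_inversions[OF wB] iO]) (use False i0 in \<open>auto simp: Iw lab_def\<close>)
      thus ?thesis
        using proj_congI[OF B(2) wB, of \<delta>] I(1) i0 Iw unfolding i(2) by blast
    next
      case i0: True
      hence w: "w = gen 1 \<circ> gen 0 \<circ> gen 1" using i mcox_alt_word(4) by simp
      have wB: "w \<in> Bn n" unfolding w using n by (intro Bn_comp gen_Bn) auto
      note Iw = inversions_gen_B2(6)[OF n, folded w]
      have new: "lab (- 2) 1 \<subseteq> - proj n \<delta> (inversions n w)"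
        by (rule not_proj_lab[OF biclosed_inversions[OF wB] O(2)]) (use False in \<open>auto simp: Iw lab_def\<close>)
      \<comment> \<open>No value between \<open>- 2\<close> and \<open>2\<close> excludes this pair
        directly, since \<open>(- 2, 1)\<close> and \<open>(- 1, 2)\<close> are inversions of
        \<open>w\<close>. Alignment would require \<open>(- 2, 1)\<close> in the projection, from
        which it has just been removed.\<close>
      moreover have "(- 2, 2) \<notin> proj n \<delta> (inversions n w)"
        using alignedD(2)[OF aligned_proj[of n \<delta> "inversions n w"], of "- 2" 2 1] O(1) False new
        by (auto simp: lab_def)
      ultimately show ?thesis
        using proj_congI[OF B(2) wB, of \<delta>] inversions_gen_B2(4)[OF n] i0 Iw unfolding i(2)
        by (simp add: lab_def) blast
    qed
  qed
qed

text \<open>Intersecting a competing congruence \<open>R\<close> with the kernel keeps the descent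
  to an aligned element inside one kernel class. As each such class has a unique aligned element,
  \<open>x\<close> and \<open>y\<close> reach the same one and are related in
  \<open>R\<close>.\<close>

lemma Theta_eq_proj_cong:
  assumes n: "2 \<le> n"
  shows "Theta n (if \<delta> then orient_down n else orient_up n) = proj_cong n \<delta>"
proof
  let ?E = "if \<delta> then orient_down n else orient_up n"
  show "Theta n ?E \<subseteq> proj_cong n \<delta>"
    unfolding Theta_def using lattice_cong_proj_cong gen_pairs_proj_cong[OF n] by blast
  show "proj_cong n \<delta> \<subseteq> Theta n ?E"
    unfolding Theta_def
  proof (clarify)
    fix x y R assume xy: "(x, y) \<in> proj_cong n \<delta>" and R: "lattice_cong n R" "gen_pairs ?E \<subseteq> R"
    interpret generated_congruence n "R \<inter> proj_cong n \<delta>" \<delta>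
      using lattice_cong_Int[OF R(1) lattice_cong_proj_cong] R(2) gen_pairs_proj_cong[OF n]
      by unfold_locales auto
    have eq: "inversions n z' = proj n \<delta> (inversions n z)"
      if "z' \<in> aligned_perms n \<delta>" "(z, z') \<in> proj_cong n \<delta>" for z z'
      using that proj_aligned[of n \<delta> "inversions n z'"] inversions_full
      by (simp add: aligned_perms_def proj_cong_def)
    obtain x' where x': "x' \<in> aligned_perms n \<delta>" "(x, x') \<in> R \<inter> proj_cong n \<delta>"
      using reaches_aligned[of x] xy by (auto simp: proj_cong_def)
    obtain y' where y': "y' \<in> aligned_perms n \<delta>" "(y, y') \<in> R \<inter> proj_cong n \<delta>"
      using reaches_aligned[of y] xy by (auto simp: proj_cong_def)
    have "proj n \<delta> (inversions n x) = proj n \<delta> (inversions n y)" using xy by (simp add: proj_cong_def)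
    hence "inversions n x' = inversions n y'" using eq[OF x'(1), of x] eq[OF y'(1), of y] x'(2) y'(2) by simp
    hence "x' = y'" using x'(1) y'(1) inversions_inj unfolding aligned_perms_def by blast
    thus "(x, y) \<in> R" using R_trans[OF x'(2) R_sym] y'(2) by blast
  qed
qed

text \<open>Aligned elements represent the classes, and monotonicity of \<open>proj\<close> carries
  a comparison of arbitrary representatives to these.\<close>

lemma iso_to_Cq_aligned:
  assumes n: "2 \<le> n"
  shows "iso_to_Cq n (aligned_perms n \<delta>) (if \<delta> then orient_down n else orient_up n)"
proof -
  let ?E = "if \<delta> then orient_down n else orient_up n"
  define T where "T = proj_cong n \<delta>"
  let ?S = "aligned_perms n \<delta>"
  have T: "Theta n ?E = T" unfolding T_def by (rule Theta_eq_proj_cong[OF n])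
  have eqT: "equiv (Bn n) T" using lattice_cong_proj_cong unfolding lattice_cong_def T_def by blast
  have S: "x \<in> Bn n" "proj n \<delta> (inversions n x) = inversions n x" if "x \<in> ?S" for x
    using that proj_aligned inversions_full by (auto simp: aligned_perms_def)
  have "bij_betw (\<lambda>x. T `` {x}) ?S (Cq n ?E)"
    unfolding bij_betw_def
  proof
    show "inj_on (\<lambda>x. T `` {x}) ?S"
    proof (rule inj_onI)
      fix x y assume xy: "x \<in> ?S" "y \<in> ?S" "T `` {x} = T `` {y}"
      hence "(x, y) \<in> T" using eq_equiv_class[OF xy(3) eqT] S by blast
      hence "inversions n x = inversions n y" using S(2) xy by (simp add: T_def proj_cong_def)
      thus "x = y" using inversions_inj S(1) xy by blast
    qed
    show "(\<lambda>x. T `` {x}) ` ?S = Cq n ?E"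
    proof
      show "(\<lambda>x. T `` {x}) ` ?S \<subseteq> Cq n ?E"
        unfolding Cq_def T using S by (auto intro: quotientI)
      show "Cq n ?E \<subseteq> (\<lambda>x. T `` {x}) ` ?S"
      proof
        fix X assume "X \<in> Cq n ?E"
        then obtain x where x: "x \<in> Bn n" "X = T `` {x}" unfolding Cq_def T by (rule quotientE)
        obtain y where y: "y \<in> Bn n" "inversions n y = proj n \<delta> (inversions n x)"
          using realize_biclosed[OF biclosed_proj[OF biclosed_inversions[OF x(1)]]] by blast
        have yS: "y \<in> ?S" using y aligned_proj by (simp add: aligned_perms_def)
        hence "(x, y) \<in> T" using x y S(2)[OF yS] by (simp add: T_def proj_cong_def)
        hence "X = T `` {y}" using equiv_class_eq[OF eqT] x(2) by blast
        thus "X \<in> (\<lambda>x. T `` {x}) ` ?S" using yS by blast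
      qed
    qed
  qed
  moreover have "weak_le n x y \<longleftrightarrow> Cq_le n (T `` {x}) (T `` {y})" if xy: "x \<in> ?S" "y \<in> ?S" for x y
  proof
    assume "weak_le n x y"
    moreover have "x \<in> T `` {x}" "y \<in> T `` {y}" using S xy equiv_class_self[OF eqT] by blast+
    ultimately show "Cq_le n (T `` {x}) (T `` {y})" unfolding Cq_le_def by blast
  next
    assume "Cq_le n (T `` {x}) (T `` {y})"
    then obtain u v where uv: "(x, u) \<in> T" "(y, v) \<in> T" "weak_le n u v" unfolding Cq_le_def by blast
    hence "inversions n u \<subseteq> inversions n v" by (simp add: weak_le_iff T_def proj_cong_def)
    hence "proj n \<delta> (inversions n u) \<subseteq> proj n \<delta> (inversions n v)" by (rule proj_mono)
    hence "inversions n x \<subseteq> inversions n y"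
      using uv(1,2) S xy by (simp add: T_def proj_cong_def)
    thus "weak_le n x y" using S xy by (simp add: weak_le_iff)
  qed
  ultimately show ?thesis unfolding iso_to_Cq_def by blast
qed

section \<open>Signed patterns\<close>

lemma sorted_wrt_nths: "sorted_wrt P xs \<Longrightarrow> sorted_wrt P (nths xs I)"
proof (induction xs arbitrary: I)
  case (Cons a xs)
  thus ?case using set_nths_subset[of xs] by (auto simp: nths_Cons)
qed simp

lemma contains_iff:
  "contains n x p \<longleftrightarrow> (\<exists>ks. sorted_wrt (<) ks \<and> set ks \<subseteq> {1..int n} \<and> st (map x ks) = p)"
proof
  assume "contains n x p"
  then obtain I where "st (map x (nths [1..int n] I)) = p"
    unfolding contains_def abbr_def nths_map by blast
  moreover have "sorted_wrt (<) (nths [1..int n] I)" by (intro sorted_wrt_nths sorted_wrt_upto)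
  moreover have "set (nths [1..int n] I) \<subseteq> {1..int n}" using set_nths_subset[of "[1..int n]" I] by simp
  ultimately show "\<exists>ks. sorted_wrt (<) ks \<and> set ks \<subseteq> {1..int n} \<and> st (map x ks) = p" by blast
next
  assume "\<exists>ks. sorted_wrt (<) ks \<and> set ks \<subseteq> {1..int n} \<and> st (map x ks) = p"
  then obtain ks where ks: "sorted_wrt (<) ks" "set ks \<subseteq> {1..int n}" "st (map x ks) = p" by blast
  have "filter (\<lambda>k. k \<in> set ks) [1..int n] = ks"
    by (rule strict_sorted_equal) (use ks in \<open>auto intro: sorted_wrt_filter sorted_wrt_upto\<close>)
  then obtain I where "nths [1..int n] I = ks" by (metis filter_eq_nths)
  thus "contains n x p" unfolding contains_def abbr_def nths_map using ks by blast
qed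

lemma length_st [simp]: "length (st as) = length as"
  by (simp add: st_def)

lemma contains_pair:
  "contains n x [a, b] \<longleftrightarrow> (\<exists>i j. 0 < i \<and> i < j \<and> j \<le> int n \<and> st [x i, x j] = [a, b])"
proof
  assume "contains n x [a, b]"
  then obtain ks where ks: "sorted_wrt (<) ks" "set ks \<subseteq> {1..int n}" "st (map x ks) = [a, b]"
    unfolding contains_iff by blast
  have "length ks = 2" using arg_cong[OF ks(3), of length] by simp
  then obtain i j where "ks = [i, j]" by (auto simp: numeral_2_eq_2 length_Suc_conv)
  thus "\<exists>i j. 0 < i \<and> i < j \<and> j \<le> int n \<and> st [x i, x j] = [a, b]" using ks by force
next
  assume "\<exists>i j. 0 < i \<and> i < j \<and> j \<le> int n \<and> st [x i, x j] = [a, b]"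
  then obtain i j where "0 < i" "i < j" "j \<le> int n" "st [x i, x j] = [a, b]" by blast
  thus "contains n x [a, b]" unfolding contains_iff by (intro exI[of _ "[i, j]"]) auto
qed

lemma contains_triple:
  "contains n x [a, b, c] \<longleftrightarrow>
    (\<exists>i j k. 0 < i \<and> i < j \<and> j < k \<and> k \<le> int n \<and> st [x i, x j, x k] = [a, b, c])"
proof
  assume "contains n x [a, b, c]"
  then obtain ks where ks: "sorted_wrt (<) ks" "set ks \<subseteq> {1..int n}" "st (map x ks) = [a, b, c]"
    unfolding contains_iff by blast
  have "length ks = 3" using arg_cong[OF ks(3), of length] by simp
  then obtain i j k where "ks = [i, j, k]" by (auto simp: numeral_3_eq_3 length_Suc_conv)
  thus "\<exists>i j k. 0 < i \<and> i < j \<and> j < k \<and> k \<le> int n \<and> st [x i, x j, x k] = [a, b, c]" using ks by force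
next
  assume "\<exists>i j k. 0 < i \<and> i < j \<and> j < k \<and> k \<le> int n \<and> st [x i, x j, x k] = [a, b, c]"
  then obtain i j k where "0 < i" "i < j" "j < k" "k \<le> int n" "st [x i, x j, x k] = [a, b, c]" by blast
  thus "contains n x [a, b, c]" unfolding contains_iff by (intro exI[of _ "[i, j, k]"]) auto
qed

lemma card_filter_insert:
  assumes "finite A" "u \<notin> A"
  shows "card {b \<in> insert u A. P b} = (if P u then 1 else 0) + card {b \<in> A. P b}"
proof -
  have "{b \<in> insert u A. P b} = (if P u then insert u {b \<in> A. P b} else {b \<in> A. P b})" by auto
  thus ?thesis using assms by simp
qed

lemma st_pair:
  assumes "\<bar>u\<bar> \<noteq> \<bar>v\<bar>"
  shows "st [u, v] = [sgn u * (if \<bar>v\<bar> < \<bar>u\<bar> then 2 else 1), sgn v * (if \<bar>u\<bar> < \<bar>v\<bar> then 2 else 1)]"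
proof -
  have "u \<noteq> v" using assms by auto
  hence "card {b \<in> {u, v}. P b} = (if P u then 1 else 0) + (if P v then 1 else 0)" for P
    using card_filter_insert[of "{v}" u P] card_filter_insert[of "{}" v P] by simp
  thus ?thesis unfolding st_def list.map list.set using assms by simp
qed

lemma st_triple:
  assumes "\<bar>u\<bar> \<noteq> \<bar>v\<bar>" "\<bar>u\<bar> \<noteq> \<bar>w\<bar>" "\<bar>v\<bar> \<noteq> \<bar>w\<bar>"
  shows "st [u, v, w] =
   [sgn u * (1 + (if \<bar>v\<bar> < \<bar>u\<bar> then 1 else 0) + (if \<bar>w\<bar> < \<bar>u\<bar> then 1 else 0)),
    sgn v * (1 + (if \<bar>u\<bar> < \<bar>v\<bar> then 1 else 0) + (if \<bar>w\<bar> < \<bar>v\<bar> then 1 else 0)),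
    sgn w * (1 + (if \<bar>u\<bar> < \<bar>w\<bar> then 1 else 0) + (if \<bar>v\<bar> < \<bar>w\<bar> then 1 else 0))]"
proof -
  have "u \<noteq> v" "u \<noteq> w" "v \<noteq> w" using assms by auto
  hence "card {b \<in> {u, v, w}. P b} =
      (if P u then 1 else 0) + (if P v then 1 else 0) + (if P w then 1 else 0)" for P
    using card_filter_insert[of "{v, w}" u P] card_filter_insert[of "{w}" v P]
      card_filter_insert[of "{}" w P] by simp
  thus ?thesis unfolding st_def list.map list.set using assms by simp
qed

lemma st_pair_iff:
  fixes u v :: int
  assumes "u \<noteq> 0" "v \<noteq> 0" "\<bar>u\<bar> \<noteq> \<bar>v\<bar>"
  shows "st [u, v] = [-2, -1] \<longleftrightarrow> u < v \<and> v < 0"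
    and "st [u, v] = [2, -1] \<longleftrightarrow> v < 0 \<and> - v < u"
    and "st [u, v] = [-2, 1] \<longleftrightarrow> 0 < v \<and> u < - v"
    and "st [u, v] = [1, -2] \<longleftrightarrow> 0 < u \<and> v < - u"
  unfolding st_pair[OF assms(3)] using assms by (auto simp: sgn_if abs_if split: if_splits)

text \<open>With \<open>count_eq\<close> this turns each equation of a standardization into a sign
  and comparisons of absolute values, which linear arithmetic can decide.\<close>

lemma sgn_mult_eq:
  fixes u m k :: int
  assumes "0 < m" "0 < k"
  shows "sgn u * m = k \<longleftrightarrow> 0 < u \<and> m = k" "sgn u * m = - k \<longleftrightarrow> u < 0 \<and> m = k"
  using assms by (auto simp: sgn_if)

lemma count_eq:
  "1 + (if A then 1 else 0) + (if B then 1 else 0) = (1::int) \<longleftrightarrow> \<not> A \<and> \<not> B"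
  "1 + (if A then 1 else 0) + (if B then 1 else 0) = (2::int) \<longleftrightarrow> A \<noteq> B"
  "1 + (if A then 1 else 0) + (if B then 1 else 0) = (3::int) \<longleftrightarrow> A \<and> B"
  "0 < 1 + (if A then 1 else 0) + (if B then 1 else (0::int))"
  by auto

lemma st_triple_iff:
  fixes u v w :: int
  assumes "u \<noteq> 0" "v \<noteq> 0" "w \<noteq> 0" "\<bar>u\<bar> \<noteq> \<bar>v\<bar>" "\<bar>u\<bar> \<noteq> \<bar>w\<bar>" "\<bar>v\<bar> \<noteq> \<bar>w\<bar>"
  shows "st [u, v, w] = [-2, 3, 1] \<longleftrightarrow> 0 < w \<and> w < - u \<and> - u < v"
    and "st [u, v, w] = [-1, 2, -3] \<longleftrightarrow> 0 < - u \<and> - u < v \<and> v < - w"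
    and "st [u, v, w] = [1, 2, -3] \<longleftrightarrow> 0 < u \<and> u < v \<and> v < - w"
    and "st [u, v, w] = [2, 3, 1] \<longleftrightarrow> 0 < w \<and> w < u \<and> u < v"
    and "st [u, v, w] = [-2, -1, -3] \<longleftrightarrow> v < 0 \<and> u < v \<and> w < u"
    and "st [u, v, w] = [-1, 3, -2] \<longleftrightarrow> u < 0 \<and> w < u \<and> - w < v"
    and "st [u, v, w] = [3, -1, 2] \<longleftrightarrow> v < 0 \<and> - v < w \<and> w < u"
    and "st [u, v, w] = [3, 1, 2] \<longleftrightarrow> 0 < v \<and> v < w \<and> w < u"
  unfolding st_triple[OF assms(4-6)] list.inject
  by (simp_all only: sgn_mult_eq count_eq zero_less_one zero_less_numeral simp_thms)
     (smt (z3) assms)+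

lemma Bn_abs_distinct:
  assumes "x \<in> Bn n" "0 < i" "i < j"
  shows "x i \<noteq> 0" "x j \<noteq> 0" "\<bar>x i\<bar> \<noteq> \<bar>x j\<bar>"
proof -
  have "x i \<noteq> x 0" "x j \<noteq> x 0" "x i \<noteq> x j" "x i \<noteq> x (- j)"
    using Bn_eq_iff[OF assms(1)] assms(2,3) by simp_all
  thus "x i \<noteq> 0" "x j \<noteq> 0" "\<bar>x i\<bar> \<noteq> \<bar>x j\<bar>"
    using Bn_zero[OF assms(1)] Bn_uminus[OF assms(1), of j] by (auto simp: abs_if split: if_splits)
qed

lemma contains_pair_iff:
  assumes x: "x \<in> Bn n"
  shows "contains n x [-2, -1] \<longleftrightarrow> (\<exists>i j. 0 < i \<and> i < j \<and> j \<le> int n \<and> x i < x j \<and> x j < 0)"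
    and "contains n x [2, -1] \<longleftrightarrow> (\<exists>i j. 0 < i \<and> i < j \<and> j \<le> int n \<and> x j < 0 \<and> - x j < x i)"
    and "contains n x [-2, 1] \<longleftrightarrow> (\<exists>i j. 0 < i \<and> i < j \<and> j \<le> int n \<and> 0 < x j \<and> x i < - x j)"
    and "contains n x [1, -2] \<longleftrightarrow> (\<exists>i j. 0 < i \<and> i < j \<and> j \<le> int n \<and> 0 < x i \<and> x j < - x i)"
  unfolding contains_pair
  using st_pair_iff[OF Bn_abs_distinct[OF x]] by (simp_all cong: conj_cong)

lemma contains_triple_iff:
  assumes x: "x \<in> Bn n"
  shows "contains n x [-2, 3, 1] \<longleftrightarrow>
      (\<exists>i j k. 0 < i \<and> i < j \<and> j < k \<and> k \<le> int n \<and> 0 < x k \<and> x k < - x i \<and> - x i < x j)"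
    and "contains n x [-1, 2, -3] \<longleftrightarrow>
      (\<exists>i j k. 0 < i \<and> i < j \<and> j < k \<and> k \<le> int n \<and> 0 < - x i \<and> - x i < x j \<and> x j < - x k)"
    and "contains n x [1, 2, -3] \<longleftrightarrow>
      (\<exists>i j k. 0 < i \<and> i < j \<and> j < k \<and> k \<le> int n \<and> 0 < x i \<and> x i < x j \<and> x j < - x k)"
    and "contains n x [2, 3, 1] \<longleftrightarrow>
      (\<exists>i j k. 0 < i \<and> i < j \<and> j < k \<and> k \<le> int n \<and> 0 < x k \<and> x k < x i \<and> x i < x j)"
    and "contains n x [-2, -1, -3] \<longleftrightarrow>
      (\<exists>i j k. 0 < i \<and> i < j \<and> j < k \<and> k \<le> int n \<and> x j < 0 \<and> x i < x j \<and> x k < x i)"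
    and "contains n x [-1, 3, -2] \<longleftrightarrow>
      (\<exists>i j k. 0 < i \<and> i < j \<and> j < k \<and> k \<le> int n \<and> x i < 0 \<and> x k < x i \<and> - x k < x j)"
    and "contains n x [3, -1, 2] \<longleftrightarrow>
      (\<exists>i j k. 0 < i \<and> i < j \<and> j < k \<and> k \<le> int n \<and> x j < 0 \<and> - x j < x k \<and> x k < x i)"
    and "contains n x [3, 1, 2] \<longleftrightarrow>
      (\<exists>i j k. 0 < i \<and> i < j \<and> j < k \<and> k \<le> int n \<and> 0 < x j \<and> x j < x k \<and> x k < x i)"
proof -
  have D: "x i \<noteq> 0" "x j \<noteq> 0" "x k \<noteq> 0" "\<bar>x i\<bar> \<noteq> \<bar>x j\<bar>" "\<bar>x i\<bar> \<noteq> \<bar>x k\<bar>" "\<bar>x j\<bar> \<noteq> \<bar>x k\<bar>"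
    if "0 < i" "i < j" "j < k" for i j k
    using Bn_abs_distinct[OF x that(1,2)] Bn_abs_distinct[OF x, of i k] Bn_abs_distinct[OF x, of j k] that
    by auto
  show "contains n x [-2, 3, 1] \<longleftrightarrow>
      (\<exists>i j k. 0 < i \<and> i < j \<and> j < k \<and> k \<le> int n \<and> 0 < x k \<and> x k < - x i \<and> - x i < x j)"
    and "contains n x [-1, 2, -3] \<longleftrightarrow>
      (\<exists>i j k. 0 < i \<and> i < j \<and> j < k \<and> k \<le> int n \<and> 0 < - x i \<and> - x i < x j \<and> x j < - x k)"
    and "contains n x [1, 2, -3] \<longleftrightarrow>
      (\<exists>i j k. 0 < i \<and> i < j \<and> j < k \<and> k \<le> int n \<and> 0 < x i \<and> x i < x j \<and> x j < - x k)"
    and "contains n x [2, 3, 1] \<longleftrightarrow>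
      (\<exists>i j k. 0 < i \<and> i < j \<and> j < k \<and> k \<le> int n \<and> 0 < x k \<and> x k < x i \<and> x i < x j)"
    and "contains n x [-2, -1, -3] \<longleftrightarrow>
      (\<exists>i j k. 0 < i \<and> i < j \<and> j < k \<and> k \<le> int n \<and> x j < 0 \<and> x i < x j \<and> x k < x i)"
    and "contains n x [-1, 3, -2] \<longleftrightarrow>
      (\<exists>i j k. 0 < i \<and> i < j \<and> j < k \<and> k \<le> int n \<and> x i < 0 \<and> x k < x i \<and> - x k < x j)"
    and "contains n x [3, -1, 2] \<longleftrightarrow>
      (\<exists>i j k. 0 < i \<and> i < j \<and> j < k \<and> k \<le> int n \<and> x j < 0 \<and> - x j < x k \<and> x k < x i)"
    and "contains n x [3, 1, 2] \<longleftrightarrow>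
      (\<exists>i j k. 0 < i \<and> i < j \<and> j < k \<and> k \<le> int n \<and> 0 < x j \<and> x j < x k \<and> x k < x i)"
    unfolding contains_triple using st_triple_iff[OF D] by (simp_all cong: conj_cong)
qed

lemma not_alignedI:
  assumes x: "x \<in> Bn n" and "p \<in> Om n" "q \<in> Om n" "r \<in> Om n" "p < q" "q < r"
    "x r < x p" "x p < x q" "(0 < x p) = \<delta>"
  shows "\<not> aligned n \<delta> (inversions n x)"
  unfolding not_aligned_iff[OF x] using assms by blast

text \<open>An occurrence \<open>b c a\<close> with \<open>b > 0\<close> in the full notation is
  folded onto the positive positions. The place of the centre among \<open>p, q, r\<close> and the
  size of \<open>a\<close> determine the pattern; where two entries suffice, a pattern of length two
  arises.\<close>

lemma avoiding_eq_aligned_True: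
  "avoiding n [[-2,-1], [2,-1], [-2,3,1], [-1,2,-3], [1,2,-3], [2,3,1]] = aligned_perms n True"
proof -
  have "aligned n True (inversions n x) \<longleftrightarrow>
    (\<forall>w\<in>set [[-2,-1], [2,-1], [-2,3,1], [-1,2,-3], [1,2,-3], [2,3,1]]. \<not> contains n x w)"
    if x: "x \<in> Bn n" for x
  proof -
    note um = Bn_uminus[OF x]
    note C = contains_pair_iff(1,2)[OF x] contains_triple_iff(1-4)[OF x]
    have Om: "i \<in> Om n" "- i \<in> Om n" if "0 < i" "i \<le> int n" for i using that by (auto simp: Om_def)
    note N = not_alignedI[OF x, where \<delta> = True]
    have "\<not> aligned n True (inversions n x)" if c: "contains n x [-2, -1]"
    proof -
      obtain i j where "0 < i" "i < j" "j \<le> int n" "x i < x j" "x j < 0" using c unfolding C by blast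
      \<comment> \<open>The third entry is the negative of the second:
        \<open>- x j, - x i, x i\<close> is the occurrence \<open>b c a\<close>.\<close>
      thus ?thesis using Om[of i] Om[of j] um by (intro N[of "- j" "- i" i]) auto
    qed
    moreover have "\<not> aligned n True (inversions n x)" if c: "contains n x [2, -1]"
    proof -
      obtain i j where "0 < i" "i < j" "j \<le> int n" "x j < 0" "- x j < x i" using c unfolding C by blast
      thus ?thesis using Om[of i] Om[of j] um by (intro N[of "- j" i j]) auto
    qed
    moreover have "\<not> aligned n True (inversions n x)" if c: "contains n x [-2, 3, 1]"
    proof -
      obtain i j k where "0 < i" "i < j" "j < k" "k \<le> int n" "0 < x k" "x k < - x i" "- x i < x j"
        using c unfolding C by blast
      thus ?thesis using Om[of i] Om[of j] Om[of k] um by (intro N[of "- i" j k]) auto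
    qed
    moreover have "\<not> aligned n True (inversions n x)" if c: "contains n x [-1, 2, -3]"
    proof -
      obtain i j k where "0 < i" "i < j" "j < k" "k \<le> int n" "0 < - x i" "- x i < x j" "x j < - x k"
        using c unfolding C by blast
      thus ?thesis using Om[of i] Om[of j] Om[of k] um by (intro N[of "- i" j k]) auto
    qed
    moreover have "\<not> aligned n True (inversions n x)" if c: "contains n x [1, 2, -3]"
    proof -
      obtain i j k where "0 < i" "i < j" "j < k" "k \<le> int n" "0 < x i" "x i < x j" "x j < - x k"
        using c unfolding C by blast
      thus ?thesis using Om[of i] Om[of j] Om[of k] by (intro N[of i j k]) auto
    qed
    moreover have "\<not> aligned n True (inversions n x)" if c: "contains n x [2, 3, 1]"
    proof -
      obtain i j k where "0 < i" "i < j" "j < k" "k \<le> int n" "0 < x k" "x k < x i" "x i < x j"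
        using c unfolding C by blast
      thus ?thesis using Om[of i] Om[of j] Om[of k] by (intro N[of i j k]) auto
    qed
    moreover have "\<exists>w\<in>set [[-2,-1], [2,-1], [-2,3,1], [-1,2,-3], [1,2,-3], [2,3,1]]. contains n x w"
      if na: "\<not> aligned n True (inversions n x)"
    proof (rule ccontr)
      assume none: "\<not> ?thesis"
      have nc: "\<not> contains n x [-2, -1]" "\<not> contains n x [2, -1]" "\<not> contains n x [-2, 3, 1]"
        "\<not> contains n x [-1, 2, -3]" "\<not> contains n x [1, 2, -3]" "\<not> contains n x [2, 3, 1]"
        using none by simp_all
      obtain p q r where pqr: "p \<in> Om n" "q \<in> Om n" "r \<in> Om n" "p < q" "q < r"
        "x r < x p" "x p < x q" "0 < x p" using na unfolding not_aligned_iff[OF x] by blast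
      have bd: "p \<noteq> 0" "q \<noteq> 0" "r \<noteq> 0" "- int n \<le> p" "p \<le> int n" "- int n \<le> q" "q \<le> int n"
        "- int n \<le> r" "r \<le> int n"
        using pqr(1-3) by (auto simp: Om_def)
      have n1: "\<not> (x i < x j \<and> x j < 0)" and n2: "\<not> (x j < 0 \<and> - x j < x i)"
        if "0 < i" "i < j" "j \<le> int n" for i j
        using nc(1,2) that unfolding C by blast+
      have n3: "\<not> (0 < x k \<and> x k < - x i \<and> - x i < x j)" and n4: "\<not> (0 < - x i \<and> - x i < x j \<and> x j < - x k)"
        and n5: "\<not> (0 < x i \<and> x i < x j \<and> x j < - x k)" and n6: "\<not> (0 < x k \<and> x k < x i \<and> x i < x j)"
        if "0 < i" "i < j" "j < k" "k \<le> int n" for i j k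
        using nc(3-6) that unfolding C by blast+
      have ne: "\<bar>x i\<bar> \<noteq> \<bar>x j\<bar>" "x i \<noteq> 0" if "0 < i" "i < j" for i j
        using Bn_abs_distinct[OF x that] by auto
      have r0: "x r \<noteq> 0" using pqr(3) x Bn_Om Om_nonzero by blast
      consider "0 < p" | "p < 0" "0 < q" | "q < 0" using bd by linarith
      thus False
      proof cases
        case 1
        hence "0 < q" using pqr(4) by simp
        thus False
          using n6[OF 1 pqr(4,5) bd(9)] n5[OF 1 pqr(4,5) bd(9)] n2[OF _ pqr(5) bd(9)] ne[OF _ pqr(5)]
            pqr(6-8) r0 by linarith
      next
        case 2
        define P where "P = - p"
        have P: "x p = - x P" "0 < P" "P \<le> int n" using um[of P] 2 bd by (auto simp: P_def)
        have "P \<noteq> q" using P pqr by auto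
        then consider "P < q" | "q < P" by linarith
        thus False
        proof cases
          case 1
          thus False
            using n3[OF P(2) 1 pqr(5) bd(9)] n4[OF P(2) 1 pqr(5) bd(9)] n2[OF 2(2) pqr(5) bd(9)]
              ne[OF 2(2) pqr(5)] pqr(6-8) r0 P(1) by linarith
        next
          case qP: 2
          thus False using n2[OF 2(2) qP P(3)] pqr(7,8) P(1) by linarith
        qed
      next
        case 3
        define P Q where "P = - p" and "Q = - q"
        have P: "x p = - x P" "x q = - x Q" "0 < Q" "Q < P" "P \<le> int n"
          using um[of P] um[of Q] 3 pqr bd by (auto simp: P_def Q_def)
        thus False using n1[OF P(3-5)] pqr(7,8) by linarith
      qed
    qed
    ultimately show ?thesis by auto
  qed
  thus ?thesis unfolding avoiding_def aligned_perms_def by blast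
qed

text \<open>Now \<open>a < b < 0\<close>, so it is the sign and size of \<open>c\<close> that vary.
  If the centre separates \<open>p\<close> from \<open>r\<close>, then \<open>b\<close> and
  \<open>a\<close> alone give a pattern of length two.\<close>

lemma avoiding_eq_aligned_False:
  "avoiding n [[-2,1], [1,-2], [-2,-1,-3], [-1,3,-2], [3,-1,2], [3,1,2]] = aligned_perms n False"
proof -
  have "aligned n False (inversions n x) \<longleftrightarrow>
    (\<forall>w\<in>set [[-2,1], [1,-2], [-2,-1,-3], [-1,3,-2], [3,-1,2], [3,1,2]]. \<not> contains n x w)"
    if x: "x \<in> Bn n" for x
  proof -
    note um = Bn_uminus[OF x]
    note C = contains_pair_iff(3,4)[OF x] contains_triple_iff(5-8)[OF x]
    have Om: "i \<in> Om n" "- i \<in> Om n" if "0 < i" "i \<le> int n" for i using that by (auto simp: Om_def)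
    note N = not_alignedI[OF x, where \<delta> = False]
    have "\<not> aligned n False (inversions n x)" if c: "contains n x [-2, 1]"
    proof -
      obtain i j where "0 < i" "i < j" "j \<le> int n" "0 < x j" "x i < - x j" using c unfolding C by blast
      thus ?thesis using Om[of i] Om[of j] um by (intro N[of "- j" "- i" i]) auto
    qed
    moreover have "\<not> aligned n False (inversions n x)" if c: "contains n x [1, -2]"
    proof -
      obtain i j where "0 < i" "i < j" "j \<le> int n" "0 < x i" "x j < - x i" using c unfolding C by blast
      thus ?thesis using Om[of i] Om[of j] um by (intro N[of "- i" i j]) auto
    qed
    moreover have "\<not> aligned n False (inversions n x)" if c: "contains n x [-2, -1, -3]"
    proof -
      obtain i j k where "0 < i" "i < j" "j < k" "k \<le> int n" "x j < 0" "x i < x j" "x k < x i"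
        using c unfolding C by blast
      thus ?thesis using Om[of i] Om[of j] Om[of k] by (intro N[of i j k]) auto
    qed
    moreover have "\<not> aligned n False (inversions n x)" if c: "contains n x [-1, 3, -2]"
    proof -
      obtain i j k where "0 < i" "i < j" "j < k" "k \<le> int n" "x i < 0" "x k < x i" "- x k < x j"
        using c unfolding C by blast
      thus ?thesis using Om[of i] Om[of j] Om[of k] by (intro N[of i j k]) auto
    qed
    moreover have "\<not> aligned n False (inversions n x)" if c: "contains n x [3, -1, 2]"
    proof -
      obtain i j k where "0 < i" "i < j" "j < k" "k \<le> int n" "x j < 0" "- x j < x k" "x k < x i"
        using c unfolding C by blast
      thus ?thesis using Om[of i] Om[of j] Om[of k] um by (intro N[of "- k" "- j" "- i"]) auto
    qed
    moreover have "\<not> aligned n False (inversions n x)" if c: "contains n x [3, 1, 2]"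
    proof -
      obtain i j k where "0 < i" "i < j" "j < k" "k \<le> int n" "0 < x j" "x j < x k" "x k < x i"
        using c unfolding C by blast
      thus ?thesis using Om[of i] Om[of j] Om[of k] um by (intro N[of "- k" "- j" "- i"]) auto
    qed
    moreover have "\<exists>w\<in>set [[-2,1], [1,-2], [-2,-1,-3], [-1,3,-2], [3,-1,2], [3,1,2]]. contains n x w"
      if na: "\<not> aligned n False (inversions n x)"
    proof (rule ccontr)
      assume none: "\<not> ?thesis"
      have nc: "\<not> contains n x [-2, 1]" "\<not> contains n x [1, -2]" "\<not> contains n x [-2, -1, -3]"
        "\<not> contains n x [-1, 3, -2]" "\<not> contains n x [3, -1, 2]" "\<not> contains n x [3, 1, 2]"
        using none by simp_all
      obtain p q r where pqr: "p \<in> Om n" "q \<in> Om n" "r \<in> Om n" "p < q" "q < r"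
        "x r < x p" "x p < x q" "\<not> 0 < x p" using na unfolding not_aligned_iff[OF x] by blast
      have bd: "p \<noteq> 0" "q \<noteq> 0" "r \<noteq> 0" "- int n \<le> p" "p \<le> int n" "- int n \<le> q" "q \<le> int n"
        "- int n \<le> r" "r \<le> int n"
        using pqr(1-3) by (auto simp: Om_def)
      have n1: "\<not> (0 < x j \<and> x i < - x j)" and n2: "\<not> (0 < x i \<and> x j < - x i)"
        if "0 < i" "i < j" "j \<le> int n" for i j
        using nc(1,2) that unfolding C by blast+
      have n3: "\<not> (x j < 0 \<and> x i < x j \<and> x k < x i)" and n4: "\<not> (x i < 0 \<and> x k < x i \<and> - x k < x j)"
        and n5: "\<not> (x j < 0 \<and> - x j < x k \<and> x k < x i)" and n6: "\<not> (0 < x j \<and> x j < x k \<and> x k < x i)"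
        if "0 < i" "i < j" "j < k" "k \<le> int n" for i j k
        using nc(3-6) that unfolding C by blast+
      have ne: "\<bar>x i\<bar> \<noteq> \<bar>x j\<bar>" "x i \<noteq> 0" if "0 < i" "i < j" for i j
        using Bn_abs_distinct[OF x that] by auto
      have "x p \<noteq> 0" "x q \<noteq> 0" using pqr(1,2) x Bn_Om Om_nonzero by blast+
      hence b0: "x p < 0" "x q \<noteq> 0" using pqr(8) by auto
      consider "r < 0" | "0 < r" "0 < p" | "0 < r" "p < 0" using bd by linarith
      thus False
      proof cases
        case 1
        define P Q S where "P = - p" and "Q = - q" and "S = - r"
        have P: "x p = - x P" "x q = - x Q" "x r = - x S" "0 < S" "S < Q" "Q < P" "P \<le> int n" "0 < Q"
          using um[of P] um[of Q] um[of S] 1 pqr bd by (auto simp: P_def Q_def S_def)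
        show False
          using n6[OF P(4-7)] n5[OF P(4-7)] n1[OF P(8,6,7)] ne[OF P(8,6)] P(1-3) pqr(6,7) b0 by linarith
      next
        case 2
        thus False
          using n3[OF 2(2) pqr(4,5) bd(9)] n4[OF 2(2) pqr(4,5) bd(9)] n1[OF 2(2) pqr(4) bd(7)]
            n2[OF _ pqr(5) bd(9)] ne[OF 2(2) pqr(4)] ne[OF _ pqr(5)] 2(2) pqr(4,6,7) b0 by linarith
      next
        case 3
        define P where "P = - p"
        have P: "x p = - x P" "0 < P" "P \<le> int n" using um[of P] 3 bd by (auto simp: P_def)
        have "P \<noteq> r" using P pqr b0 by auto
        then consider "P < r" | "r < P" by linarith
        thus False
        proof cases
          case 1
          thus False using n2[OF P(2) 1 bd(9)] pqr(6) P(1) b0 by linarith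
        next
          case 2
          thus False using n1[OF 3(1) 2 P(3)] pqr(6) P(1) b0 by linarith
        qed
      qed
    qed
    ultimately show ?thesis by auto
  qed
  thus ?thesis unfolding avoiding_def aligned_perms_def by blast
qed

text \<open>The second alternative is the one established: positive \<open>b\<close> goes with
  \<open>orient_down\<close>, negative \<open>b\<close> with \<open>orient_up\<close>.\<close>

theorem theorem7p8:
  fixes n :: nat
  assumes "n \<ge> 2"
  defines "S1 \<equiv> avoiding n [[-2,-1], [2,-1], [-2,3,1], [-1,2,-3], [1,2,-3], [2,3,1]]"
      and "S2 \<equiv> avoiding n [[-2,1], [1,-2], [-2,-1,-3], [-1,3,-2], [3,-1,2], [3,1,2]]"
  shows "weak_sublattice n S1 \<and> weak_sublattice n S2 \<and>
         ((iso_to_Cq n S1 (orient_up n) \<and> iso_to_Cq n S2 (orient_down n)) \<or>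
          (iso_to_Cq n S1 (orient_down n) \<and> iso_to_Cq n S2 (orient_up n)))"
  unfolding S1_def S2_def avoiding_eq_aligned_True avoiding_eq_aligned_False
  using weak_sublattice_aligned[of n True] weak_sublattice_aligned[of n False]
    iso_to_Cq_aligned[OF assms(1), of True] iso_to_Cq_aligned[OF assms(1), of False] by simp

end
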